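(* Let $p$ be a prime and let $s\in\mathbb{C}$ with $\operatorname{Re}s\in(0,1)$. Then the map $$\mathrm{FE}_s^{\omega,\mathrm{dec}}(\Gamma_p)\to H^1_{\mathrm{par}}(\Gamma_p;\mathcal{V}_s^{\omega*,\infty}),\qquad f\mapsto[c(f)]$$ is a linear isomorphism of vector spaces. Its inverse is the map $$H^1_{\mathrm{par}}(\Gamma_p;\mathcal{V}_s^{\omega*,\infty})\to\mathrm{FE}_s^{\omega,\mathrm{dec}}(\Gamma_p),\qquad [c]\mapsto f([c]).$$
   Context: **Group.** For a prime $p$ let $\Gamma_p=\mathrm{P}\Gamma_0(p)=\{\begin{bmatrix} a & b \\ c & d \end{bmatrix}\in\mathrm{PSL}(2,\mathbb{Z}) : c\equiv 0 \bmod p\}$, acting on $P^1(\mathbb{R})=\mathbb{R}\cup\{\infty\}$ by Möbius transformations, written $g.t$. Put $T=\begin{bmatrix} 1 & 1 \\ 0 & 1 \end{bmatrix}$. For $k\in\{1,\dots,p-1\}$ let $k'\in\{1,\dots,p-1\}$ be the unique element with $kk'\equiv-1\bmod p$, and let $h_k=\begin{bmatrix} k' & -\frac{kk'+1}{p} \\ p & -k \end{bmatrix}\in\Gamma_p$. (So $h_k^{-1}=h_{k'}$ and $1'=p-1$.) The group $\Gamma_p$ is generated by $T,h_1,\dots,h_{p-1}$. **Action.** For $s\in\mathbb{C}$, $g=\begin{bmatrix} a & b \\ c & d \end{bmatrix}\in\Gamma_p$ and a complex-valued function $\varphi$ on a subset of $\mathbb{R}$, put $(\tau_s(g^{-1})\varphi)(t)=(g'(t))^s\varphi(g.t)=\big((ct+d)^{-2}\big)^s\varphi\big(\frac{at+b}{ct+d}\big)$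 wherever this is well-defined; it is understood as a limit if $c\neq0$ and $t=-d/c$. **Smooth extension.** Smooth means $C^\infty$. A function $\varphi:\mathbb{R}\to\mathbb{C}$ extends smoothly to $P^1(\mathbb{R})$ (relative to $s$) if for some (equivalently any) $g\in\Gamma_p$ not stabilizing $\infty$ both $\varphi$ and $\tau_s(g)\varphi$ are smooth on $\mathbb{R}$. A function defined on $\mathbb{R}$ minus a point extends smoothly to $\mathbb{R}$ (resp. $P^1(\mathbb{R})$) if it is the restriction of a function on $\mathbb{R}$ which is smooth (resp. extends smoothly to $P^1(\mathbb{R})$). **Transfer operator.** Let $I_k=(\frac{k}{p},\infty)$ for $k=0,\dots,p-1$ and $I_p=(-\infty,0)$. The transfer operator $\mathcal{L}_{F,s}$ acts on vectors $f=(f_0,\dots,f_p)^\top$ of functions $f_j:I_j\to\mathbb{C}$ by $\widetilde f=\mathcal{L}_{F,s}f$, where - $\widetilde f_0=\tau_s(T^{-1}h_1)f_0+\tau_s(T^{-1})f_{p-1}$ on $I_0$, - $\widetilde f_p=\tau_s(h_{p-1})f_{p-1}+\tau_s(h_{p-1}T)f_p$ on $I_p$, - $\widetilde f_1=f_0+\tau_s(h_{p-1}T)f_p$ on $I_1$, - $\widetilde f_{k+1}=f_k+\tau_s(h_{k'})f_{k'-1}$ on $I_{k+1}$, for $k\in\{1,\dots,p-2\}$. **Period functions.** $\mathrm{FE}_s^{\omega,\mathrm{dec}}(\Gamma_p)$ is the space of function vectors $f=(f_0,\dots,f_p)^\top$ such that - (PF1) $f_j$ is a complex-valued real-analytic function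 on $I_j$ for $j\in\{0,\dots,p\}$; - (PF2) $f=\mathcal{L}_{F,s}f$; - (PF3) for each $k\in\{1,\dots,p-1\}$ the map equal to $f_k$ on $(\frac{k}{p},\infty)$ and to $-\tau_s(h_{k'})f_{k'}$ on $(-\infty,\frac{k}{p})$ extends smoothly to $\mathbb{R}$; - (PF4) the map equal to $-f_0$ on $(0,\infty)$ and to $f_p$ on $(-\infty,0)$ extends smoothly to $P^1(\mathbb{R})$. **Parabolic cohomology.** $\mathcal{V}_s^{\omega*,\infty}$ is the space of functions $\varphi:\mathbb{R}\to\mathbb{C}$ which are smooth, extend smoothly to $P^1(\mathbb{R})$, and are real-analytic on $\mathbb{R}\setminus E$ for some finite set $E$ depending on $\varphi$; $\Gamma_p$ acts on it by $\tau_s$. Let - $Z^1(\Gamma_p;\mathcal{V}_s^{\omega*,\infty})$ be the space of maps $c:\Gamma_p\to\mathcal{V}_s^{\omega*,\infty}$, $g\mapsto c_g$, with $c_{gh}=\tau_s(h^{-1})c_g+c_h$ for all $g,h\in\Gamma_p$; - $Z^1_{\mathrm{par}}(\Gamma_p;\mathcal{V}_s^{\omega*,\infty})$ be the subspace of those $c$ such that for every parabolic $g\in\Gamma_p$ there is $\psi\in\mathcal{V}_s^{\omega*,\infty}$ with $c_g=\tau_s(g^{-1})\psi-\psi$; - $B^1_{\mathrm{par}}$ be the space of maps $g\mapsto\tau_s(g^{-1})\psi-\psi$ with $\psi\in\mathcal{V}_s^{\omega*,\infty}$; - $H^1_{\mathrm{par}}=Z^1_{\mathrm{par}}/B^1_{\mathrm{par}}$.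 **The map $[c]\mapsto f([c])$.** Each class in $H^1_{\mathrm{par}}(\Gamma_p;\mathcal{V}_s^{\omega*,\infty})$ has a unique representative $c$ with $c_T=0$, and for it there is a unique $\psi\in\mathcal{V}_s^{\omega*,\infty}$ with $c_{h_{p-1}T}=\tau_s(T^{-1}h_1)\psi-\psi$. Define $f([c])=(f_0,\dots,f_p)^\top$ by $f_k=c_{h_k}|_{I_k}$ for $k\in\{1,\dots,p-1\}$, $f_0=-\psi|_{I_0}$ and $f_p=\psi|_{I_p}$. **The map $f\mapsto c(f)$.** For $f\in\mathrm{FE}_s^{\omega,\mathrm{dec}}(\Gamma_p)$, $c=c(f):\Gamma_p\to\mathcal{V}_s^{\omega*,\infty}$ is given on generators by $c_T=0$ and, for $k\in\{1,\dots,p-1\}$, by letting $c_{h_k}$ be the smooth extension of the map equal to $f_k$ on $(\frac{k}{p},\infty)$ and to $-\tau_s(h_{k'})f_{k'}$ on $(-\infty,\frac{k}{p})$; it is extended to $\Gamma_p$ by the cocycle relation $c_{gh}=\tau_s(h^{-1})c_g+c_h$. That this is well-defined and yields an element of $Z^1_{\mathrm{par}}(\Gamma_p;\mathcal{V}_s^{\omega*,\infty})$, and that $f([c])$ lies in $\mathrm{FE}_s^{\omega,\mathrm{dec}}(\Gamma_p)$, is part of the assertion. *)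

theory Defs
  imports
    "HOL-Analysis.Analysis"
    "HOL-Algebra.Coset"
    "HOL-Algebra.AbelCoset"
    "HOL-Algebra.Module"
    "HOL-Number_Theory.Cong"
begin

section \<open>The group\<close>

definition SL2Z :: "(int^2^2) monoid" where
  "SL2Z = \<lparr>carrier = {A. det A = 1}, monoid.mult = (**), one = mat 1\<rparr>"

text \<open>Elements of the quotient are the two-element sets \<open>{A, -A}\<close>.\<close>

definition PSL2Z :: "(int^2^2) set monoid" where
  "PSL2Z = SL2Z Mod {mat 1, - mat 1}"

definition psl :: "int^2^2 \<Rightarrow> (int^2^2) set" where
  "psl A = {mat 1, - mat 1} #>\<^bsub>SL2Z\<^esub> A"

lemma matrix_2_eqI:
  fixes A B :: "int^2^2"
  assumes "A$1$1 = B$1$1" "A$1$2 = B$1$2" "A$2$1 = B$2$1" "A$2$2 = B$2$2"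
  shows "A = B"
  using assms by (simp add: vec_eq_iff forall_2)

lemma group_SL2Z: "group SL2Z"
proof (rule groupI)
  fix A assume "A \<in> carrier SL2Z"
  then have d: "A$1$1 * A$2$2 - A$1$2 * A$2$1 = 1" by (simp add: SL2Z_def det_2)
  define B :: "int^2^2" where "B = vector [vector [A$2$2, - (A$1$2)], vector [- (A$2$1), A$1$1]]"
  have "B ** A = mat 1"
    by (rule matrix_2_eqI; use d in
        \<open>simp add: B_def matrix_matrix_mult_def mat_def sum_2 algebra_simps\<close>)
  moreover have "det B = 1" using d by (simp add: B_def det_2 algebra_simps)
  ultimately show "\<exists>y\<in>carrier SL2Z. y \<otimes>\<^bsub>SL2Z\<^esub> A = \<one>\<^bsub>SL2Z\<^esub>"
    by (auto simp: SL2Z_def)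
qed (auto simp: SL2Z_def det_mul matrix_mul_assoc)

lemma normal_SL2Z: "{mat 1, - mat 1} \<lhd> SL2Z"
proof -
  interpret group SL2Z by (rule group_SL2Z)
  have sq: "(- mat 1 :: int^2^2) ** (- mat 1) = mat 1"
    by (rule matrix_2_eqI; simp add: matrix_matrix_mult_def mat_def sum_2)
  have det: "det (- mat 1 :: int^2^2) = 1" by (simp add: det_2 mat_def)
  have one: "\<one>\<^bsub>SL2Z\<^esub> = mat 1" by (simp add: SL2Z_def)
  have "inv\<^bsub>SL2Z\<^esub> (- mat 1) = - mat 1"
    by (rule inv_equality) (use sq det in \<open>auto simp: SL2Z_def\<close>)
  moreover have "inv\<^bsub>SL2Z\<^esub> (mat 1) = mat 1" using inv_one unfolding one .
  ultimately have sub: "subgroup {mat 1, - mat 1} SL2Z"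
    by unfold_locales (use sq det in \<open>auto simp: SL2Z_def\<close>)
  have comm: "A ** (- mat 1) = (- mat 1) ** A" for A :: "int^2^2"
    by (rule matrix_2_eqI; simp add: matrix_matrix_mult_def mat_def sum_2)
  show ?thesis
    by (rule normalI[OF sub]) (auto simp: r_coset_def l_coset_def SL2Z_def comm)
qed

lemma group_PSL2Z: "group PSL2Z"
  unfolding PSL2Z_def by (rule normal.factorgroup_is_group[OF normal_SL2Z])

lemma psl_eq: "psl A = {A, - A}"
proof -
  have "(- mat 1) ** A = - A"
    by (rule matrix_2_eqI; simp add: matrix_matrix_mult_def mat_def sum_2)
  then show ?thesis by (auto simp: psl_def r_coset_def SL2Z_def)
qed

definition PGamma0 :: "nat \<Rightarrow> (int^2^2) set monoid" where
  "PGamma0 p = PSL2Z\<lparr>carrier := {g \<in> carrier PSL2Z. \<forall>A\<in>g. [A$2$1 = 0] (mod int p)}\<rparr>"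

definition mat2 :: "int \<Rightarrow> int \<Rightarrow> int \<Rightarrow> int \<Rightarrow> int^2^2" where
  "mat2 a b c d = vector [vector [a, b], vector [c, d]]"

definition T_elt :: "(int^2^2) set" where
  "T_elt = psl (mat2 1 1 0 1)"

definition dual_index :: "nat \<Rightarrow> nat \<Rightarrow> nat" where
  "dual_index p k = (THE l. l \<in> {1..p-1} \<and> [int k * int l = -1] (mod int p))"

definition h_elt :: "nat \<Rightarrow> nat \<Rightarrow> (int^2^2) set" where
  "h_elt p k = psl (mat2 (int (dual_index p k)) (- ((int k * int (dual_index p k) + 1) div int p))
                         (int p) (- int k))"

definition parabolic :: "(int^2^2) set \<Rightarrow> bool" where
  "parabolic g \<longleftrightarrow> g \<noteq> \<one>\<^bsub>PSL2Z\<^esub> \<and> (\<forall>A\<in>g. \<bar>trace A\<bar> = 2)"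

text \<open>Since \<open>g.\<infinity> = a/c\<close>, the element \<open>g\<close> stabilizes \<open>\<infinity>\<close> iff \<open>c = 0\<close>.\<close>

definition stabilizes_infinity :: "(int^2^2) set \<Rightarrow> bool" where
  "stabilizes_infinity g \<longleftrightarrow> (\<forall>A\<in>g. A$2$1 = 0)"


section \<open>The action\<close>

text \<open>\<open>slash s A \<phi>\<close> is \<open>\<tau>\<^sub>s(A\<^sup>-\<^sup>1)\<phi>\<close>. The pole \<open>-d/c\<close> is the only zero of \<open>ct + d\<close>, and the value there
  is the limit; when the limit does not exist, the value is unspecified. Functions on a
  subset of the reals are represented by total functions that vanish off that subset; everywhere
  below, the values of \<open>slash s A \<phi>\<close> are only used at points \<open>t\<close> for which \<open>A.t\<close> lies in the domain of
  the function \<open>\<phi>\<close>.\<close>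

definition slash :: "complex \<Rightarrow> int^2^2 \<Rightarrow> (real \<Rightarrow> complex) \<Rightarrow> real \<Rightarrow> complex" where
  "slash s A \<phi> t =
    (let a = real_of_int (A$1$1); b = real_of_int (A$1$2);
         c = real_of_int (A$2$1); d = real_of_int (A$2$2);
         F = (\<lambda>u. complex_of_real (1 / (c * u + d)^2) powr s * \<phi> ((a * u + b) / (c * u + d)))
     in if c * t + d = 0 then Lim (at t) F else F t)"

lemma slash_uminus: "slash s (- A) = slash s A"
proof -
  have 1: "- x * u + - y = - (x * u + y)" for x u y :: real by simp
  show ?thesis
    by (intro ext) (simp only: slash_def Let_def vector_uminus_component of_int_minus 1
        minus_divide_divide power2_minus neg_equal_0_iff_equal)
qed

definition tau :: "complex \<Rightarrow> (int^2^2) set \<Rightarrow> (real \<Rightarrow> complex) \<Rightarrow> real \<Rightarrow> complex" where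
  "tau s g = slash s (SOME A. A \<in> inv\<^bsub>PSL2Z\<^esub> g)"

lemma tau_eq_slash:
  assumes "g \<in> carrier PSL2Z" "A \<in> inv\<^bsub>PSL2Z\<^esub> g"
  shows "tau s g = slash s A"
proof -
  have "inv\<^bsub>PSL2Z\<^esub> g \<in> carrier PSL2Z"
    using group.inv_closed[OF group_PSL2Z] assms(1) .
  then obtain B where "inv\<^bsub>PSL2Z\<^esub> g = psl B"
    by (auto simp: PSL2Z_def FactGroup_def RCOSETS_def psl_def)
  then have B: "inv\<^bsub>PSL2Z\<^esub> g = {B, - B}" by (simp add: psl_eq)
  have "(SOME A. A \<in> inv\<^bsub>PSL2Z\<^esub> g) \<in> inv\<^bsub>PSL2Z\<^esub> g"
    using assms(2) by (rule someI)
  then show ?thesis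
    using assms(2) unfolding tau_def B by (auto simp: slash_uminus)
qed


section \<open>Smooth and real-analytic functions\<close>

definition smooth :: "(real \<Rightarrow> complex) \<Rightarrow> bool" where
  "smooth \<phi> \<longleftrightarrow> (\<forall>n. \<forall>t. ((\<lambda>f t. vector_derivative f (at t)) ^^ n) \<phi> differentiable (at t))"

definition real_analytic_on :: "(real \<Rightarrow> complex) \<Rightarrow> real set \<Rightarrow> bool" where
  "real_analytic_on \<phi> S \<longleftrightarrow>
    (\<forall>x\<in>S. \<exists>a :: nat \<Rightarrow> complex. \<exists>r>0. \<forall>t. \<bar>t - x\<bar> < r \<longrightarrow>
       (\<lambda>n. a n * complex_of_real ((t - x) ^ n)) sums \<phi> t)"

definition extends_smoothly_P1 :: "nat \<Rightarrow> complex \<Rightarrow> (real \<Rightarrow> complex) \<Rightarrow> bool" where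
  "extends_smoothly_P1 p s \<phi> \<longleftrightarrow>
    (\<exists>g\<in>carrier (PGamma0 p). \<not> stabilizes_infinity g \<and> smooth \<phi> \<and> smooth (tau s g \<phi>))"

text \<open>\<open>\<phi>\<close> restricts to \<open>u\<close> on \<open>(x, \<infinity>)\<close> and to \<open>v\<close> on \<open>(-\<infinity>, x)\<close>; its value at \<open>x\<close> is arbitrary.\<close>

definition glues :: "real \<Rightarrow> (real \<Rightarrow> complex) \<Rightarrow> (real \<Rightarrow> complex) \<Rightarrow> (real \<Rightarrow> complex) \<Rightarrow> bool" where
  "glues x u v \<phi> \<longleftrightarrow> (\<forall>t>x. \<phi> t = u t) \<and> (\<forall>t<x. \<phi> t = v t)"


section \<open>Spaces of functions as complex vector spaces\<close>

text \<open>The multiplicative part of a \<open>module\<close> record is irrelevant for its module structure.\<close>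

definition fun_space :: "('i \<Rightarrow> real \<Rightarrow> complex) set \<Rightarrow> (complex, 'i \<Rightarrow> real \<Rightarrow> complex) module" where
  "fun_space X = \<lparr>carrier = X, monoid.mult = undefined, one = undefined,
     ring.zero = (\<lambda>i t. 0), ring.add = (\<lambda>f g i t. f i t + g i t), module.smult = (\<lambda>a f i t. a * f i t)\<rparr>"

definition quotient_space :: "('k, 'v) module \<Rightarrow> 'v set \<Rightarrow> ('k, 'v set) module" where
  "quotient_space M B = \<lparr>carrier = a_rcosets\<^bsub>M\<^esub> B, monoid.mult = undefined, one = undefined,
     ring.zero = B, ring.add = (\<lambda>C D. C <+>\<^bsub>M\<^esub> D), module.smult = (\<lambda>a C. \<Union>x\<in>C. B +>\<^bsub>M\<^esub> (a \<odot>\<^bsub>M\<^esub> x))\<rparr>"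

definition complex_field :: "complex ring" where
  "complex_field = \<lparr>carrier = UNIV, monoid.mult = (*), one = 1, ring.zero = 0, ring.add = (+)\<rparr>"

lemma field_complex_field: "field complex_field"
proof -
  have *: "\<exists>y. x + y = 0" for x :: complex
    by (rule exI[of _ "- x"]) simp
  have **: "x \<noteq> 0 \<Longrightarrow> \<exists>y. x * y = 1" for x :: complex
    by (rule exI[of _ "inverse x"]) simp
  show ?thesis
    by unfold_locales (auto simp: complex_field_def algebra_simps Units_def * **)
qed

definition linear_iso ::
    "'k ring \<Rightarrow> ('k, 'v) module \<Rightarrow> ('k, 'w) module \<Rightarrow> ('v \<Rightarrow> 'w) \<Rightarrow> bool" where
  "linear_iso K M N \<Phi> \<longleftrightarrow>
     field K \<and> module K M \<and> module K N \<and>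
     (\<forall>x\<in>carrier M. \<forall>y\<in>carrier M. \<Phi> (x \<oplus>\<^bsub>M\<^esub> y) = \<Phi> x \<oplus>\<^bsub>N\<^esub> \<Phi> y) \<and>
     (\<forall>a\<in>carrier K. \<forall>x\<in>carrier M. \<Phi> (a \<odot>\<^bsub>M\<^esub> x) = a \<odot>\<^bsub>N\<^esub> \<Phi> x) \<and>
     bij_betw \<Phi> (carrier M) (carrier N)"


section \<open>Period functions\<close>

text \<open>A function vector is a map \<open>f\<close> with \<open>f j = 0\<close> off \<open>I_dom p j\<close>; in particular \<open>f j = 0\<close> for \<open>j > p\<close>.\<close>

definition I_dom :: "nat \<Rightarrow> nat \<Rightarrow> real set" where
  "I_dom p j = (if j < p then {real j / real p <..} else if j = p then {..<0} else {})"

definition function_vectors :: "nat \<Rightarrow> (nat \<Rightarrow> real \<Rightarrow> complex) set" where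
  "function_vectors p = {f. \<forall>j t. t \<notin> I_dom p j \<longrightarrow> f j t = 0}"

text \<open>The last case is the one of the index \<open>j = k + 1\<close> with \<open>k\<close> in \<open>{1..p-2}\<close>.\<close>

definition transfer_op ::
    "nat \<Rightarrow> complex \<Rightarrow> (nat \<Rightarrow> real \<Rightarrow> complex) \<Rightarrow> nat \<Rightarrow> real \<Rightarrow> complex" where
  "transfer_op p s f j t =
    (if t \<notin> I_dom p j then 0
     else if j = 0 then
       tau s (inv\<^bsub>PSL2Z\<^esub> T_elt \<otimes>\<^bsub>PSL2Z\<^esub> h_elt p 1) (f 0) t + tau s (inv\<^bsub>PSL2Z\<^esub> T_elt) (f (p - 1)) t
     else if j = p then
       tau s (h_elt p (p - 1)) (f (p - 1)) t + tau s (h_elt p (p - 1) \<otimes>\<^bsub>PSL2Z\<^esub> T_elt) (f p) t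
     else if j = 1 then
       f 0 t + tau s (h_elt p (p - 1) \<otimes>\<^bsub>PSL2Z\<^esub> T_elt) (f p) t
     else
       f (j - 1) t + tau s (h_elt p (dual_index p (j - 1))) (f (dual_index p (j - 1) - 1)) t)"

definition glues_component ::
    "nat \<Rightarrow> complex \<Rightarrow> (nat \<Rightarrow> real \<Rightarrow> complex) \<Rightarrow> nat \<Rightarrow> (real \<Rightarrow> complex) \<Rightarrow> bool" where
  "glues_component p s f k =
     glues (real k / real p) (f k)
       (\<lambda>t. - tau s (h_elt p (dual_index p k)) (f (dual_index p k)) t)"

definition FE :: "nat \<Rightarrow> complex \<Rightarrow> (nat \<Rightarrow> real \<Rightarrow> complex) set" where
  "FE p s = {f \<in> function_vectors p.
     (\<forall>j\<in>{0..p}. real_analytic_on (f j) (I_dom p j)) \<and>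
     f = transfer_op p s f \<and>
     (\<forall>k\<in>{1..p-1}. \<exists>\<phi>. smooth \<phi> \<and> glues_component p s f k \<phi>) \<and>
     (\<exists>\<phi>. extends_smoothly_P1 p s \<phi> \<and> glues 0 (\<lambda>t. - f 0 t) (f p) \<phi>)}"


section \<open>Parabolic cohomology\<close>

definition V_space :: "nat \<Rightarrow> complex \<Rightarrow> (real \<Rightarrow> complex) set" where
  "V_space p s = {\<phi>. smooth \<phi> \<and> extends_smoothly_P1 p s \<phi> \<and> (\<exists>E. finite E \<and> real_analytic_on \<phi> (- E))}"

text \<open>Maps on \<open>\<Gamma>\<^sub>p\<close> are represented by total maps that vanish off \<open>\<Gamma>\<^sub>p\<close>.\<close>

definition Z1 :: "nat \<Rightarrow> complex \<Rightarrow> ((int^2^2) set \<Rightarrow> real \<Rightarrow> complex) set" where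
  "Z1 p s = {c. (\<forall>g\<in>carrier (PGamma0 p). c g \<in> V_space p s) \<and>
     (\<forall>g. g \<notin> carrier (PGamma0 p) \<longrightarrow> c g = (\<lambda>t. 0)) \<and>
     (\<forall>g\<in>carrier (PGamma0 p). \<forall>h\<in>carrier (PGamma0 p).
        c (g \<otimes>\<^bsub>PSL2Z\<^esub> h) = (\<lambda>t. tau s (inv\<^bsub>PSL2Z\<^esub> h) (c g) t + c h t))}"

definition Z1_par :: "nat \<Rightarrow> complex \<Rightarrow> ((int^2^2) set \<Rightarrow> real \<Rightarrow> complex) set" where
  "Z1_par p s = {c \<in> Z1 p s. \<forall>g\<in>carrier (PGamma0 p). parabolic g \<longrightarrow>
     (\<exists>\<psi>\<in>V_space p s. c g = (\<lambda>t. tau s (inv\<^bsub>PSL2Z\<^esub> g) \<psi> t - \<psi> t))}"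

definition B1_par :: "nat \<Rightarrow> complex \<Rightarrow> ((int^2^2) set \<Rightarrow> real \<Rightarrow> complex) set" where
  "B1_par p s = {c. \<exists>\<psi>\<in>V_space p s. c = (\<lambda>g t.
     if g \<in> carrier (PGamma0 p) then tau s (inv\<^bsub>PSL2Z\<^esub> g) \<psi> t - \<psi> t else 0)}"

definition H1_par :: "nat \<Rightarrow> complex \<Rightarrow> (complex, ((int^2^2) set \<Rightarrow> real \<Rightarrow> complex) set) module" where
  "H1_par p s = quotient_space (fun_space (Z1_par p s)) (B1_par p s)"

definition cohomology_class ::
    "nat \<Rightarrow> complex \<Rightarrow> ((int^2^2) set \<Rightarrow> real \<Rightarrow> complex) \<Rightarrow> ((int^2^2) set \<Rightarrow> real \<Rightarrow> complex) set" where
  "cohomology_class p s c = B1_par p s +>\<^bsub>fun_space (Z1_par p s)\<^esub> c"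


section \<open>The two maps\<close>

definition is_normalized_representative ::
    "((int^2^2) set \<Rightarrow> real \<Rightarrow> complex) set \<Rightarrow> ((int^2^2) set \<Rightarrow> real \<Rightarrow> complex) \<Rightarrow> bool" where
  "is_normalized_representative C c \<longleftrightarrow> c \<in> C \<and> c T_elt = (\<lambda>t. 0)"

definition normalized_representative ::
    "((int^2^2) set \<Rightarrow> real \<Rightarrow> complex) set \<Rightarrow> (int^2^2) set \<Rightarrow> real \<Rightarrow> complex" where
  "normalized_representative C = (THE c. is_normalized_representative C c)"

definition is_cusp_potential ::
    "nat \<Rightarrow> complex \<Rightarrow> ((int^2^2) set \<Rightarrow> real \<Rightarrow> complex) \<Rightarrow> (real \<Rightarrow> complex) \<Rightarrow> bool" where
  "is_cusp_potential p s c \<psi> \<longleftrightarrow> \<psi> \<in> V_space p s \<and>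
     c (h_elt p (p - 1) \<otimes>\<^bsub>PSL2Z\<^esub> T_elt) =
       (\<lambda>t. tau s (inv\<^bsub>PSL2Z\<^esub> T_elt \<otimes>\<^bsub>PSL2Z\<^esub> h_elt p 1) \<psi> t - \<psi> t)"

definition cusp_potential ::
    "nat \<Rightarrow> complex \<Rightarrow> ((int^2^2) set \<Rightarrow> real \<Rightarrow> complex) \<Rightarrow> real \<Rightarrow> complex" where
  "cusp_potential p s c = (THE \<psi>. is_cusp_potential p s c \<psi>)"

definition period_of_class ::
    "nat \<Rightarrow> complex \<Rightarrow> ((int^2^2) set \<Rightarrow> real \<Rightarrow> complex) set \<Rightarrow> nat \<Rightarrow> real \<Rightarrow> complex" where
  "period_of_class p s C j t =
    (let c = normalized_representative C; \<psi> = cusp_potential p s c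
     in if t \<notin> I_dom p j then 0
        else if j = 0 then - \<psi> t
        else if j = p then \<psi> t
        else c (h_elt p j) t)"

definition is_cocycle_of_period ::
    "nat \<Rightarrow> complex \<Rightarrow> (nat \<Rightarrow> real \<Rightarrow> complex) \<Rightarrow> ((int^2^2) set \<Rightarrow> real \<Rightarrow> complex) \<Rightarrow> bool" where
  "is_cocycle_of_period p s f c \<longleftrightarrow> c \<in> Z1 p s \<and> c T_elt = (\<lambda>t. 0) \<and>
     (\<forall>k\<in>{1..p-1}. smooth (c (h_elt p k)) \<and> glues_component p s f k (c (h_elt p k)))"

definition cocycle_of_period ::
    "nat \<Rightarrow> complex \<Rightarrow> (nat \<Rightarrow> real \<Rightarrow> complex) \<Rightarrow> (int^2^2) set \<Rightarrow> real \<Rightarrow> complex" where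
  "cocycle_of_period p s f = (THE c. is_cocycle_of_period p s f c)"

end

theory Submission
  imports Defs "HOL-Complex_Analysis.Cauchy_Integral_Formula"
begin

text \<open>Put \<open>T = (1 1; 0 1)\<close>, \<open>L = (1 0; 1 1)\<close>. Transported to \<open>(0, \<infinity>)\<close>, the components of a period
  function become functions \<open>F x\<close> indexed by the classes \<open>x\<close> of rows in \<open>P\<^sup>1(\<int>/p)\<close>, and the equation
  \<open>f = transfer_op p s f\<close> becomes Lewis' equation \<open>F x = F (x T\<inverse>)|T + F (x L\<inverse>)|L\<close>. The
  conditions on the glued functions extend \<open>F\<close> to the line, where the equation persists because it
  is invariant under rotation of the Farey triangle \<open>0, - 1, \<infinity>\<close>. It says that \<open>F\<close> defines a
  closed, \<open>Gamma0 p\<close>-equivariant 1-cochain on the Farey complex. Recursion on the denominators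
  integrates it to a potential \<open>P\<close> on the cusps, and \<open>c\<^sub>g = P (g\<inverse>.\<infinity>) - P \<infinity>\<close> is the cocycle; \<open>P\<close>
  also trivializes it on every parabolic element, since such an element fixes a cusp.

  Conversely, the components of a normalized cocycle satisfy Lewis' equation and are analytic off a
  finite set. On the finite set of singularities in \<open>(0, \<infinity>)\<close> the branches \<open>T\<close> and \<open>L\<close> induce a
  permutation; going around a cycle gives a hyperbolic contraction \<open>\<gamma>\<close> fixing the singularity such
  that \<open>f - f|\<gamma>\<close> is analytic there, and iteration shows that \<open>f\<close> is analytic too. Uniqueness of all
  choices holds because a translation invariant element of the module decays at infinity, as
  \<open>0 < Re s\<close>, and hence vanishes.\<close>

section \<open>Smooth and real-analytic germs\<close>

text \<open>Prescribing a cocycle on generators would require checking all relations of the group.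
  As a difference of potentials it is defined on all matrices at once, and generation by
  \<open>T_mat\<close> and the \<open>H_mat k\<close> enters only through uniqueness. Classes of
  rows appear because conjugation by diag(p, 1) turns divisibility of the lower left entry by
  \<open>p\<close> into divisibility of the upper right one. The conjugated group acts from the left
  on the matrices of oriented Farey edges, and its orbits are told apart by the upper row up to
  scaling modulo \<open>p\<close>. The technical obstacle is the pole of \<open>slash\<close>. The
  value there is a limit, so neither additivity nor composition of matrices is available for
  arbitrary functions. The components of a period function vanish off their intervals and are
  handled pointwise, away from poles, until they are glued to elements of \<open>V s\<close>; for
  those, continuity fills in the poles. Since the intervals are rescaled by matrices of determinant
  \<open>p\<close>, the action is set up for all integral matrices with nonzero determinant.\<close>

primrec diff_times :: "nat \<Rightarrow> real set \<Rightarrow> (real \<Rightarrow> complex) \<Rightarrow> bool" where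
  "diff_times 0 U f = True"
| "diff_times (Suc n) U f =
    (\<exists>f'. (\<forall>t\<in>U. (f has_vector_derivative f' t) (at t)) \<and> diff_times n U f')"

lemma diff_times_cong:
  assumes "open U" "\<And>t. t \<in> U \<Longrightarrow> f t = g t" "diff_times n U f"
  shows "diff_times n U g"
proof (cases n)
  case (Suc m)
  then obtain f' where f': "\<forall>t\<in>U. (f has_vector_derivative f' t) (at t)" "diff_times m U f'"
    using assms(3) by auto
  have "\<forall>t\<in>U. (g has_vector_derivative f' t) (at t)"
    using f'(1) assms(1,2) has_vector_derivative_transform_within_open by blast
  then show ?thesis using f'(2) Suc by auto
qed simp

lemma diff_times_SucD: "diff_times (Suc n) U f \<Longrightarrow> diff_times n U f"
  by (induction n arbitrary: f) (simp, metis diff_times.simps(2))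

lemma diff_times_subset: "diff_times n U f \<Longrightarrow> V \<subseteq> U \<Longrightarrow> diff_times n V f"
  by (induction n arbitrary: f) (simp, metis diff_times.simps(2) subsetD)

lemma diff_times_add:
  "diff_times n U f \<Longrightarrow> diff_times n U g \<Longrightarrow> diff_times n U (\<lambda>t. f t + g t)"
proof (induction n arbitrary: f g)
  case (Suc n)
  then obtain f' g' where f': "\<forall>t\<in>U. (f has_vector_derivative f' t) (at t)" "diff_times n U f'"
    and g': "\<forall>t\<in>U. (g has_vector_derivative g' t) (at t)" "diff_times n U g'" by auto
  have "diff_times n U (\<lambda>t. f' t + g' t)" using Suc.IH f'(2) g'(2) by blast
  moreover have "\<forall>t\<in>U. ((\<lambda>t. f t + g t) has_vector_derivative f' t + g' t) (at t)"
    using f'(1) g'(1) by (auto intro: has_vector_derivative_add)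
  ultimately show ?case
    unfolding diff_times.simps by (intro exI[of _ "\<lambda>t. f' t + g' t"]) auto
qed simp

lemma diff_times_mult:
  "diff_times n U f \<Longrightarrow> diff_times n U g \<Longrightarrow> diff_times n U (\<lambda>t. f t * g t)"
proof (induction n arbitrary: f g)
  case (Suc n)
  then obtain f' g' where f': "\<forall>t\<in>U. (f has_vector_derivative f' t) (at t)" "diff_times n U f'"
    and g': "\<forall>t\<in>U. (g has_vector_derivative g' t) (at t)" "diff_times n U g'" by auto
  have "diff_times n U f" "diff_times n U g" using Suc.prems diff_times_SucD by blast+
  then have "diff_times n U (\<lambda>t. f t * g' t + f' t * g t)"
    using Suc.IH f'(2) g'(2) by (intro diff_times_add) auto
  moreover have "\<forall>t\<in>U. ((\<lambda>t. f t * g t) has_vector_derivative f t * g' t + f' t * g t) (at t)"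
    using f'(1) g'(1) by (auto intro: has_vector_derivative_mult)
  ultimately show ?case
    unfolding diff_times.simps by (intro exI[of _ "\<lambda>t. f t * g' t + f' t * g t"]) auto
qed simp

lemma diff_times_holomorphic:
  assumes "open W" "\<And>t. t \<in> U \<Longrightarrow> complex_of_real t \<in> W" "G holomorphic_on W"
  shows "diff_times n U (\<lambda>t. G (of_real t))"
  using assms(3)
proof (induction n arbitrary: G)
  case (Suc n)
  have "deriv G holomorphic_on W" using Suc.prems assms(1) by (rule holomorphic_deriv)
  then have "diff_times n U (\<lambda>t. deriv G (of_real t))" by (rule Suc.IH)
  moreover have "\<forall>t\<in>U. ((\<lambda>t. G (of_real t)) has_vector_derivative deriv G (of_real t)) (at t)"
    using assms(1,2) Suc.prems
    by (auto intro!: has_vector_derivative_real_field holomorphic_derivI)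
  ultimately show ?case
    unfolding diff_times.simps by (intro exI[of _ "\<lambda>t. deriv G (of_real t)"]) auto
qed simp

lemma diff_times_compose:
  fixes m m' :: "real \<Rightarrow> real"
  assumes m: "\<And>t. t \<in> U \<Longrightarrow> (m has_real_derivative m' t) (at t)" "m ` U \<subseteq> V"
    and m': "\<And>n. diff_times n U (\<lambda>t. of_real (m' t))"
    and f: "diff_times n V f"
  shows "diff_times n U (\<lambda>t. f (m t))"
  using f
proof (induction n arbitrary: f)
  case (Suc n)
  then obtain f' where f': "\<forall>t\<in>V. (f has_vector_derivative f' t) (at t)" "diff_times n V f'" by auto
  have "diff_times n U (\<lambda>t. of_real (m' t) * f' (m t))"
    using diff_times_mult[OF m' Suc.IH[OF f'(2)]] .
  moreover have "((\<lambda>t. f (m t)) has_vector_derivative of_real (m' t) * f' (m t)) (at t)" if "t \<in> U" for t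
  proof -
    have 1: "(m has_vector_derivative m' t) (at t)"
      using m(1)[OF that] by (simp add: has_real_derivative_iff_has_vector_derivative)
    have 2: "(f has_vector_derivative f' (m t)) (at (m t))" using f'(1) m(2) that by auto
    show ?thesis using vector_diff_chain_at[OF 1 2] by (simp add: o_def scaleR_conv_of_real)
  qed
  ultimately show ?case
    unfolding diff_times.simps by (intro exI[of _ "\<lambda>t. of_real (m' t) * f' (m t)"]) auto
qed simp

text \<open>\<open>smooth\<close> iterates \<open>vector_derivative\<close>, whose values carry no
  information where the derivative does not exist. \<open>diff_times\<close> asks for some
  derivative on a set instead, which makes the inductions for sums, products and compositions
  direct; on open sets the two agree by uniqueness of derivatives.\<close>

lemma diff_times_iff:
  assumes "open U"
  shows "diff_times n U f \<longleftrightarrow>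
    (\<forall>i<n. \<forall>t\<in>U. ((\<lambda>f t. vector_derivative f (at t)) ^^ i) f differentiable (at t))"
proof (induction n arbitrary: f)
  case (Suc n)
  let ?D = "\<lambda>f t. vector_derivative f (at t) :: complex"
  have "diff_times (Suc n) U f \<longleftrightarrow> (\<forall>t\<in>U. f differentiable (at t)) \<and> diff_times n U (?D f)"
  proof
    assume "diff_times (Suc n) U f"
    then obtain f' where f': "\<forall>t\<in>U. (f has_vector_derivative f' t) (at t)" "diff_times n U f'" by auto
    moreover have "f' t = ?D f t" if "t \<in> U" for t
      using f'(1) that vector_derivative_at by metis
    ultimately show "(\<forall>t\<in>U. f differentiable (at t)) \<and> diff_times n U (?D f)"
      using diff_times_cong[OF assms, of f' "?D f" n] differentiableI_vector by blast
  next
    assume "(\<forall>t\<in>U. f differentiable (at t)) \<and> diff_times n U (?D f)"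
    then show "diff_times (Suc n) U f"
      unfolding diff_times.simps
      by (intro exI[of _ "?D f"]) (simp add: vector_derivative_works)
  qed
  also have "\<dots> \<longleftrightarrow> (\<forall>i<Suc n. \<forall>t\<in>U. (?D ^^ i) f differentiable (at t))"
    unfolding Suc.IH All_less_Suc2 funpow_Suc_right o_def by simp
  finally show ?case .
qed simp

definition smooth_at :: "(real \<Rightarrow> complex) \<Rightarrow> real \<Rightarrow> bool" where
  "smooth_at f t \<longleftrightarrow> (\<exists>U. open U \<and> t \<in> U \<and> (\<forall>n. diff_times n U f))"

lemma smooth_iff_smooth_at: "smooth f \<longleftrightarrow> (\<forall>t. smooth_at f t)"
proof
  assume "smooth f"
  then show "\<forall>t. smooth_at f t"
    unfolding smooth_def smooth_at_def by (metis diff_times_iff open_UNIV UNIV_I)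
next
  assume *: "\<forall>t. smooth_at f t"
  show "smooth f"
    unfolding smooth_def
  proof (intro allI)
    fix n t
    obtain U where "open U" "t \<in> U" "diff_times (Suc n) U f"
      using * unfolding smooth_at_def by blast
    then show "((\<lambda>f t. vector_derivative f (at t)) ^^ n) f differentiable (at t)"
      using diff_times_iff by blast
  qed
qed

lemma smooth_at_cong:
  assumes "smooth_at f t" "\<forall>\<^sub>F u in nhds t. f u = g u"
  shows "smooth_at g t"
proof -
  obtain U V where U: "open U" "t \<in> U" "\<And>n. diff_times n U f"
    and V: "open V" "t \<in> V" "\<And>u. u \<in> V \<Longrightarrow> f u = g u"
    using assms unfolding smooth_at_def eventually_nhds by blast
  have "diff_times n (U \<inter> V) g" for n
    by (rule diff_times_cong[of _ f]) (use U V diff_times_subset[of n U f "U \<inter> V"] in auto)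
  then show ?thesis unfolding smooth_at_def using U V by (intro exI[of _ "U \<inter> V"]) auto
qed

lemma smooth_at_add:
  assumes "smooth_at f t" "smooth_at g t" shows "smooth_at (\<lambda>u. f u + g u) t"
proof -
  obtain U V where U: "open U" "t \<in> U" "\<And>n. diff_times n U f"
    and V: "open V" "t \<in> V" "\<And>n. diff_times n V g"
    using assms unfolding smooth_at_def by blast
  then have "diff_times n (U \<inter> V) (\<lambda>u. f u + g u)" for n
    by (intro diff_times_add) (auto intro: diff_times_subset[of n U] diff_times_subset[of n V])
  then show ?thesis unfolding smooth_at_def using U V by (intro exI[of _ "U \<inter> V"]) auto
qed

lemma smooth_at_mult:
  assumes "smooth_at f t" "smooth_at g t" shows "smooth_at (\<lambda>u. f u * g u) t"
proof -
  obtain U V where U: "open U" "t \<in> U" "\<And>n. diff_times n U f"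
    and V: "open V" "t \<in> V" "\<And>n. diff_times n V g"
    using assms unfolding smooth_at_def by blast
  then have "diff_times n (U \<inter> V) (\<lambda>u. f u * g u)" for n
    by (intro diff_times_mult) (auto intro: diff_times_subset[of n U] diff_times_subset[of n V])
  then show ?thesis unfolding smooth_at_def using U V by (intro exI[of _ "U \<inter> V"]) auto
qed

lemma smooth_at_holomorphic:
  assumes "open W" "complex_of_real t \<in> W" "G holomorphic_on W"
  shows "smooth_at (\<lambda>u. G (of_real u)) t"
proof -
  have "open (complex_of_real -` W)"
    using assms(1) by (intro open_vimage) (auto intro: continuous_intros)
  then show ?thesis
    unfolding smooth_at_def
    using assms
    by (intro exI[of _ "complex_of_real -` W"]) (auto intro!: diff_times_holomorphic[of W])
qed

lemma smooth_at_const: "smooth_at (\<lambda>u. k) t"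
  using smooth_at_holomorphic[of UNIV t "\<lambda>_. k"] by simp

lemma smooth_at_isCont:
  assumes "smooth_at f t" shows "isCont f t"
proof -
  obtain U where "t \<in> U" "diff_times (Suc 0) U f"
    using assms unfolding smooth_at_def by blast
  then obtain f' where "(f has_vector_derivative f' t) (at t)" by auto
  then show ?thesis by (rule has_vector_derivative_continuous)
qed

lemma smooth_at_compose:
  fixes m m' :: "real \<Rightarrow> real"
  assumes U: "open U" "t \<in> U" and m: "\<And>u. u \<in> U \<Longrightarrow> (m has_real_derivative m' u) (at u)"
    and m': "\<And>n. diff_times n U (\<lambda>u. of_real (m' u))" and f: "smooth_at f (m t)"
  shows "smooth_at (\<lambda>u. f (m u)) t"
proof -
  obtain V where V: "open V" "m t \<in> V" "\<And>n. diff_times n V f"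
    using f unfolding smooth_at_def by blast
  have "continuous_on U m"
    using m by (meson DERIV_isCont continuous_at_imp_continuous_on)
  then have o: "open (U \<inter> m -` V)"
    using U(1) V(1) by (metis Int_commute continuous_on_open_vimage)
  have "diff_times n (U \<inter> m -` V) (\<lambda>u. f (m u))" for n
    by (rule diff_times_compose[where m' = m' and V = V])
      (use m V(3) diff_times_subset[OF m', of "U \<inter> m -` V"] in auto)
  then show ?thesis
    unfolding smooth_at_def using o U V by (intro exI[of _ "U \<inter> m -` V"]) auto
qed

lemma smooth_isCont: "smooth f \<Longrightarrow> isCont f t"
  by (simp add: smooth_iff_smooth_at smooth_at_isCont)

lemma smooth_add: "smooth f \<Longrightarrow> smooth g \<Longrightarrow> smooth (\<lambda>t. f t + g t)"
  by (simp add: smooth_iff_smooth_at smooth_at_add)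

lemma smooth_cmult: "smooth f \<Longrightarrow> smooth (\<lambda>t. k * f t)"
  by (simp add: smooth_iff_smooth_at smooth_at_mult smooth_at_const)

definition analytic_at :: "(real \<Rightarrow> complex) \<Rightarrow> real \<Rightarrow> bool" where
  "analytic_at f t \<longleftrightarrow> (\<exists>G W. open W \<and> complex_of_real t \<in> W \<and> G holomorphic_on W \<and>
     (\<forall>u. complex_of_real u \<in> W \<longrightarrow> f u = G (of_real u)))"

text \<open>A power series that converges on a real interval converges on the complex disc over it,
  and Taylor expansion gives the converse. Holomorphic germs can be composed with Moebius maps
  without rearranging series.\<close>

lemma real_analytic_on_iff: "real_analytic_on f S \<longleftrightarrow> (\<forall>x\<in>S. analytic_at f x)"
proof -
  have "(\<exists>a r. r > 0 \<and> (\<forall>t. \<bar>t - x\<bar> < r \<longrightarrow>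
      (\<lambda>n. a n * complex_of_real ((t - x) ^ n)) sums f t)) \<longleftrightarrow> analytic_at f x" for x
  proof
    assume "\<exists>a r. r > 0 \<and> (\<forall>t. \<bar>t - x\<bar> < r \<longrightarrow>
      (\<lambda>n. a n * complex_of_real ((t - x) ^ n)) sums f t)"
    then obtain a r where r: "r > 0"
      and a: "\<And>t. \<bar>t - x\<bar> < r \<Longrightarrow> (\<lambda>n. a n * (complex_of_real t - of_real x) ^ n) sums f t" by auto
    define G where "G z = (\<Sum>n. a n * (z - complex_of_real x) ^ n)" for z
    have "(\<lambda>n. a n * (z - complex_of_real x) ^ n) sums G z" if z: "z \<in> ball (of_real x) r" for z
    proof -
      \<comment> \<open>Convergence is known at real points only, so \<open>z\<close> is compared
        with the real point \<open>x + q\<close>, which is farther from the centre.\<close>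
      obtain q where q: "norm (z - of_real x) < q" "q < r"
        using z dense by (metis dist_commute dist_norm mem_ball)
      have "q > 0" using q(1) norm_ge_zero le_less_trans by blast
      then have "summable (\<lambda>n. a n * (complex_of_real q) ^ n)"
        using a[of "x + q"] q by (auto simp: sums_iff)
      then have "summable (\<lambda>n. a n * (z - complex_of_real x) ^ n)"
        using powser_inside[of a "of_real q" "z - of_real x"] q(1) \<open>q > 0\<close> by simp
      then show ?thesis unfolding G_def by (rule summable_sums)
    qed
    then have "G holomorphic_on ball (of_real x) r" by (rule power_series_holomorphic)
    moreover have "f u = G (of_real u)" if "complex_of_real u \<in> ball (of_real x) r" for u
    proof -
      have "\<bar>u - x\<bar> < r" using that by (simp add: dist_commute dist_real_def)
      then show ?thesis using a[of u] by (simp add: G_def sums_iff)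
    qed
    ultimately show "analytic_at f x"
      unfolding analytic_at_def using r by (meson centre_in_ball open_ball)
  next
    assume "analytic_at f x"
    then obtain G W where W: "open W" "complex_of_real x \<in> W" "G holomorphic_on W"
      "\<forall>u. complex_of_real u \<in> W \<longrightarrow> f u = G (of_real u)" unfolding analytic_at_def by blast
    then obtain r where r: "r > 0" "ball (of_real x) r \<subseteq> W" by (meson openE)
    have "(\<lambda>n. (deriv ^^ n) G (of_real x) / fact n * complex_of_real ((t - x) ^ n)) sums f t"
      if "\<bar>t - x\<bar> < r" for t
    proof -
      have "complex_of_real t \<in> ball (of_real x) r"
        using that by (simp add: dist_commute dist_real_def)
      then show ?thesis
        using holomorphic_power_series[of G "of_real x" r "of_real t"] W r
        by (metis (no_types, lifting) holomorphic_on_subset of_real_diff of_real_power subsetD sums_cong)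
    qed
    then show "\<exists>a r. r > 0 \<and> (\<forall>t. \<bar>t - x\<bar> < r \<longrightarrow>
      (\<lambda>n. a n * complex_of_real ((t - x) ^ n)) sums f t)"
      using r(1) by (intro exI[of _ "\<lambda>n. (deriv ^^ n) G (of_real x) / fact n"] exI[of _ r]) auto
  qed
  then show ?thesis unfolding real_analytic_on_def by auto
qed

lemma analytic_at_add:
  assumes "analytic_at f t" "analytic_at g t" shows "analytic_at (\<lambda>u. f u + g u) t"
proof -
  obtain G W H V where "open W" "complex_of_real t \<in> W" "G holomorphic_on W"
    "\<forall>u. complex_of_real u \<in> W \<longrightarrow> f u = G (of_real u)"
    "open V" "complex_of_real t \<in> V" "H holomorphic_on V"
    "\<forall>u. complex_of_real u \<in> V \<longrightarrow> g u = H (of_real u)"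
    using assms unfolding analytic_at_def by blast
  then show ?thesis
    unfolding analytic_at_def
    by (intro exI[of _ "\<lambda>z. G z + H z"] exI[of _ "W \<inter> V"])
      (auto intro!: holomorphic_intros intro: holomorphic_on_subset)
qed

lemma analytic_at_cmult:
  assumes "analytic_at f t" shows "analytic_at (\<lambda>u. k * f u) t"
proof -
  obtain G W where "open W" "complex_of_real t \<in> W" "G holomorphic_on W"
    "\<forall>u. complex_of_real u \<in> W \<longrightarrow> f u = G (of_real u)"
    using assms unfolding analytic_at_def by blast
  then show ?thesis
    unfolding analytic_at_def
    by (intro exI[of _ "\<lambda>z. k * G z"] exI[of _ W]) (auto intro!: holomorphic_intros)
qed

lemma analytic_at_cong:
  assumes "analytic_at f t" "\<forall>\<^sub>F u in nhds t. f u = g u"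
  shows "analytic_at g t"
proof -
  obtain G W where W: "open W" "complex_of_real t \<in> W" "G holomorphic_on W"
    "\<forall>u. complex_of_real u \<in> W \<longrightarrow> f u = G (of_real u)"
    using assms(1) unfolding analytic_at_def by blast
  obtain e where e: "e > 0" "\<And>u. dist u t < e \<Longrightarrow> f u = g u"
    using assms(2) unfolding eventually_nhds_metric by blast
  have "g u = G (of_real u)" if "complex_of_real u \<in> W \<inter> ball (of_real t) e" for u
    using that W(4) e(2)[of u] by (simp add: dist_commute)
  then show ?thesis
    unfolding analytic_at_def using W e(1)
    by (intro exI[of _ G] exI[of _ "W \<inter> ball (of_real t) e"])
      (auto intro: holomorphic_on_subset)
qed

section \<open>The action of integral matrices\<close>

lemma mat2_sel [simp]:
  "mat2 a b c d $ 1 $ 1 = a" "mat2 a b c d $ 1 $ 2 = b"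
  "mat2 a b c d $ 2 $ 1 = c" "mat2 a b c d $ 2 $ 2 = d"
  by (simp_all add: mat2_def)

lemma mat2_eta: "mat2 (A$1$1) (A$1$2) (A$2$1) (A$2$2) = A"
  by (rule matrix_2_eqI) simp_all

lemma mat2_mult [simp]:
  "mat2 a b c d ** mat2 a' b' c' d' =
    mat2 (a * a' + b * c') (a * b' + b * d') (c * a' + d * c') (c * b' + d * d')"
  by (rule matrix_2_eqI) (simp_all add: matrix_matrix_mult_def sum_2)

lemma mat2_uminus [simp]: "- mat2 a b c d = mat2 (- a) (- b) (- c) (- d)"
  by (rule matrix_2_eqI) simp_all

lemma mat2_one: "mat 1 = mat2 1 0 0 1"
  by (rule matrix_2_eqI) (simp_all add: mat_def)

lemma det_mat2 [simp]: "det (mat2 a b c d) = a * d - b * c"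
  by (simp add: det_2)

lemma mat2_eq_iff [simp]: "mat2 a b c d = mat2 a' b' c' d' \<longleftrightarrow> a = a' \<and> b = b' \<and> c = c' \<and> d = d'"
  by (metis mat2_sel)

definition adj :: "int^2^2 \<Rightarrow> int^2^2" where
  "adj A = mat2 (A$2$2) (- (A$1$2)) (- (A$2$1)) (A$1$1)"

lemma adj_mat2 [simp]: "adj (mat2 a b c d) = mat2 d (- b) (- c) a"
  by (simp add: adj_def)

lemma det_adj [simp]: "det (adj A) = det A"
  by (simp add: adj_def det_2)

lemma adj_adj [simp]: "adj (adj A) = A"
  by (simp add: adj_def mat2_eta)

lemma mult_adj: "det A = 1 \<Longrightarrow> A ** adj A = mat 1" "det A = 1 \<Longrightarrow> adj A ** A = mat 1"
  by (subst (1 2) mat2_eta[of A, symmetric], simp add: mat2_one det_2 algebra_simps adj_def)+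

definition den :: "int^2^2 \<Rightarrow> real \<Rightarrow> real" where
  "den A t = of_int (A$2$1) * t + of_int (A$2$2)"

definition mob :: "int^2^2 \<Rightarrow> real \<Rightarrow> real" where
  "mob A t = (of_int (A$1$1) * t + of_int (A$1$2)) / den A t"

definition weight :: "complex \<Rightarrow> real \<Rightarrow> complex" where
  "weight s x = complex_of_real (1 / x^2) powr s"

text \<open>With \<open>x\<close> replaced by a complex number, the right-hand side is holomorphic
  wherever the square of that number has positive real part, a region that contains the nonzero
  reals of both signs.\<close>

lemma weight_eq: "x \<noteq> 0 \<Longrightarrow> weight s x = exp (- s * Ln ((complex_of_real x)^2))"
proof -
  assume "x \<noteq> 0"
  then have "x^2 > 0" by simp
  have "Ln (complex_of_real (1 / x^2)) = of_real (ln (1 / x^2))"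
    using \<open>x^2 > 0\<close> by (intro Ln_of_real) simp
  also have "ln (1 / x^2) = - ln (x^2)" using \<open>x^2 > 0\<close> by (simp add: ln_div)
  also have "complex_of_real (- ln (x^2)) = - Ln (complex_of_real (x^2))"
    using \<open>x^2 > 0\<close> by (simp add: Ln_of_real del: of_real_power)
  finally show ?thesis using \<open>x \<noteq> 0\<close> by (simp add: weight_def powr_def)
qed

lemma weight_mult: "weight s (x * y) = weight s x * weight s y"
proof -
  have "weight s (x * y) = (complex_of_real (1 / x^2) * complex_of_real (1 / y^2)) powr s"
    by (simp add: weight_def power_mult_distrib)
  also have "\<dots> = weight s x * weight s y"
    unfolding weight_def by (rule powr_times_real) auto
  finally show ?thesis .
qed

lemma weight_one [simp]: "weight s 1 = 1" by (simp add: weight_def)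

lemma weight_nonzero: "x \<noteq> 0 \<Longrightarrow> weight s x \<noteq> 0" by (simp add: weight_def)

lemma slash_regular: "den A t \<noteq> 0 \<Longrightarrow> slash s A \<phi> t = weight s (den A t) * \<phi> (mob A t)"
  by (simp add: slash_def den_def mob_def weight_def Let_def)

lemma slash_pole:
  "den A t = 0 \<Longrightarrow> slash s A \<phi> t = Lim (at t) (\<lambda>u. weight s (den A u) * \<phi> (mob A u))"
  by (simp add: slash_def den_def mob_def weight_def Let_def)

lemma den_mult: "den B t \<noteq> 0 \<Longrightarrow> den (A ** B) t = den A (mob B t) * den B t"
  by (simp add: den_def mob_def matrix_matrix_mult_def sum_2 field_simps)

lemma mob_mult: "den B t \<noteq> 0 \<Longrightarrow> mob (A ** B) t = mob A (mob B t)"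
proof -
  assume B: "den B t \<noteq> 0"
  have "of_int ((A ** B)$1$1) * t + of_int ((A ** B)$1$2) =
      (of_int (A$1$1) * mob B t + of_int (A$1$2)) * den B t"
    using B by (simp add: den_def mob_def matrix_matrix_mult_def sum_2 field_simps)
  then show ?thesis unfolding mob_def[of "A ** B"] mob_def[of A] den_mult[OF B] using B by simp
qed

lemma slash_mult_regular:
  assumes "den B t \<noteq> 0" "den A (mob B t) \<noteq> 0"
  shows "slash s (A ** B) \<phi> t = slash s B (slash s A \<phi>) t"
  using assms by (simp add: slash_regular den_mult mob_mult weight_mult)

lemma finite_den_zero: "det A \<noteq> 0 \<Longrightarrow> finite {t. den A t = 0}"
proof (cases "A$2$1 = 0")
  case False
  then have "{t. den A t = 0} \<subseteq> {- of_int (A$2$2) / of_int (A$2$1)}"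
    by (auto simp: den_def field_simps)
  then show ?thesis using finite_subset by blast
qed (auto simp: den_def det_2)

lemma eventually_den: "det A \<noteq> 0 \<Longrightarrow> \<forall>\<^sub>F u in at t. den A u \<noteq> 0"
proof -
  assume "det A \<noteq> 0"
  then have "\<forall>\<^sub>F u in at t. \<forall>x\<in>{t. den A t = 0}. u \<noteq> x"
    by (intro eventually_ball_finite finite_den_zero) (auto intro: eventually_neq_at_within)
  then show ?thesis by eventually_elim auto
qed

lemma isCont_den: "isCont (den A) t"
  unfolding den_def by (intro continuous_intros)

lemma eventually_nhds_den: "den A t \<noteq> 0 \<Longrightarrow> \<forall>\<^sub>F u in nhds t. den A u \<noteq> 0"
  using isCont_den[of t A] tendsto_imp_eventually_ne[of "den A" "den A t" "at t" 0]
  by (auto simp: isCont_def eventually_nhds_conv_at)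

lemma mob_has_derivative:
  assumes "den A t \<noteq> 0"
  shows "(mob A has_real_derivative of_int (det A) / (den A t)^2) (at t)"
proof -
  have "((\<lambda>t. (of_int (A$1$1) * t + of_int (A$1$2)) / (of_int (A$2$1) * t + of_int (A$2$2)))
    has_real_derivative of_int (det A) / (den A t)^2) (at t)"
    using assms unfolding den_def
    by (auto intro!: derivative_eq_intros simp: det_2 power2_eq_square field_simps)
  then show ?thesis unfolding mob_def den_def .
qed

lemma smooth_at_slash:
  assumes A: "den A t \<noteq> 0" and \<phi>: "smooth_at \<phi> (mob A t)"
  shows "smooth_at (slash s A \<phi>) t"
proof -
  define D where "D z = of_int (A$2$1) * z + of_int (A$2$2)" for z :: complex
  have D: "D (of_real u) = of_real (den A u)" for u by (simp add: D_def den_def)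
  have hD: "D holomorphic_on X" for X unfolding D_def by (intro holomorphic_intros)
  have cD: "continuous_on X D" for X unfolding D_def by (intro continuous_intros)
  have U: "open {u. den A u \<noteq> 0}"
    unfolding den_def by (intro open_Collect_neq continuous_intros)
  have "smooth_at (\<lambda>u. exp (- s * Ln ((D (of_real u))^2))) t"
  proof (rule smooth_at_holomorphic)
    show "open {z. Re ((D z)^2) > 0}"
      by (intro open_Collect_less continuous_intros cD)
    show "complex_of_real t \<in> {z. Re ((D z)^2) > 0}"
      using A by (simp add: D flip: of_real_power)
    show "(\<lambda>z. exp (- s * Ln ((D z)^2))) holomorphic_on {z. Re ((D z)^2) > 0}"
      by (intro holomorphic_intros hD) (auto simp: complex_nonpos_Reals_iff)
  qed
  then have w: "smooth_at (\<lambda>u. weight s (den A u)) t"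
  proof (rule smooth_at_cong)
    show "\<forall>\<^sub>F u in nhds t. exp (- s * Ln ((D (of_real u))^2)) = weight s (den A u)"
      using eventually_nhds_den[OF A] by eventually_elim (simp add: D weight_eq)
  qed
  have "smooth_at (\<lambda>u. \<phi> (mob A u)) t"
  proof (rule smooth_at_compose[OF U])
    show "diff_times n {u. den A u \<noteq> 0} (\<lambda>u. complex_of_real (of_int (det A) / (den A u)^2))" for n
    proof -
      have "diff_times n {u. den A u \<noteq> 0} (\<lambda>u. of_int (det A) / (D (of_real u))^2)"
        by (rule diff_times_holomorphic[of "{z. D z \<noteq> 0}"])
          (auto intro!: holomorphic_intros hD open_Collect_neq cD continuous_intros simp: D)
      then show ?thesis by (simp add: D)
    qed
  qed (use A \<phi> mob_has_derivative in auto)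
  with w have "smooth_at (\<lambda>u. weight s (den A u) * \<phi> (mob A u)) t" by (rule smooth_at_mult)
  then show ?thesis
  proof (rule smooth_at_cong)
    show "\<forall>\<^sub>F u in nhds t. weight s (den A u) * \<phi> (mob A u) = slash s A \<phi> u"
      using eventually_nhds_den[OF A] by eventually_elim (simp add: slash_regular)
  qed
qed

lemma analytic_at_slash:
  assumes A: "den A t \<noteq> 0" and \<phi>: "analytic_at \<phi> (mob A t)"
  shows "analytic_at (slash s A \<phi>) t"
proof -
  define D where "D z = of_int (A$2$1) * z + of_int (A$2$2)" for z :: complex
  define N where "N z = of_int (A$1$1) * z + of_int (A$1$2)" for z :: complex
  have D: "D (of_real u) = of_real (den A u)" for u by (simp add: D_def den_def)
  have N: "N (of_real u) / D (of_real u) = of_real (mob A u)" for u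
    by (simp add: N_def D_def mob_def den_def)
  have hD: "D holomorphic_on X" "N holomorphic_on X" for X
    unfolding D_def N_def by (intro holomorphic_intros)+
  have cD: "continuous_on X D" "continuous_on X N" for X
    unfolding D_def N_def by (intro continuous_intros)+
  obtain G W where W: "open W" "complex_of_real (mob A t) \<in> W" "G holomorphic_on W"
    "\<And>u. complex_of_real u \<in> W \<Longrightarrow> \<phi> u = G (of_real u)"
    using \<phi> unfolding analytic_at_def by blast
  define V where "V = {z. Re ((D z)^2) > 0}"
  have V: "open V" unfolding V_def by (intro open_Collect_less continuous_intros cD)
  have V0: "D z \<noteq> 0" if "z \<in> V" for z using that by (auto simp: V_def)
  define V' where "V' = (\<lambda>z. N z / D z) -` W \<inter> V"
  have V': "open V'"
    unfolding V'_def
    by (rule continuous_on_open_vimage[THEN iffD1, rule_format, OF V _ W(1)])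
      (use V0 in \<open>auto intro!: continuous_intros cD\<close>)
  have "slash s A \<phi> u = exp (- s * Ln ((D (of_real u))^2)) * G (N (of_real u) / D (of_real u))"
    if "complex_of_real u \<in> V'" for u
  proof -
    have "den A u \<noteq> 0" using that V0[of "of_real u"] by (auto simp: V'_def D)
    moreover have "complex_of_real (mob A u) \<in> W" using that by (simp add: V'_def N)
    ultimately show ?thesis by (simp add: N slash_regular weight_eq W(4) flip: D)
  qed
  moreover have "(\<lambda>z. exp (- s * Ln ((D z)^2)) * G (N z / D z)) holomorphic_on V'"
  proof (intro holomorphic_intros hD)
    have "(G \<circ> (\<lambda>z. N z / D z)) holomorphic_on V'"
      by (rule holomorphic_on_compose_gen[OF _ W(3)])
        (use V0 in \<open>auto intro!: holomorphic_intros hD simp: V'_def\<close>)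
    then show "(\<lambda>z. G (N z / D z)) holomorphic_on V'" by (simp add: o_def)
  qed (auto simp: V'_def V_def complex_nonpos_Reals_iff)
  moreover have "complex_of_real t \<in> V'"
    unfolding V'_def V_def vimage_def using A W(2)
    by (auto simp only: N mem_Collect_eq Int_iff) (simp add: D flip: of_real_power)
  ultimately show ?thesis
    unfolding analytic_at_def using V' by blast
qed

section \<open>The module of smooth, piecewise analytic functions\<close>

definition S_mat :: "int^2^2" where "S_mat = mat2 0 (- 1) 1 0"

text \<open>Smoothness at infinity is tested with one matrix outside the level \<open>p\<close>
  group. By \<open>smooth_slash\<close> every integral matrix of nonzero determinant that moves
  infinity gives the same condition, so the notion does not involve \<open>p\<close>.\<close>

definition smooth_P1 :: "complex \<Rightarrow> (real \<Rightarrow> complex) \<Rightarrow> bool" where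
  "smooth_P1 s \<phi> \<longleftrightarrow> smooth \<phi> \<and> smooth (slash s S_mat \<phi>)"

lemma isCont_eqI:
  fixes f g :: "real \<Rightarrow> complex"
  assumes "isCont f t" "isCont g t" "\<forall>\<^sub>F u in at t. f u = g u"
  shows "f t = g t"
proof -
  have "(f \<longlongrightarrow> g t) (at t)"
    using assms(2) unfolding isCont_def
    by (rule Lim_transform_eventually) (use assms(3) in \<open>simp add: eq_commute\<close>)
  then show ?thesis using assms(1) tendsto_unique[of "at t"] by (auto simp: isCont_def)
qed

lemma eventually_at_notin_finite:
  fixes t :: real shows "finite E \<Longrightarrow> \<forall>\<^sub>F u in at t. u \<notin> E"
proof -
  assume "finite E"
  then have "\<forall>\<^sub>F u in at t. \<forall>x\<in>E. u \<noteq> x"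
    by (intro eventually_ball_finite) (auto intro: eventually_neq_at_within)
  then show ?thesis by eventually_elim auto
qed

lemma smooth_eqI:
  assumes "smooth f" "smooth g" "finite E" "\<And>t. t \<notin> E \<Longrightarrow> f t = g t"
  shows "f = g"
proof
  fix t
  have "\<forall>\<^sub>F u in at t. f u = g u"
    using eventually_at_notin_finite[OF assms(3)] by eventually_elim (rule assms(4))
  then show "f t = g t" using isCont_eqI smooth_isCont assms(1,2) by blast
qed

text \<open>The way to evaluate the \<open>Lim\<close> at a pole: a continuous function that agrees
  with \<open>slash s A \<phi>\<close> around the pole also gives the value at it.\<close>

lemma slash_eq_limit:
  assumes "isCont g t" "\<forall>\<^sub>F u in at t. slash s A \<phi> u = g u" "det A \<noteq> 0" "den A t = 0"
  shows "slash s A \<phi> t = g t"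
proof -
  have "\<forall>\<^sub>F u in at t. g u = weight s (den A u) * \<phi> (mob A u)"
    using assms(2) eventually_den[OF assms(3), of t]
    by eventually_elim (simp add: slash_regular)
  then have "((\<lambda>u. weight s (den A u) * \<phi> (mob A u)) \<longlongrightarrow> g t) (at t)"
    using assms(1) unfolding isCont_def by (rule Lim_transform_eventually[rotated])
  then show ?thesis unfolding slash_pole[OF assms(4)] by (intro tendsto_Lim) auto
qed

lemma eventually_slash_mult:
  assumes "det A \<noteq> 0" "det B \<noteq> 0"
  shows "\<forall>\<^sub>F u in at t. slash s (A ** B) \<phi> u = slash s B (slash s A \<phi>) u"
proof -
  have "det (A ** B) \<noteq> 0" using assms by (simp add: det_mul)
  from eventually_den[OF this, of t] eventually_den[OF assms(2), of t] show ?thesis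
    by eventually_elim (rule slash_mult_regular, auto simp: den_mult)
qed

lemma slash_scalar: "n \<noteq> 0 \<Longrightarrow> slash s (mat2 n 0 0 n) \<phi> = (\<lambda>t. weight s (of_int n) * \<phi> t)"
  by (rule ext) (subst slash_regular; simp add: den_def mob_def)

lemma slash_one [simp]: "slash s (mat2 1 0 0 1) \<phi> = \<phi>"
  by (simp add: slash_scalar)

lemma slash_zero [simp]: "slash s A (\<lambda>t. 0) = (\<lambda>t. 0)"
proof
  fix t :: real
  have "Lim (at t) (\<lambda>u. 0 :: complex) = 0" by (intro tendsto_Lim tendsto_const at_neq_bot)
  then show "slash s A (\<lambda>t. 0) t = 0"
    by (cases "den A t = 0") (simp_all add: slash_regular slash_pole)
qed

lemma slash_shift: "slash s (mat2 1 m 0 1) \<phi> t = \<phi> (t + of_int m)"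
  by (subst slash_regular) (simp_all add: den_def mob_def)

text \<open>Only a pole \<open>t\<close> of \<open>A\<close> is critical. There \<open>A\<close> is
  written, up to the scalar det A0, as A0 times \<open>adj A0 ** A\<close>. Since \<open>A\<close>
  sends \<open>t\<close> to infinity and the inverse of A0 sends infinity to a finite point, the
  second factor is regular at \<open>t\<close>, and the assumption on A0 applies.\<close>

lemma smooth_slash:
  assumes \<phi>: "smooth \<phi>" "smooth (slash s A0 \<phi>)" and A0: "A0 $ 2 $ 1 \<noteq> 0" "det A0 \<noteq> 0"
    and A: "det A \<noteq> 0"
  shows "smooth (slash s A \<phi>)"
  unfolding smooth_iff_smooth_at
proof
  fix t
  show "smooth_at (slash s A \<phi>) t"
  proof (cases "den A t = 0")
    case False
    then show ?thesis using \<phi>(1) by (simp add: smooth_at_slash smooth_iff_smooth_at)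
  next
    case True
    define B where "B = adj A0 ** A"
    define n where "n = det A0"
    have AB: "A0 ** B = mat2 n 0 0 n ** A"
      by (rule matrix_2_eqI)
        (simp_all add: B_def n_def adj_def det_2 matrix_matrix_mult_def sum_2 algebra_simps)
    have detB: "det B \<noteq> 0" using A A0 by (simp add: B_def det_mul)
    \<comment> \<open>Numerator and denominator of \<open>mob A\<close> have no common zero, since
      the determinant is a combination of their values.\<close>
    have num: "of_int (A$1$1) * t + of_int (A$1$2) \<noteq> 0"
    proof
      assume *: "of_int (A$1$1) * t + of_int (A$1$2) = 0"
      have "of_int (A$1$1 * A$2$2 - A$1$2 * A$2$1) =
        of_int (A$1$1) * den A t - of_int (A$2$1) * (of_int (A$1$1) * t + of_int (A$1$2))"
        by (simp add: den_def algebra_simps)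
      then show False using True * A by (simp add: det_2 del: of_int_mult of_int_diff)
    qed
    have "den B t = of_int (A0$1$1) * den A t - of_int (A0$2$1) * (of_int (A$1$1) * t + of_int (A$1$2))"
      by (simp add: B_def adj_def den_def matrix_matrix_mult_def sum_2 algebra_simps)
    then have denB: "den B t \<noteq> 0" using True num A0(1) by simp
    define g where "g u = inverse (weight s (of_int n)) * slash s B (slash s A0 \<phi>) u" for u
    have g: "smooth_at g t"
      unfolding g_def using denB \<phi>(2)
      by (intro smooth_at_mult smooth_at_const smooth_at_slash[where A = B])
        (auto simp: smooth_iff_smooth_at)
    have ev: "\<forall>\<^sub>F u in at t. slash s A \<phi> u = g u"
      using eventually_slash_mult[OF A0(2) detB, of s \<phi> t] eventually_den[OF A, of t]
    proof eventually_elim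
      case (elim u)
      have "slash s (mat2 n 0 0 n ** A) \<phi> u = slash s A (slash s (mat2 n 0 0 n) \<phi>) u"
        using elim(2) A0(2) by (intro slash_mult_regular) (auto simp: den_def n_def)
      also have "\<dots> = weight s (of_int n) * slash s A \<phi> u"
        using elim(2) A0(2) by (simp add: slash_scalar n_def slash_regular)
      finally show ?case
        using elim(1) A0(2) weight_nonzero[of "of_int n" s] by (simp add: AB g_def n_def field_simps)
    qed
    moreover have "slash s A \<phi> t = g t"
      using slash_eq_limit[OF smooth_at_isCont[OF g] ev A True] .
    ultimately have "\<forall>\<^sub>F u in nhds t. g u = slash s A \<phi> u"
      by (simp add: eventually_nhds_conv_at eq_commute)
    then show ?thesis by (rule smooth_at_cong[OF g])
  qed
qed

lemma det_S_mat [simp]: "det S_mat = 1" by (simp add: S_mat_def)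

lemma smooth_P1_slash_smooth:
  "smooth_P1 s \<phi> \<Longrightarrow> det A \<noteq> 0 \<Longrightarrow> smooth (slash s A \<phi>)"
  unfolding smooth_P1_def by (erule conjE, rule smooth_slash[of _ _ S_mat]) (auto simp: S_mat_def)

lemma smooth_P1I:
  "smooth \<phi> \<Longrightarrow> smooth (slash s A \<phi>) \<Longrightarrow> A $ 2 $ 1 \<noteq> 0 \<Longrightarrow> det A \<noteq> 0 \<Longrightarrow> smooth_P1 s \<phi>"
  unfolding smooth_P1_def using smooth_slash[of \<phi> s A S_mat] by simp

text \<open>The identity holds off finitely many points by pure algebra, and the left side is
  continuous. The right side is continuous where \<open>B\<close> is regular and is a limit by
  definition where it is not.\<close>

lemma smooth_P1_slash_mult:
  assumes \<phi>: "smooth_P1 s \<phi>" and "det A \<noteq> 0" "det B \<noteq> 0"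
  shows "slash s (A ** B) \<phi> = slash s B (slash s A \<phi>)"
proof
  fix t
  have AB: "isCont (slash s (A ** B) \<phi>) t"
    using assms by (intro smooth_isCont smooth_P1_slash_smooth) (auto simp: det_mul)
  have ev: "\<forall>\<^sub>F u in at t. slash s B (slash s A \<phi>) u = slash s (A ** B) \<phi> u"
    using eventually_slash_mult[OF assms(2,3), of s \<phi> t] by eventually_elim simp
  have "slash s B (slash s A \<phi>) t = slash s (A ** B) \<phi> t"
  proof (cases "den B t = 0")
    case True
    then show ?thesis using slash_eq_limit[OF AB ev assms(3)] by simp
  next
    case False
    then have "isCont (slash s B (slash s A \<phi>)) t"
      using smooth_P1_slash_smooth[OF assms(1,2)]
      by (intro smooth_at_isCont smooth_at_slash[where A = B]) (auto simp: smooth_iff_smooth_at)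
    then show ?thesis using isCont_eqI AB ev by blast
  qed
  then show "slash s (A ** B) \<phi> t = slash s B (slash s A \<phi>) t" by simp
qed

text \<open>Equal to \<open>V_space p s\<close> by \<open>V_space_eq\<close>, but free of
  \<open>p\<close> and stable under all integral matrices of nonzero determinant, in particular
  under the rescalings \<open>B_mat j\<close>.\<close>

definition V :: "complex \<Rightarrow> (real \<Rightarrow> complex) set" where
  "V s = {\<phi>. smooth_P1 s \<phi> \<and> (\<exists>E. finite E \<and> (\<forall>t. t \<notin> E \<longrightarrow> analytic_at \<phi> t))}"

lemma V_smooth_P1: "\<phi> \<in> V s \<Longrightarrow> smooth_P1 s \<phi>" by (simp add: V_def)

lemma V_smooth: "\<phi> \<in> V s \<Longrightarrow> smooth \<phi>" by (simp add: V_def smooth_P1_def)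

lemma V_slash_mult:
  "\<phi> \<in> V s \<Longrightarrow> det A \<noteq> 0 \<Longrightarrow> det B \<noteq> 0 \<Longrightarrow> slash s (A ** B) \<phi> = slash s B (slash s A \<phi>)"
  by (simp add: V_smooth_P1 smooth_P1_slash_mult)

lemma V_slash:
  assumes \<phi>: "\<phi> \<in> V s" and A: "det A \<noteq> 0" shows "slash s A \<phi> \<in> V s"
proof -
  have "smooth (slash s S_mat (slash s A \<phi>))"
    using smooth_P1_slash_smooth[OF V_smooth_P1[OF \<phi>], of "A ** S_mat"] A
    by (simp add: V_slash_mult[OF \<phi>] det_mul)
  then have 1: "smooth_P1 s (slash s A \<phi>)"
    using smooth_P1_slash_smooth[OF V_smooth_P1[OF \<phi>] A] by (simp add: smooth_P1_def)
  obtain E where E: "finite E" "\<And>t. t \<notin> E \<Longrightarrow> analytic_at \<phi> t"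
    using \<phi> unfolding V_def by blast
  have inj: "inj_on (mob A) (- {t. den A t = 0})"
  proof (rule inj_onI)
    fix t u assume tu: "t \<in> - {t. den A t = 0}" "u \<in> - {t. den A t = 0}" "mob A t = mob A u"
    then have "(of_int (A$1$1) * t + of_int (A$1$2)) * den A u =
      (of_int (A$1$1) * u + of_int (A$1$2)) * den A t" by (simp add: mob_def field_simps)
    then have "of_int (det A) * (t - u) = 0" by (simp add: den_def det_2 algebra_simps)
    then show "t = u" using A by simp
  qed
  let ?E = "{t. den A t = 0} \<union> (mob A -` E \<inter> - {t. den A t = 0})"
  have "finite ?E"
    using finite_den_zero[OF A] finite_vimage_IntI[OF E(1) inj] by blast
  moreover have "analytic_at (slash s A \<phi>) t" if "t \<notin> ?E" for t
    using that by (intro analytic_at_slash E(2)) auto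
  ultimately show ?thesis using 1 unfolding V_def by blast
qed

lemma slash_add:
  assumes "smooth_P1 s \<phi>" "smooth_P1 s \<psi>" "det A \<noteq> 0"
  shows "slash s A (\<lambda>t. \<phi> t + \<psi> t) = (\<lambda>t. slash s A \<phi> t + slash s A \<psi> t)"
proof
  fix t
  show "slash s A (\<lambda>t. \<phi> t + \<psi> t) t = slash s A \<phi> t + slash s A \<psi> t"
  proof (cases "den A t = 0")
    case True
    show ?thesis
    proof (rule slash_eq_limit[OF _ _ assms(3) True])
      show "isCont (\<lambda>t. slash s A \<phi> t + slash s A \<psi> t) t"
        using assms by (intro smooth_isCont smooth_add smooth_P1_slash_smooth)
      show "\<forall>\<^sub>F u in at t. slash s A (\<lambda>t. \<phi> t + \<psi> t) u = slash s A \<phi> u + slash s A \<psi> u"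
        using eventually_den[OF assms(3), of t]
        by eventually_elim (simp add: slash_regular distrib_left)
    qed
  qed (simp add: slash_regular distrib_left)
qed

lemma slash_cmult:
  assumes "smooth_P1 s \<phi>" "det A \<noteq> 0"
  shows "slash s A (\<lambda>t. k * \<phi> t) = (\<lambda>t. k * slash s A \<phi> t)"
proof
  fix t
  show "slash s A (\<lambda>t. k * \<phi> t) t = k * slash s A \<phi> t"
  proof (cases "den A t = 0")
    case True
    show ?thesis
    proof (rule slash_eq_limit[OF _ _ assms(2) True])
      show "isCont (\<lambda>t. k * slash s A \<phi> t) t"
        using assms by (intro smooth_isCont smooth_cmult smooth_P1_slash_smooth)
      show "\<forall>\<^sub>F u in at t. slash s A (\<lambda>t. k * \<phi> t) u = k * slash s A \<phi> u"
        using eventually_den[OF assms(2), of t]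
        by eventually_elim (simp add: slash_regular)
    qed
  qed (simp add: slash_regular)
qed

lemma V_slash_add:
  "\<phi> \<in> V s \<Longrightarrow> \<psi> \<in> V s \<Longrightarrow> det A \<noteq> 0 \<Longrightarrow>
    slash s A (\<lambda>t. \<phi> t + \<psi> t) = (\<lambda>t. slash s A \<phi> t + slash s A \<psi> t)"
  by (simp add: slash_add V_smooth_P1)

lemma V_slash_cmult:
  "\<phi> \<in> V s \<Longrightarrow> det A \<noteq> 0 \<Longrightarrow> slash s A (\<lambda>t. k * \<phi> t) = (\<lambda>t. k * slash s A \<phi> t)"
  by (simp add: slash_cmult V_smooth_P1)

lemma V_add:
  assumes "\<phi> \<in> V s" "\<psi> \<in> V s" shows "(\<lambda>t. \<phi> t + \<psi> t) \<in> V s"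
proof -
  obtain E D where "finite E" "\<And>t. t \<notin> E \<Longrightarrow> analytic_at \<phi> t"
    "finite D" "\<And>t. t \<notin> D \<Longrightarrow> analytic_at \<psi> t"
    using assms unfolding V_def by blast
  then have "\<exists>E. finite E \<and> (\<forall>t. t \<notin> E \<longrightarrow> analytic_at (\<lambda>t. \<phi> t + \<psi> t) t)"
    by (intro exI[of _ "E \<union> D"]) (auto intro: analytic_at_add)
  moreover have "smooth_P1 s (\<lambda>t. \<phi> t + \<psi> t)"
    using assms by (simp add: V_def smooth_P1_def slash_add smooth_add)
  ultimately show ?thesis by (simp add: V_def)
qed

lemma V_cmult:
  assumes "\<phi> \<in> V s" shows "(\<lambda>t. k * \<phi> t) \<in> V s"
proof -
  obtain E where "finite E" "\<And>t. t \<notin> E \<Longrightarrow> analytic_at \<phi> t"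
    using assms unfolding V_def by blast
  then have "\<exists>E. finite E \<and> (\<forall>t. t \<notin> E \<longrightarrow> analytic_at (\<lambda>t. k * \<phi> t) t)"
    by (intro exI[of _ E]) (auto intro: analytic_at_cmult)
  moreover have "smooth_P1 s (\<lambda>t. k * \<phi> t)"
    using assms by (simp add: V_def smooth_P1_def slash_cmult smooth_cmult)
  ultimately show ?thesis by (simp add: V_def)
qed

lemma V_uminus: "\<phi> \<in> V s \<Longrightarrow> (\<lambda>t. - \<phi> t) \<in> V s"
  using V_cmult[of \<phi> s "- 1"] by simp

lemma V_diff: "\<phi> \<in> V s \<Longrightarrow> \<psi> \<in> V s \<Longrightarrow> (\<lambda>t. \<phi> t - \<psi> t) \<in> V s"
  using V_add[OF _ V_uminus, of \<phi> s \<psi>] by simp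

lemma V_zero: "(\<lambda>t. 0) \<in> V s"
proof -
  have "smooth (\<lambda>t. 0)" by (simp add: smooth_iff_smooth_at smooth_at_const)
  moreover have "analytic_at (\<lambda>t. 0) t" for t
    unfolding analytic_at_def by (intro exI[of _ "\<lambda>_. 0"] exI[of _ UNIV]) auto
  ultimately show ?thesis unfolding V_def smooth_P1_def by auto
qed

lemma V_slash_uminus:
  "\<phi> \<in> V s \<Longrightarrow> det A \<noteq> 0 \<Longrightarrow> slash s A (\<lambda>t. - \<phi> t) = (\<lambda>t. - slash s A \<phi> t)"
  using V_slash_cmult[of \<phi> s A "- 1"] by simp

lemma V_slash_diff:
  "\<phi> \<in> V s \<Longrightarrow> \<psi> \<in> V s \<Longrightarrow> det A \<noteq> 0 \<Longrightarrow>
    slash s A (\<lambda>t. \<phi> t - \<psi> t) = (\<lambda>t. slash s A \<phi> t - slash s A \<psi> t)"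
  using V_slash_add[OF _ V_uminus, of \<phi> s \<psi> A] by (simp add: V_slash_uminus)

lemma V_eqI:
  "f \<in> V s \<Longrightarrow> g \<in> V s \<Longrightarrow> finite E \<Longrightarrow> (\<And>t. t \<notin> E \<Longrightarrow> f t = g t) \<Longrightarrow> f = g"
  using smooth_eqI V_smooth by blast

lemma V_slash_adj:
  assumes "\<phi> \<in> V s" "det A = 1"
  shows "slash s A (slash s (adj A) \<phi>) = \<phi>" "slash s (adj A) (slash s A \<phi>) = \<phi>"
  using V_slash_mult[OF assms(1), of "adj A" A] V_slash_mult[OF assms(1), of A "adj A"] assms(2)
  by (simp_all add: mult_adj mat2_one)

text \<open>An element of \<open>V s\<close> decays like \<open>|t| powr (- 2 * Re s)\<close> at infinity.\<close>

lemma V_shift_invariant_eq_zero: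
  assumes \<phi>: "\<phi> \<in> V s" and s: "0 < Re s" and m: "m \<noteq> 0"
    and inv: "slash s (mat2 1 m 0 1) \<phi> = \<phi>"
  shows "\<phi> = (\<lambda>t. 0)"
proof
  fix t
  define x where "x n = t + real n * of_int m" for n :: nat
  define \<omega> where "\<omega> = slash s S_mat \<phi>"
  have per: "\<phi> (u + of_int m) = \<phi> u" for u using fun_cong[OF inv, of u] by (simp add: slash_shift)
  have \<phi>x: "\<phi> (x n) = \<phi> t" for n
    using per[of "x _"] by (induction n) (auto simp: x_def algebra_simps)
  have "slash s S_mat \<omega> = \<phi>"
    using V_slash_mult[OF \<phi>, of S_mat S_mat] slash_uminus[of s "mat2 1 0 0 1"]
    by (simp add: \<omega>_def S_mat_def)
  then have \<phi>\<omega>: "\<phi> u = weight s u * \<omega> (- 1 / u)" if "u \<noteq> 0" for u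
    using slash_regular[of S_mat u s \<omega>] that by (simp add: S_mat_def den_def mob_def)
  have lin: "filterlim x at_infinity sequentially"
    unfolding x_def
  proof (rule tendsto_add_filterlim_at_infinity[OF tendsto_const])
    have "filterlim real at_infinity sequentially"
      using filterlim_real_sequentially by (rule filterlim_at_top_imp_at_infinity)
    then show "filterlim (\<lambda>n. real n * of_int m) at_infinity sequentially"
      using tendsto_mult_filterlim_at_infinity[OF tendsto_const[of "real_of_int m"], of real] m
      by (simp add: mult.commute)
  qed
  have ne: "\<forall>\<^sub>F n in sequentially. x n \<noteq> 0"
    using lin by (auto dest: filterlim_at_infinity_imp_eventually_ne)
  have inv0: "(\<lambda>n. inverse (x n)) \<longlonglongrightarrow> 0"
    using lin tendsto_inverse_0 filterlim_compose by blast
  have "isCont \<omega> 0"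
    unfolding \<omega>_def using V_smooth[OF V_slash[OF \<phi>, of S_mat]] by (simp add: smooth_isCont)
  then have "(\<lambda>n. \<omega> (- inverse (x n))) \<longlonglongrightarrow> \<omega> 0"
    by (rule isCont_tendsto_compose) (use tendsto_minus[OF inv0] in simp)
  moreover have "(\<lambda>n. weight s (x n)) \<longlonglongrightarrow> 0"
  proof (rule tendsto_norm_zero_cancel)
    have "(\<lambda>n. (inverse (x n))^2) \<longlonglongrightarrow> 0" using tendsto_power[OF inv0, of 2] by simp
    then have "(\<lambda>n. ((inverse (x n))^2) powr Re s) \<longlonglongrightarrow> 0"
      by (rule tendsto_zero_powrI) (use s in auto)
    moreover have "norm (weight s (x n)) = ((inverse (x n))^2) powr Re s" for n
      unfolding weight_def
      by (subst norm_powr_real_powr) (auto simp: field_simps)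
    ultimately show "(\<lambda>n. norm (weight s (x n))) \<longlonglongrightarrow> 0" by simp
  qed
  ultimately have "(\<lambda>n. weight s (x n) * \<omega> (- inverse (x n))) \<longlonglongrightarrow> 0 * \<omega> 0"
    by (intro tendsto_mult)
  then have "(\<lambda>n. \<phi> (x n)) \<longlonglongrightarrow> 0 * \<omega> 0"
    by (rule Lim_transform_eventually)
      (use ne in eventually_elim, simp add: \<phi>\<omega> divide_inverse)
  then show "\<phi> t = 0" by (simp add: \<phi>x LIMSEQ_const_iff)
qed

text \<open>\<open>S_mat\<close> conjugates the stabilizer of the cusp 0 to translations, so this is
  the preceding lemma seen from the cusp 0.\<close>

lemma V_lower_shift_invariant_eq_zero:
  assumes \<phi>: "\<phi> \<in> V s" and s: "0 < Re s" and m: "m \<noteq> 0"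
    and inv: "slash s (mat2 1 0 m 1) \<phi> = \<phi>"
  shows "\<phi> = (\<lambda>t. 0)"
proof -
  define \<omega> where "\<omega> = slash s S_mat \<phi>"
  have \<omega>: "\<omega> \<in> V s" unfolding \<omega>_def by (rule V_slash[OF \<phi>]) simp
  have "slash s (mat2 1 (- m) 0 1) \<omega> = slash s (S_mat ** mat2 1 (- m) 0 1) \<phi>"
    unfolding \<omega>_def by (subst V_slash_mult[OF \<phi>]) auto
  also have "S_mat ** mat2 1 (- m) 0 1 = mat2 1 0 m 1 ** S_mat" by (simp add: S_mat_def)
  also have "slash s \<dots> \<phi> = \<omega>"
    unfolding \<omega>_def by (subst V_slash_mult[OF \<phi>]) (simp_all add: inv)
  finally have "\<omega> = (\<lambda>t. 0)" using V_shift_invariant_eq_zero[OF \<omega> s, of "- m"] m by simp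
  then show ?thesis using V_slash_adj(2)[OF \<phi>, of S_mat] by (simp add: \<omega>_def)
qed

section \<open>Regularity of solutions of the three-term equation\<close>

text \<open>Iterating the equation writes \<open>f\<close> as a geometrically convergent series of holomorphic
  functions.\<close>

lemma analytic_at_functional_equation:
  fixes f :: "real \<Rightarrow> complex" and g :: "real \<Rightarrow> real" and G w h :: "complex \<Rightarrow> complex"
  assumes W: "open W" "complex_of_real x \<in> W"
    and hol: "G holomorphic_on W" "w holomorphic_on W" "h holomorphic_on W"
    and Gg: "\<And>t. complex_of_real t \<in> W \<Longrightarrow> G (of_real t) = of_real (g t)"
    and contr: "\<And>z. z \<in> W \<Longrightarrow> norm (G z - of_real x) \<le> norm (z - of_real x)"
    and w: "norm (w (of_real x)) < 1"
    and eq: "\<And>t. complex_of_real t \<in> W \<Longrightarrow> f t = w (of_real t) * f (g t) + h (of_real t)"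
    and cont: "isCont f x"
  shows "analytic_at f x"
proof -
  obtain \<kappa> where \<kappa>: "norm (w (of_real x)) < \<kappa>" "\<kappa> < 1" using w dense by blast
  then have \<kappa>0: "0 \<le> \<kappa>" using norm_ge_zero le_less_trans less_imp_le by blast
  have ic: "isCont w (of_real x)" "isCont h (of_real x)"
    using hol W by (auto simp: holomorphic_on_imp_continuous_on continuous_on_interior interior_open
        intro!: continuous_on_interior[of W])
  have ew: "\<forall>\<^sub>F z in nhds (of_real x). norm (w z) < \<kappa>"
    using ic(1) \<kappa>(1) by (intro order_tendstoD(2)[OF tendsto_norm])
      (auto simp: isCont_def tendsto_at_iff_tendsto_nhds)
  have eh: "\<forall>\<^sub>F z in nhds (of_real x). norm (h z) < norm (h (of_real x)) + 1"
    using ic(2) by (intro order_tendstoD(2)[OF tendsto_norm])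
      (auto simp: isCont_def tendsto_at_iff_tendsto_nhds)
  have ef: "\<forall>\<^sub>F t in nhds x. norm (f t) < norm (f x) + 1"
    using cont by (intro order_tendstoD(2)[OF tendsto_norm])
      (auto simp: isCont_def tendsto_at_iff_tendsto_nhds)
  have eW: "\<forall>\<^sub>F z in nhds (of_real x). z \<in> W" using W eventually_nhds by blast
  obtain r1 where r1: "r1 > 0" "\<And>z. dist z (of_real x) < r1 \<Longrightarrow>
      z \<in> W \<and> norm (w z) < \<kappa> \<and> norm (h z) < norm (h (of_real x)) + 1"
    using eventually_conj[OF eW eventually_conj[OF ew eh]] unfolding eventually_nhds_metric by blast
  obtain r2 where r2: "r2 > 0" "\<And>t. dist t x < r2 \<Longrightarrow> norm (f t) < norm (f x) + 1"
    using ef unfolding eventually_nhds_metric by blast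
  define B where "B = ball (complex_of_real x) (min r1 r2)"
  define Ch where "Ch = norm (h (of_real x)) + 1"
  define Cf where "Cf = norm (f x) + 1"
  have B: "z \<in> W" "norm (w z) \<le> \<kappa>" "norm (h z) \<le> Ch" if "z \<in> B" for z
    using r1(2)[of z] that by (auto simp: B_def Ch_def dist_commute)
  have Bf: "norm (f t) \<le> Cf" if "complex_of_real t \<in> B" for t
  proof -
    have "dist t x < r2" using that by (simp add: B_def dist_commute)
    then show ?thesis using r2(2) by (auto simp: Cf_def less_imp_le)
  qed
  \<comment> \<open>The weak inequality in \<open>contr\<close> is enough: it keeps the iterates in
    discs about \<open>x\<close>, while convergence comes from the factor \<kappa> < 1 gained with
    every weight.\<close>
  have GB: "G z \<in> B" if "z \<in> B" for z
    using contr[OF B(1)[OF that]] that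
    by (auto simp: B_def dist_norm norm_minus_commute)
  have GnB: "(G ^^ n) z \<in> B" if "z \<in> B" for z n
    by (induction n) (use that GB in auto)
  have Gn: "(G ^^ n) holomorphic_on B" for n
  proof (induction n)
    case 0 show ?case by (simp add: id_def)
  next
    case (Suc n)
    have "(G \<circ> (G ^^ n)) holomorphic_on B"
      using Suc hol(1) GnB B(1) by (intro holomorphic_on_compose_gen[of _ B _ W]) auto
    then show ?case by (simp add: o_def)
  qed
  define P where "P n z = (\<Prod>i<n. w ((G ^^ i) z))" for n z
  define u where "u n z = P n z * h ((G ^^ n) z)" for n z
  have P: "norm (P n z) \<le> \<kappa> ^ n" if "z \<in> B" for n z
    unfolding P_def using B(2)[OF GnB[OF that]]
    by (induction n) (auto simp: norm_mult mult.commute intro!: mult_mono \<kappa>0)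
  have compG: "(\<lambda>z. k ((G ^^ n) z)) holomorphic_on B" if "k holomorphic_on W" for k n
  proof -
    have "(k \<circ> (G ^^ n)) holomorphic_on B"
      using that GnB B(1) by (intro holomorphic_on_compose_gen[OF Gn, of _ W]) auto
    then show ?thesis by (simp add: o_def)
  qed
  have uh: "u n holomorphic_on B" for n
    unfolding u_def P_def by (intro holomorphic_intros compG hol)
  have ub: "norm (u n z) \<le> \<kappa> ^ n * Ch" if "z \<in> B" for n z
    unfolding u_def norm_mult using P[OF that] B(3)[OF GnB[OF that]] \<kappa>0
    by (intro mult_mono) auto
  have summ: "summable (\<lambda>n. \<kappa> ^ n * Ch)"
    using \<kappa> \<kappa>0 by (intro summable_mult2 summable_geometric) auto
  define F where "F z = (\<Sum>n. u n z)" for z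
  have ul: "uniform_limit B (\<lambda>n z. \<Sum>i<n. u i z) F sequentially"
    unfolding F_def by (rule Weierstrass_m_test[OF ub summ])
  have "open B" by (simp add: B_def)
  have "F holomorphic_on B"
  proof (rule holomorphic_uniform_sequence[where f = "\<lambda>n z. \<Sum>i<n. u i z"])
    show "open B" by fact
    show "(\<lambda>z. \<Sum>i<n. u i z) holomorphic_on B" for n
      by (intro holomorphic_intros uh)
    show "\<exists>d>0. cball z d \<subseteq> B \<and> uniform_limit (cball z d) (\<lambda>n z. \<Sum>i<n. u i z) F sequentially"
      if "z \<in> B" for z
    proof -
      obtain d where "d > 0" "cball z d \<subseteq> B"
        using \<open>z \<in> B\<close> \<open>open B\<close> open_contains_cball by blast
      then show ?thesis using uniform_limit_on_subset[OF ul] by blast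
    qed
  qed
  moreover have "f t = F (of_real t)" if t: "complex_of_real t \<in> B" for t
  proof -
    have Gt: "(G ^^ n) (of_real t) = of_real ((g ^^ n) t)" for n
    proof (induction n)
      case (Suc n)
      then show ?case using Gg[of "(g ^^ n) t"] B(1)[OF GnB[OF t, of n]] by simp
    qed simp
    have ft: "f t = (\<Sum>i<n. u i (of_real t)) + P n (of_real t) * f ((g ^^ n) t)" for n
    proof (induction n)
      case (Suc n)
      have "f ((g ^^ n) t) = w ((G ^^ n) (of_real t)) * f ((g ^^ Suc n) t) + h ((G ^^ n) (of_real t))"
        using eq[of "(g ^^ n) t"] B(1)[OF GnB[OF t, of n]] by (simp add: Gt)
      then show ?case using Suc by (simp add: u_def P_def algebra_simps)
    qed (simp add: P_def)
    have "(\<lambda>n. P n (of_real t) * f ((g ^^ n) t)) \<longlonglongrightarrow> 0"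
    proof (rule Lim_null_comparison)
      show "\<forall>\<^sub>F n in sequentially. norm (P n (of_real t) * f ((g ^^ n) t)) \<le> \<kappa> ^ n * Cf"
        unfolding norm_mult using P[OF t] Bf GnB[OF t] \<kappa>0
        by (intro always_eventually allI mult_mono) (auto simp: Gt)
      show "(\<lambda>n. \<kappa> ^ n * Cf) \<longlonglongrightarrow> 0"
        using \<kappa> \<kappa>0 by (intro tendsto_mult_left_zero LIMSEQ_realpow_zero) auto
    qed
    then have "(\<lambda>n. f t - P n (of_real t) * f ((g ^^ n) t)) \<longlonglongrightarrow> f t - 0"
      by (intro tendsto_diff tendsto_const)
    moreover have "f t - P n (of_real t) * f ((g ^^ n) t) = (\<Sum>i<n. u i (of_real t))" for n
      using ft[of n] by simp
    ultimately have "(\<lambda>n. u n (of_real t)) sums f t" by (simp add: sums_def)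
    then show ?thesis by (simp add: F_def sums_iff)
  qed
  ultimately show ?thesis
    unfolding analytic_at_def using r1(1) r2(1)
    by (intro exI[of _ F] exI[of _ B]) (auto simp: B_def)
qed

text \<open>At the fixed point the derivative of \<open>mob A\<close> is
  \<open>1 / (den A x)^2\<close> and the weight has absolute value
  \<open>(1 / (den A x)^2) powr Re s\<close>. Both are below 1, so f = f|A + h is a functional
  equation of the kind just solved.\<close>

lemma analytic_at_contraction:
  assumes s: "0 < Re s" and A: "det A = 1" "mob A x = x" "den A x > 1"
    and h: "analytic_at (\<lambda>t. f t - slash s A f t) x" and cont: "isCont f x"
  shows "analytic_at f x"
proof -
  obtain H W where W: "open W" "complex_of_real x \<in> W" "H holomorphic_on W"
    "\<And>u. complex_of_real u \<in> W \<Longrightarrow> f u - slash s A f u = H (of_real u)"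
    using h unfolding analytic_at_def by blast
  define D where "D z = of_int (A$2$1) * z + of_int (A$2$2)" for z :: complex
  define N where "N z = of_int (A$1$1) * z + of_int (A$1$2)" for z :: complex
  have D: "D (of_real u) = of_real (den A u)" for u by (simp add: D_def den_def)
  have N: "N (of_real u) / D (of_real u) = of_real (mob A u)" for u
    by (simp add: N_def D_def mob_def den_def)
  have hD: "D holomorphic_on X" "N holomorphic_on X" for X
    unfolding D_def N_def by (intro holomorphic_intros)+
  have cD: "continuous_on X D" for X unfolding D_def by (intro continuous_intros)
  \<comment> \<open>The first inequality makes the weight holomorphic, the second makes the Moebius
    map contract towards \<open>x\<close>; both hold at \<open>x\<close> because D takes the value
    \<open>den A x\<close> > 1 there.\<close>
  define U where "U = W \<inter> {z. Re ((D z)^2) > 0} \<inter> {z. norm (D z) > 1}"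
  have U: "open U" unfolding U_def
    by (intro open_Int W open_Collect_less continuous_intros cD)
  have U0: "D z \<noteq> 0" if "z \<in> U" for z using that by (auto simp: U_def)
  have xU: "complex_of_real x \<in> U"
    using W(2) A(3) unfolding U_def by (simp add: D flip: of_real_power)
  show ?thesis
  proof (rule analytic_at_functional_equation[OF U xU, where g = "mob A"])
    show "(\<lambda>z. N z / D z) holomorphic_on U"
      using U0 by (intro holomorphic_intros hD) auto
    show "(\<lambda>z. exp (- s * Ln ((D z)^2))) holomorphic_on U"
      by (intro holomorphic_intros hD) (auto simp: U_def complex_nonpos_Reals_iff)
    show "H holomorphic_on U" using W(3) by (rule holomorphic_on_subset) (auto simp: U_def)
    show "norm (N z / D z - of_real x) \<le> norm (z - of_real x)" if "z \<in> U" for z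
    proof -
      have "N (of_real x) = of_real x * D (of_real x)"
        using N[of x] A(2) U0[OF xU] by (simp add: field_simps)
      \<comment> \<open>For determinant 1 and a fixed point \<open>x\<close>, the distance to
        \<open>x\<close> is divided by \<open>D z * D x\<close> exactly.\<close>
      then have "(N z - of_real x * D z) * D (of_real x) =
          N z * D (of_real x) - N (of_real x) * D z" by (simp add: algebra_simps)
      also have "\<dots> = of_int (det A) * (z - of_real x)"
        by (simp add: N_def D_def det_2 algebra_simps)
      finally have "(N z - of_real x * D z) * D (of_real x) = z - of_real x" using A(1) by simp
      moreover have "N z / D z - of_real x =
          ((N z - of_real x * D z) * D (of_real x)) / (D z * D (of_real x))"
        using U0[OF xU] U0[OF that] by (simp add: divide_simps)
      ultimately have "N z / D z - of_real x = (z - of_real x) / (D z * D (of_real x))" by simp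
      moreover have "norm (D z * D (of_real x)) \<ge> 1 * 1"
        unfolding norm_mult using that xU by (intro mult_mono) (auto simp: U_def)
      ultimately show ?thesis by (simp add: norm_divide divide_le_eq mult_le_cancel_left1)
    qed
    show "norm (exp (- s * Ln ((D (of_real x))^2))) < 1"
    proof -
      have "norm (weight s (den A x)) = (1 / (den A x)^2) powr Re s"
        unfolding weight_def by (subst norm_powr_real_powr) auto
      also have "\<dots> < 1"
        using powr_less_mono2[OF s, of "1 / (den A x)^2" 1] A(3) by (simp add: divide_less_eq)
      finally show ?thesis using A(3) by (simp add: D weight_eq)
    qed
    show "f t = exp (- s * Ln ((D (of_real t))^2)) * f (mob A t) + H (of_real t)"
      if "complex_of_real t \<in> U" for t
    proof -
      have "den A t \<noteq> 0" using U0[OF that] by (simp add: D)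
      then have "slash s A f t = exp (- s * Ln ((D (of_real t))^2)) * f (mob A t)"
        by (simp add: slash_regular D weight_eq)
      then show ?thesis using W(4)[of t] that by (simp add: U_def algebra_simps)
    qed
  qed (use N cont in auto)
qed

section \<open>The two branches on the positive half-line and regularity along their cycles\<close>

definition T_mat :: "int^2^2" where "T_mat = mat2 1 1 0 1"
definition L_mat :: "int^2^2" where "L_mat = mat2 1 0 1 1"

text \<open>These are the elements of the monoid generated by \<open>T_mat\<close> and
  \<open>L_mat\<close>. They map the positive half-line into itself and have no pole on it, so
  slashes along them compose for arbitrary functions.\<close>

definition nonneg_mat :: "int^2^2 \<Rightarrow> bool" where
  "nonneg_mat A \<longleftrightarrow> A$1$1 \<ge> 1 \<and> A$2$2 \<ge> 1 \<and> A$1$2 \<ge> 0 \<and> A$2$1 \<ge> 0 \<and> det A = 1"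

lemma nonneg_mat_pos:
  assumes "nonneg_mat A" "t > 0" shows "den A t > 0" "mob A t > 0"
proof -
  show "den A t > 0" using assms unfolding nonneg_mat_def den_def
    by (intro add_nonneg_pos mult_nonneg_nonneg) auto
  moreover have "of_int (A$1$1) * t + of_int (A$1$2) > 0"
    using assms unfolding nonneg_mat_def by (intro add_pos_nonneg mult_pos_pos) auto
  ultimately show "mob A t > 0" unfolding mob_def by simp
qed

lemma nonneg_T_mat [simp]: "nonneg_mat T_mat" and nonneg_L_mat [simp]: "nonneg_mat L_mat"
  by (simp_all add: nonneg_mat_def T_mat_def L_mat_def)

text \<open>The points where some \<open>F j\<close> fails to be analytic form a finite set \<open>\<Sigma>\<close> of pairs, and by the
  equation every pair in it has one of its images under \<open>T\<close> and \<open>L\<close> in it again. Since \<open>T\<close> and \<open>L\<close>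
  map \<open>(0, \<infinity>)\<close> into \<open>(1, \<infinity>)\<close> and \<open>(0, 1)\<close>, this choice of images is injective, hence bijective,
  and the other image never belongs to \<open>\<Sigma>\<close>. Every pair is therefore periodic, and going once around
  its cycle yields the equation of a contraction.\<close>

lemma three_term_regularity:
  fixes F :: "nat \<Rightarrow> real \<Rightarrow> complex" and tm lm :: "nat \<Rightarrow> nat"
  assumes s: "0 < Re s" and J: "finite J"
    and tm: "inj_on tm J" "tm ` J \<subseteq> J" and lm: "inj_on lm J" "lm ` J \<subseteq> J"
    and eq: "\<And>j t. j \<in> J \<Longrightarrow> t > 0 \<Longrightarrow>
      F j t = slash s T_mat (F (tm j)) t + slash s L_mat (F (lm j)) t"
    and cont: "\<And>j t. j \<in> J \<Longrightarrow> t > 0 \<Longrightarrow> isCont (F j) t"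
    and fin: "\<And>j. j \<in> J \<Longrightarrow> finite {t. t > 0 \<and> \<not> analytic_at (F j) t}"
    and j: "j \<in> J" and t: "t > 0"
  shows "analytic_at (F j) t"
proof (rule ccontr)
  assume sing: "\<not> analytic_at (F j) t"
  define Sg where "Sg = (SIGMA j:J. {t. t > 0 \<and> \<not> analytic_at (F j) t})"
  have finS: "finite Sg" unfolding Sg_def using J fin by (intro finite_SigmaI) auto
  have mT: "mob T_mat x = x + 1" for x by (simp add: mob_def den_def T_mat_def)
  have mL: "mob L_mat x = x / (x + 1)" for x by (simp add: mob_def den_def L_mat_def)
  have diffT: "analytic_at (\<lambda>t. F j t - slash s T_mat (F (tm j)) t) x"
    if "j \<in> J" "x > 0" "analytic_at (F (lm j)) (mob L_mat x)" for j x
  proof (rule analytic_at_cong)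
    show "analytic_at (slash s L_mat (F (lm j))) x"
      using that nonneg_mat_pos(1)[OF nonneg_L_mat that(2)] by (intro analytic_at_slash) auto
    show "\<forall>\<^sub>F u in nhds x. slash s L_mat (F (lm j)) u = F j u - slash s T_mat (F (tm j)) u"
      using eventually_nhds_in_open[of "{0<..}" x] that(2)
      by (auto elim!: eventually_mono simp: eq[OF that(1)])
  qed
  have diffL: "analytic_at (\<lambda>t. F j t - slash s L_mat (F (lm j)) t) x"
    if "j \<in> J" "x > 0" "analytic_at (F (tm j)) (mob T_mat x)" for j x
  proof (rule analytic_at_cong)
    show "analytic_at (slash s T_mat (F (tm j))) x"
      using that nonneg_mat_pos(1)[OF nonneg_T_mat that(2)] by (intro analytic_at_slash) auto
    show "\<forall>\<^sub>F u in nhds x. slash s T_mat (F (tm j)) u = F j u - slash s L_mat (F (lm j)) u"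
      using eventually_nhds_in_open[of "{0<..}" x] that(2)
      by (auto elim!: eventually_mono simp: eq[OF that(1)])
  qed
  define isT where "isT \<sigma> \<longleftrightarrow> \<not> analytic_at (F (tm (fst \<sigma>))) (mob T_mat (snd \<sigma>))" for \<sigma>
  define nx where "nx \<sigma> = (if isT \<sigma> then (tm (fst \<sigma>), mob T_mat (snd \<sigma>))
    else (lm (fst \<sigma>), mob L_mat (snd \<sigma>)))" for \<sigma> :: "nat \<times> real"
  define m where "m \<sigma> = (if isT \<sigma> then T_mat else L_mat)" for \<sigma>
  have Sg: "fst \<sigma> \<in> J" "snd \<sigma> > 0" "\<not> analytic_at (F (fst \<sigma>)) (snd \<sigma>)" if "\<sigma> \<in> Sg" for \<sigma>
    using that by (auto simp: Sg_def)
  have gt: "snd (nx \<sigma>) > 1 \<longleftrightarrow> isT \<sigma>" if "\<sigma> \<in> Sg" for \<sigma>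
    using Sg(2)[OF that] by (auto simp: nx_def mT mL)
  have nxS: "nx \<sigma> \<in> Sg" if "\<sigma> \<in> Sg" for \<sigma>
  proof (cases "isT \<sigma>")
    case True
    then show ?thesis using Sg[OF that] tm(2) nonneg_mat_pos(2)[OF nonneg_T_mat]
      by (auto simp: Sg_def nx_def isT_def)
  next
    case False
    note S = Sg[OF that]
    have "\<not> analytic_at (F (lm (fst \<sigma>))) (mob L_mat (snd \<sigma>))"
    proof
      assume an: "analytic_at (F (lm (fst \<sigma>))) (mob L_mat (snd \<sigma>))"
      have "analytic_at (slash s L_mat (F (lm (fst \<sigma>)))) (snd \<sigma>)"
        using an nonneg_mat_pos(1)[OF nonneg_L_mat S(2)] by (intro analytic_at_slash) auto
      from analytic_at_add[OF diffL[OF S(1,2)] this] False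
      show False using S(3) by (simp add: isT_def)
    qed
    then show ?thesis using S lm(2) False nonneg_mat_pos(2)[OF nonneg_L_mat]
      by (auto simp: Sg_def nx_def)
  qed
  have inj: "inj_on nx Sg"
  proof (rule inj_onI)
    fix \<sigma> \<tau> assume st: "\<sigma> \<in> Sg" "\<tau> \<in> Sg" "nx \<sigma> = nx \<tau>"
    then have "isT \<sigma> = isT \<tau>" using gt by metis
    then show "\<sigma> = \<tau>"
      using st Sg(1,2)[OF st(1)] Sg(1,2)[OF st(2)] tm(1) lm(1)
      by (cases "isT \<sigma>") (auto simp: nx_def mT mL prod_eq_iff field_simps dest: inj_onD)
  qed
  have surj: "nx ` Sg = Sg"
    using finS inj nxS by (intro endo_inj_surj) auto
  have step: "analytic_at (\<lambda>t. F (fst \<sigma>) t - slash s (m \<sigma>) (F (fst (nx \<sigma>))) t) (snd \<sigma>)"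
    if "\<sigma> \<in> Sg" for \<sigma>
  proof (cases "isT \<sigma>")
    case True
    have "analytic_at (F (lm (fst \<sigma>))) (mob L_mat (snd \<sigma>))"
    proof (rule ccontr)
      assume "\<not> ?thesis"
      then have "(lm (fst \<sigma>), mob L_mat (snd \<sigma>)) \<in> Sg"
        using Sg[OF that] lm(2) nonneg_mat_pos(2)[OF nonneg_L_mat] by (auto simp: Sg_def)
      then obtain \<tau> where \<tau>: "\<tau> \<in> Sg" "nx \<tau> = (lm (fst \<sigma>), mob L_mat (snd \<sigma>))"
        using surj by (metis imageE)
      have "\<not> snd (nx \<tau>) > 1" using Sg(2)[OF that] by (simp add: \<tau>(2) mL)
      then have "\<not> isT \<tau>" using gt[OF \<tau>(1)] by simp
      then have "lm (fst \<tau>) = lm (fst \<sigma>)" "mob L_mat (snd \<tau>) = mob L_mat (snd \<sigma>)"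
        using \<tau>(2) by (auto simp: nx_def)
      then have "\<tau> = \<sigma>"
        using Sg[OF that] Sg[OF \<tau>(1)] lm(1) by (auto simp: mL prod_eq_iff field_simps dest: inj_onD)
      then show False using True \<open>\<not> isT \<tau>\<close> by simp
    qed
    then show ?thesis using diffT Sg[OF that] True by (simp add: m_def nx_def)
  next
    case False
    then show ?thesis using diffL Sg[OF that] by (simp add: m_def nx_def isT_def)
  qed
  have mpos: "nonneg_mat (m \<sigma>)" for \<sigma> by (simp add: m_def)
  have snd_nx: "snd (nx \<sigma>) = mob (m \<sigma>) (snd \<sigma>)" for \<sigma> by (simp add: nx_def m_def)
  define \<sigma> where "\<sigma> = (j, t)"
  have \<sigma>: "\<sigma> \<in> Sg" using j t sing by (simp add: \<sigma>_def Sg_def)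
  have nxn: "(nx ^^ n) \<sigma> \<in> Sg" for n by (induction n) (use \<sigma> nxS in auto)
  \<comment> \<open>The clause on the entries singles out products without a factor
    \<open>L_mat\<close>: these are translations by at least \<open>n\<close>, hence without a
    finite fixed point. Every other product has lower left entry at least 1, which makes
    \<open>den A t\<close> exceed 1 for positive \<open>t\<close>.\<close>
  have iter: "\<exists>A. nonneg_mat A \<and> (A$2$1 = 0 \<longrightarrow> A$1$2 \<ge> int n) \<and> mob A t = snd ((nx ^^ n) \<sigma>) \<and>
    analytic_at (\<lambda>u. F j u - slash s A (F (fst ((nx ^^ n) \<sigma>))) u) t" for n
  proof (induction n)
    case 0
    have "analytic_at (\<lambda>u. 0) t"
      unfolding analytic_at_def by (intro exI[of _ "\<lambda>_. 0"] exI[of _ UNIV]) auto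
    then show ?case
      by (intro exI[of _ "mat2 1 0 0 1"]) (simp add: nonneg_mat_def mob_def den_def \<sigma>_def)
  next
    case (Suc n)
    then obtain A where A: "nonneg_mat A" "A$2$1 = 0 \<longrightarrow> A$1$2 \<ge> int n"
      "mob A t = snd ((nx ^^ n) \<sigma>)"
      "analytic_at (\<lambda>u. F j u - slash s A (F (fst ((nx ^^ n) \<sigma>))) u) t" by blast
    define \<tau> where "\<tau> = (nx ^^ n) \<sigma>"
    have \<tau>: "\<tau> \<in> Sg" "(nx ^^ Suc n) \<sigma> = nx \<tau>" by (auto simp: \<tau>_def nxn)
    have denA: "den A t > 0" using nonneg_mat_pos(1)[OF A(1) t] .
    have nn: "nonneg_mat (m \<tau> ** A)"
      using A(1) by (auto simp: m_def T_mat_def L_mat_def nonneg_mat_def matrix_matrix_mult_def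
          sum_2 det_2 algebra_simps)
    moreover have "(m \<tau> ** A)$2$1 = 0 \<longrightarrow> (m \<tau> ** A)$1$2 \<ge> int (Suc n)"
      using A(1,2) by (auto simp: m_def T_mat_def L_mat_def nonneg_mat_def matrix_matrix_mult_def sum_2)
    moreover have "mob (m \<tau> ** A) t = snd ((nx ^^ Suc n) \<sigma>)"
      using denA A(3) by (simp add: mob_mult snd_nx \<tau>_def)
    moreover have "analytic_at (\<lambda>u. F j u - slash s (m \<tau> ** A) (F (fst ((nx ^^ Suc n) \<sigma>))) u) t"
    proof (rule analytic_at_cong)
      define k where "k u = F (fst \<tau>) u - slash s (m \<tau>) (F (fst (nx \<tau>))) u" for u
      have "analytic_at (slash s A k) t"
        using denA step[OF \<tau>(1)] A(3)
        by (intro analytic_at_slash) (auto simp: k_def[abs_def] \<tau>_def)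
      from analytic_at_add[OF A(4) this]
      show "analytic_at (\<lambda>u. F j u - slash s A (F (fst ((nx ^^ n) \<sigma>))) u + slash s A k u) t" .
      have "F j u - slash s A (F (fst ((nx ^^ n) \<sigma>))) u + slash s A k u =
        F j u - slash s (m \<tau> ** A) (F (fst ((nx ^^ Suc n) \<sigma>))) u" if "u > 0" for u
      proof -
        have d: "den A u \<noteq> 0" "den (m \<tau>) (mob A u) \<noteq> 0"
          using nonneg_mat_pos(1)[OF A(1) that]
            nonneg_mat_pos(1)[OF mpos nonneg_mat_pos(2)[OF A(1) that], of \<tau>] by auto
        then show ?thesis
          unfolding slash_mult_regular[OF d] \<tau>(2)
          by (simp add: slash_regular[OF d(1)] k_def \<tau>_def right_diff_distrib)
      qed
      then show "\<forall>\<^sub>F u in nhds t. F j u - slash s A (F (fst ((nx ^^ n) \<sigma>))) u + slash s A k u =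
        F j u - slash s (m \<tau> ** A) (F (fst ((nx ^^ Suc n) \<sigma>))) u"
        using eventually_nhds_in_open[of "{0<..}" t] t by (auto elim!: eventually_mono)
    qed
    ultimately show ?case by blast
  qed
  have "\<exists>n>0. (nx ^^ n) \<sigma> = \<sigma>"
  proof -
    have "\<not> inj (\<lambda>n. (nx ^^ n) \<sigma>)"
    proof
      assume "inj (\<lambda>n. (nx ^^ n) \<sigma>)"
      then have "infinite (range (\<lambda>n. (nx ^^ n) \<sigma>))" using range_inj_infinite by blast
      moreover have "range (\<lambda>n. (nx ^^ n) \<sigma>) \<subseteq> Sg" using nxn by blast
      ultimately show False using finS finite_subset by blast
    qed
    then obtain a b where ab: "(nx ^^ a) \<sigma> = (nx ^^ b) \<sigma>" "a < b"
      unfolding inj_def by (metis linorder_neqE_nat)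
    have cancel: "(nx ^^ n) \<sigma>' = (nx ^^ n) \<tau> \<Longrightarrow> \<sigma>' \<in> Sg \<Longrightarrow> \<tau> \<in> Sg \<Longrightarrow> \<sigma>' = \<tau>" for n \<sigma>' \<tau>
    proof (induction n arbitrary: \<sigma>' \<tau>)
      case (Suc n)
      then have "nx \<sigma>' = nx \<tau>" using Suc.IH[of "nx \<sigma>'" "nx \<tau>"] nxS by (simp add: funpow_swap1)
      then show ?case using inj Suc.prems by (auto dest: inj_onD)
    qed simp
    have "(nx ^^ a) \<sigma> = (nx ^^ a) ((nx ^^ (b - a)) \<sigma>)"
      using ab funpow_add[of a "b - a" nx] by simp
    then have "\<sigma> = (nx ^^ (b - a)) \<sigma>" using cancel \<sigma> nxn by blast
    then show ?thesis using ab(2) by (metis zero_less_diff)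
  qed
  then obtain n where n: "n > 0" "(nx ^^ n) \<sigma> = \<sigma>" by blast
  obtain A where A: "nonneg_mat A" "A$2$1 = 0 \<longrightarrow> A$1$2 \<ge> int n" "mob A t = t"
    "analytic_at (\<lambda>u. F j u - slash s A (F j) u) t"
    using iter[of n] unfolding n(2) by (auto simp: \<sigma>_def)
  have c: "A$2$1 \<noteq> 0"
  proof
    assume c0: "A$2$1 = 0"
    then have "A$1$1 * A$2$2 = 1" using A(1) by (simp add: nonneg_mat_def det_2)
    then have "A$1$1 = 1" "A$2$2 = 1" using A(1) by (auto simp: nonneg_mat_def zmult_eq_1_iff)
    then have "t + of_int (A$1$2) = t" using A(3) c0 by (simp add: mob_def den_def)
    then show False using A(2) c0 n(1) by simp
  qed
  have "of_int (A$2$1) * t + of_int (A$2$2) > 0 + (1::real)"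
    using A(1) c t unfolding nonneg_mat_def by (intro add_less_le_mono mult_pos_pos) auto
  then have "den A t > 1" by (simp add: den_def)
  then show False
    using analytic_at_contraction[OF s _ A(3) _ A(4) cont[OF j t]] A(1) sing
    by (simp add: nonneg_mat_def)
qed

section \<open>Potentials on the Farey graph\<close>

text \<open>The quadruple \<open>a, b, c, d\<close> with \<open>a d - b c = 1\<close> stands for the oriented edge of the Farey graph
  from \<open>a/c\<close> to \<open>b/d\<close>. For \<open>c > 0\<close> the vertex \<open>a/c\<close> has exactly one neighbour \<open>b/d\<close> with
  \<open>0 \<le> d < c\<close> at the end of such an edge.\<close>

function farey_potential ::
    "(int \<Rightarrow> int \<Rightarrow> int \<Rightarrow> int \<Rightarrow> 'v::ab_group_add) \<Rightarrow> int \<Rightarrow> int \<Rightarrow> 'v" where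
  "farey_potential e a c =
    (let d = (SOME d. 0 \<le> d \<and> d < c \<and> [a * d = 1] (mod c)); b = (a * d - 1) div c
     in if 0 \<le> d \<and> d < c then farey_potential e b d - e a b c d else 0)"
  by pat_completeness auto
termination by (relation "Wellfounded.measure (\<lambda>(e, a, c). nat c)") auto

declare farey_potential.simps [simp del]

lemma farey_potential_infinity [simp]: "farey_potential e a 0 = 0"
  by (subst farey_potential.simps, unfold Let_def, subst if_not_P) auto

lemma farey_potential_parent:
  assumes "a * d - b * c = 1" "0 \<le> d" "d < c"
  shows "farey_potential e a c = farey_potential e b d - e a b c d"
proof -
  have ad: "a * d - 1 = b * c" using assms(1) by simp
  have uniq: "d' = d" if "0 \<le> d'" "d' < c" "[a * d' = 1] (mod c)" for d'
  proof -
    have "c dvd a * d' - 1" using that(3) by (simp add: cong_iff_dvd_diff)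
    then have "c dvd d * (a * d' - 1) - d' * (b * c)" by (intro dvd_diff) auto
    also have "d * (a * d' - 1) - d' * (b * c) = d' - d"
      unfolding ad[symmetric] by (simp add: algebra_simps)
    finally have "[d' = d] (mod c)" by (simp add: cong_iff_dvd_diff)
    then show ?thesis using that assms cong_less_imp_eq_int by blast
  qed
  have "[a * d = 1] (mod c)" using ad by (simp add: cong_iff_dvd_diff)
  then have S: "(SOME d. 0 \<le> d \<and> d < c \<and> [a * d = 1] (mod c)) = d"
    by (intro some_equality conjI assms(2,3) uniq) simp_all
  have c: "c \<noteq> 0" and d: "0 \<le> d \<and> d < c" using assms(2,3) by simp_all
  show ?thesis
    unfolding farey_potential.simps[of e a c] Let_def S ad if_P[OF d]
      nonzero_mult_div_cancel_right[OF c] ..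
qed

text \<open>The recursion takes care of the edges to parents. An edge with 0 < c < d lies in the
  triangle with third vertex (b - a)/(d - c): the side from a/c has smaller denominators, and the
  side from b/d leads to its parent, so \<open>tri\<close> gives the third side. This is exactness
  of a closed cochain on the simply connected Farey complex.\<close>

lemma farey_potential_exists:
  fixes e :: "int \<Rightarrow> int \<Rightarrow> int \<Rightarrow> int \<Rightarrow> 'v::ab_group_add"
  assumes anti: "\<And>a b c d. a * d - b * c = 1 \<Longrightarrow> e b (- a) d (- c) = - e a b c d"
    and tri: "\<And>a b c d. a * d - b * c = 1 \<Longrightarrow>
      e a b c d = e a (b - a) c (d - c) + e (a - b) b (c - d) d"
  shows "\<exists>P. P 1 0 = 0 \<and> (\<forall>a c. P (- a) (- c) = P a c) \<and>
    (\<forall>a b c d. a * d - b * c = 1 \<longrightarrow> P b d - P a c = e a b c d)"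
proof -
  define P where "P a c = (if c < 0 then farey_potential e (- a) (- c) else farey_potential e a c)"
    for a c
  have P0 [simp]: "P a 0 = 0" for a by (simp add: P_def)
  have P_neg: "P (- a) (- c) = P a c" for a c by (cases c "0::int" rule: linorder_cases) (auto simp: P_def)
  have parent: "P b d - P a c = e a b c d" if "a * d - b * c = 1" "0 \<le> d" "d < c" for a b c d
    using farey_potential_parent[OF that, of e] that by (simp add: P_def)
  have e_neg: "e (- a) (- b) (- c) (- d) = e a b c d" if "a * d - b * c = 1" for a b c d
    using anti[OF that] anti[of b "- c" "- a" d] that by (simp add: algebra_simps)
  have nonneg: "P b d - P a c = e a b c d" if "a * d - b * c = 1" "0 \<le> c" "0 \<le> d" for a b c d
    using that
  proof (induction "nat (c + d)" arbitrary: a b c d rule: less_induct)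
    case less
    consider "d < c" | "c = d" | "c = 0" "0 < d" | "0 < c" "c < d" using less.prems by linarith
    then show ?case
    proof cases
      case 1
      then show ?thesis using parent less.prems by simp
    next
      case 2
      then have "c * (a - b) = 1" using less.prems(1) by (simp add: algebra_simps)
      then have c: "c = 1" "a = b + 1" using less.prems(2) by (auto simp: zmult_eq_1_iff)
      \<comment> \<open>Equal denominators force consecutive integers, which form a triangle with
        infinity.\<close>
      have "e (b + 1) b 1 1 = e (b + 1) (- 1) 1 0 + e 1 b 0 1"
        using tri[of "b + 1" 1 b 1] by simp
      moreover have "e 1 b 0 1 = - e b (- 1) 1 0"
        using anti[of b 0 "- 1" 1] e_neg[of 1 1 b 0] by simp
      moreover have "P (b + 1) 1 = - e (b + 1) (- 1) 1 0" "P b 1 = - e b (- 1) 1 0"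
        using parent[of "b + 1" 0 "- 1" 1] parent[of b 0 "- 1" 1]
        by (simp_all flip: neg_equal_iff_equal[of "P _ 1"])
      ultimately show ?thesis using c 2 by (simp add: algebra_simps)
    next
      case 3
      then have "a = 1" "d = 1" using less.prems(1) by (auto simp: zmult_eq_1_iff)
      moreover have "e 1 b 0 1 = - e b (- 1) 1 0"
        using anti[of b 0 "- 1" 1] e_neg[of 1 1 b 0] by simp
      moreover have "P b 1 = - e b (- 1) 1 0"
        using parent[of b 0 "- 1" 1] by (simp flip: neg_equal_iff_equal[of "P _ 1"])
      ultimately show ?thesis using 3 by simp
    next
      case 4
      have 1: "P (b - a) (d - c) - P a c = e a (b - a) c (d - c)"
        by (rule less.hyps) (use 4 less.prems in \<open>auto simp: algebra_simps\<close>)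
      have 2: "P (b - a) (d - c) - P b d = e b (b - a) d (d - c)"
        by (rule parent) (use 4 less.prems in \<open>auto simp: algebra_simps\<close>)
      have 3: "e b (b - a) d (d - c) = - e (a - b) b (c - d) d"
        using anti[of "a - b" d b "c - d"] less.prems(1) by (simp add: algebra_simps)
      show ?thesis using tri[OF less.prems(1)] 1 2 3 by (simp add: algebra_simps)
    qed
  qed
  have "P b d - P a c = e a b c d" if det: "a * d - b * c = 1" for a b c d
  proof -
    consider "0 \<le> c" "0 \<le> d" | "c \<le> 0" "d \<le> 0" | "0 < c" "d < 0" | "c < 0" "0 < d" by linarith
    then show ?thesis
    proof cases
      case 1 then show ?thesis using nonneg det by simp
    next
      case 2
      then have "P (- b) (- d) - P (- a) (- c) = e (- a) (- b) (- c) (- d)"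
        using det by (intro nonneg) auto
      then show ?thesis by (simp add: P_neg e_neg[OF det])
    next
      \<comment> \<open>For denominators of opposite sign one vector is negated. This interchanges
        the ends of the edge, and \<open>anti\<close> restores the orientation.\<close>
      case 3
      then have "P a c - P (- b) (- d) = e (- b) a (- d) c"
        using det by (intro nonneg) (auto simp: algebra_simps)
      moreover have "e a b c d = - e (- b) a (- d) c"
        using anti[of "- b" c a "- d"] det by (simp add: algebra_simps)
      ultimately show ?thesis by (simp add: P_neg algebra_simps)
    next
      case 4
      then have "P (- a) (- c) - P b d = e b (- a) d (- c)"
        using det by (intro nonneg) (auto simp: algebra_simps)
      then show ?thesis using anti[OF det] by (simp add: P_neg algebra_simps)
    qed
  qed
  then show ?thesis using P_neg P0 by blast
qed

text \<open>Inverting \<open>a\<close> modulo \<open>c\<close> yields a Farey neighbour with smaller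
  lower entry, as in the recursion for the potential. Statements about a potential thus propagate
  from infinity along edges.\<close>

lemma primitive_vector_induct [consumes 1, case_names infinity neg step]:
  fixes a c :: int
  assumes "coprime a c"
    and "Q 1 0" and neg: "\<And>a c. Q a c \<Longrightarrow> Q (- a) (- c)"
    and step: "\<And>a b c d. a * d - b * c = 1 \<Longrightarrow> Q b d \<Longrightarrow> Q a c"
  shows "Q a c"
proof -
  have pos: "Q a c" if "coprime a c" "0 \<le> c" for a c
    using that
  proof (induction "nat c" arbitrary: a c rule: less_induct)
    case less
    show ?case
    proof (cases "c = 0")
      case True
      then have "a = 1 \<or> a = - 1" using less.prems(1) by auto
      then show ?thesis using assms(2) neg[of 1 0] True by auto
    next
      case False
      then have c: "c > 0" using less.prems(2) by simp
      obtain x where x: "[a * x = 1] (mod c)"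
        using cong_solve_coprime_int less.prems(1) by blast
      define d where "d = x mod c"
      have d: "0 \<le> d" "d < c" using c by (auto simp: d_def)
      have "[a * d = 1] (mod c)"
        using x by (simp add: d_def cong_def mod_mult_right_eq)
      then obtain b where b: "a * d - 1 = c * b" by (auto simp: cong_iff_dvd_diff elim: dvdE)
      then have det: "a * d - b * c = 1" by (simp add: mult.commute)
      have "coprime b d"
      proof (rule coprimeI)
        fix l assume "l dvd b" "l dvd d"
        then have "l dvd a * d - b * c" by (intro dvd_diff) auto
        then show "is_unit l" using det by simp
      qed
      then have "Q b d" using d c by (intro less.hyps) auto
      then show ?thesis using step det by blast
    qed
  qed
  show ?thesis
  proof (cases "0 \<le> c")
    case False
    then have "Q (- a) (- c)" using assms(1) by (intro pos) auto
    from neg[OF this] show ?thesis by simp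
  qed (use pos assms(1) in simp)
qed

section \<open>The groups\<close>

lemma det_mat_1 [simp]: "det (mat 1 :: int^2^2) = 1" by (simp add: mat2_one)

lemma det_uminus_mat [simp]: "det (- A) = det (A :: int^2^2)" by (simp add: det_2)

lemma uminus_one_mult: "(- mat 1) ** A = - (A :: int^2^2)" "A ** (- mat 1) = - A"
  by (rule matrix_2_eqI; simp add: matrix_matrix_mult_def mat_def sum_2)+

lemma uminus_matrix_mult:
  fixes A B :: "int^2^2"
  shows "(- A) ** B = - (A ** B)" "A ** (- B) = - (A ** B)"
  by (rule matrix_2_eqI; simp add: matrix_matrix_mult_def sum_2)+

lemma psl_eq_iff: "psl A = psl B \<longleftrightarrow> A = B \<or> A = - B"
  by (auto simp: psl_eq doubleton_eq_iff)

lemma psl_uminus [simp]: "psl (- A) = psl A" by (auto simp: psl_eq)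

lemma carrier_PSL2Z: "carrier PSL2Z = psl ` {A. det A = 1}"
  by (auto simp: PSL2Z_def FactGroup_def RCOSETS_def psl_def SL2Z_def)

lemma one_PSL2Z: "\<one>\<^bsub>PSL2Z\<^esub> = psl (mat 1)"
  by (auto simp: PSL2Z_def FactGroup_def psl_eq)

lemma psl_mult: "psl A \<otimes>\<^bsub>PSL2Z\<^esub> psl B = psl (A ** B)"
  by (auto simp: PSL2Z_def FactGroup_def psl_eq set_mult_def SL2Z_def uminus_matrix_mult)

lemma psl_inv: "det A = 1 \<Longrightarrow> inv\<^bsub>PSL2Z\<^esub> (psl A) = psl (adj A)"
  by (rule group.inv_equality[OF group_PSL2Z])
    (auto simp: carrier_PSL2Z one_PSL2Z psl_mult mult_adj)

lemma tau_psl: "det A = 1 \<Longrightarrow> tau s (psl A) = slash s (adj A)"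
proof (rule tau_eq_slash)
  assume A: "det A = 1"
  show "adj A \<in> inv\<^bsub>PSL2Z\<^esub> (psl A)" unfolding psl_inv[OF A] by (simp add: psl_eq)
qed (auto simp: carrier_PSL2Z)

lemma tau_inv_psl: "det A = 1 \<Longrightarrow> tau s (inv\<^bsub>PSL2Z\<^esub> (psl A)) = slash s A"
  by (simp add: psl_inv tau_psl)

lemma T_elt_eq: "T_elt = psl T_mat" by (simp add: T_elt_def T_mat_def)

lemma det_T_mat [simp]: "det T_mat = 1" and det_L_mat [simp]: "det L_mat = 1"
  by (simp_all add: T_mat_def L_mat_def)

text \<open>Computations are made with matrices and descend to the projective group because
  \<open>slash\<close> ignores the sign of a matrix.\<close>

definition Gamma0 :: "nat \<Rightarrow> (int^2^2) set" where
  "Gamma0 p = {A. det A = 1 \<and> int p dvd A$2$1}"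

lemma carrier_PGamma0: "carrier (PGamma0 p) = psl ` Gamma0 p"
  by (auto simp: PGamma0_def carrier_PSL2Z Gamma0_def psl_eq cong_0_iff)

lemma Gamma0_det: "A \<in> Gamma0 p \<Longrightarrow> det A = 1" by (simp add: Gamma0_def)

lemma Gamma0_mult: "A \<in> Gamma0 p \<Longrightarrow> B \<in> Gamma0 p \<Longrightarrow> A ** B \<in> Gamma0 p"
  by (simp add: Gamma0_def det_mul) (simp add: matrix_matrix_mult_def sum_2)

lemma Gamma0_adj: "A \<in> Gamma0 p \<Longrightarrow> adj A \<in> Gamma0 p"
  by (simp add: Gamma0_def) (simp add: adj_def)

lemma Gamma0_uminus: "A \<in> Gamma0 p \<Longrightarrow> - A \<in> Gamma0 p"
  by (simp add: Gamma0_def)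

lemma T_mat_Gamma0: "T_mat \<in> Gamma0 p" by (simp add: Gamma0_def) (simp add: T_mat_def)

lemma one_Gamma0: "mat 1 \<in> Gamma0 p" by (simp add: Gamma0_def) (simp add: mat2_one)

section \<open>The projective line over the residue field, and generators of the group\<close>

locale prime_level =
  fixes p :: nat
  assumes prime: "Factorial_Ring.prime p"
begin

lemma p_gt_1: "p > 1" using prime prime_gt_1_nat by blast

lemma prime_int: "Factorial_Ring.prime (int p)" using prime by simp

lemma unique_residue:
  assumes "\<not> int p dvd a" shows "\<exists>!k. k < p \<and> [int k * a = b] (mod int p)"
proof -
  have cop: "coprime a (int p)"
    using prime_imp_coprime[OF prime_int assms] by (simp add: coprime_commute)
  then obtain x where x: "[a * x = 1] (mod int p)" using cong_solve_coprime_int by blast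
  define k where "k = nat ((x * b) mod int p)"
  have k: "int k = (x * b) mod int p" using p_gt_1 by (simp add: k_def)
  have "[int k * a = x * b * a] (mod int p)" by (simp add: k cong_def mod_mult_left_eq)
  also have "x * b * a = (a * x) * b" by (simp add: mult.commute mult.left_commute)
  also have "[\<dots> = 1 * b] (mod int p)" using x by (rule cong_scalar_right)
  finally have 1: "[int k * a = b] (mod int p)" by simp
  have "int k < int p" using p_gt_1 by (simp add: k)
  moreover have "l = k" if "l < p" "[int l * a = b] (mod int p)" for l
  proof -
    have "[int l * a = int k * a] (mod int p)" using that(2) 1 cong_sym cong_trans by blast
    then have "[int l = int k] (mod int p)" using cop by (simp add: cong_mult_rcancel)
    then show ?thesis using that(1) \<open>int k < int p\<close> cong_less_imp_eq_int[of "int l" "int p" "int k"] by auto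
  qed
  ultimately show ?thesis using 1 by auto
qed

text \<open>The class in \<open>P\<^sup>1(\<int>/p)\<close> of the row \<open>(a, b)\<close>, numbered by \<open>k\<close> for \<open>(1, k)\<close> and by \<open>p\<close> for
  \<open>(0, 1)\<close>.\<close>

definition row_class :: "int \<Rightarrow> int \<Rightarrow> nat" where
  "row_class a b = (if int p dvd a then p else (THE k. k < p \<and> [int k * a = b] (mod int p)))"

definition row :: "int \<Rightarrow> int \<Rightarrow> bool" where
  "row a b \<longleftrightarrow> \<not> (int p dvd a \<and> int p dvd b)"

lemma row_class_finite:
  assumes "\<not> int p dvd a"
  shows "row_class a b < p" "int p dvd int (row_class a b) * a - b"
proof -
  have "row_class a b < p \<and> [int (row_class a b) * a = b] (mod int p)"
    unfolding row_class_def if_not_P[OF assms] by (rule theI'[OF unique_residue[OF assms]])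
  then show "row_class a b < p" "int p dvd int (row_class a b) * a - b"
    by (simp_all add: cong_iff_dvd_diff)
qed

lemma row_class_eqI:
  assumes "k < p" "\<not> int p dvd a" "int p dvd int k * a - b" shows "row_class a b = k"
  unfolding row_class_def if_not_P[OF assms(2)]
  by (rule the1_equality[OF unique_residue[OF assms(2)]])
    (use assms(1,3) in \<open>simp add: cong_iff_dvd_diff\<close>)

lemma row_class_infinity [simp]: "int p dvd a \<Longrightarrow> row_class a b = p"
  by (simp add: row_class_def)

lemma row_class_le: "row_class a b \<le> p"
  using row_class_finite(1)[of a b] by (cases "int p dvd a") auto

lemma row_class_one [simp]: "k < p \<Longrightarrow> row_class 1 (int k) = k"
  using p_gt_1 by (intro row_class_eqI) auto

text \<open>Two nonzero rows over the field with \<open>p\<close> elements are proportional iff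
  their determinant vanishes; equalities between classes thereby become divisibilities.\<close>

lemma row_class_eq_iff:
  assumes "row a b" "row a' b'"
  shows "row_class a b = row_class a' b' \<longleftrightarrow> int p dvd a * b' - a' * b"
proof -
  have pm: "int p dvd x * y \<longleftrightarrow> int p dvd x \<or> int p dvd y" for x y
    using prime_int by (simp add: prime_dvd_mult_iff)
  consider "int p dvd a" "int p dvd a'" | "int p dvd a" "\<not> int p dvd a'"
    | "\<not> int p dvd a" "int p dvd a'" | "\<not> int p dvd a" "\<not> int p dvd a'" by blast
  then show ?thesis
  proof cases
    case 1
    then show ?thesis by (simp add: dvd_diff)
  next
    case 2
    then have "\<not> int p dvd a * b' - a' * b"
      using assms by (subst dvd_diff_right_iff) (auto simp: row_def pm)
    then show ?thesis using 2 row_class_finite(1)[of a' b'] by auto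
  next
    case 3
    then have "\<not> int p dvd a * b' - a' * b"
      using assms by (subst dvd_diff_left_iff) (auto simp: row_def pm)
    then show ?thesis using 3 row_class_finite(1)[of a b] by auto
  next
    case 4
    define k where "k = row_class a' b'"
    have k: "k < p" "int p dvd int k * a' - b'" using row_class_finite[OF 4(2)] by (auto simp: k_def)
    have "row_class a b = k \<longleftrightarrow> int p dvd int k * a - b"
      using row_class_eqI[OF k(1) 4(1)] row_class_finite(2)[OF 4(1)] by auto
    also have "\<dots> \<longleftrightarrow> int p dvd a' * (int k * a - b)" using 4 by (simp add: pm)
    also have "a' * (int k * a - b) = a * (int k * a' - b') + (a * b' - a' * b)"
      by (simp add: algebra_simps)
    also have "int p dvd \<dots> \<longleftrightarrow> int p dvd a * b' - a' * b"
      using k(2) by (intro dvd_add_right_iff) auto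
    finally show ?thesis by (simp add: k_def)
  qed
qed

lemma row_of_det:
  fixes A :: "int^2^2"
  assumes "det A = 1" shows "row (A$1$1) (A$1$2)"
proof -
  have False if "int p dvd A$1$1" "int p dvd A$1$2"
  proof -
    have "int p dvd A$1$1 * A$2$2 - A$1$2 * A$2$1" using that by (intro dvd_diff) auto
    then show False using assms p_gt_1 by (simp add: det_2)
  qed
  then show ?thesis unfolding row_def by blast
qed

lemma dual_ex1:
  assumes "1 \<le> k" "k \<le> p - 1"
  shows "\<exists>!l. l \<in> {1..p-1} \<and> [int k * int l = -1] (mod int p)"
proof -
  have nd: "\<not> int p dvd int k" using assms p_gt_1 nat_dvd_not_less[of k p] by auto
  from unique_residue[OF nd, of "-1"] obtain l where l: "l < p" "[int l * int k = -1] (mod int p)"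
    and u: "\<And>l'. l' < p \<Longrightarrow> [int l' * int k = -1] (mod int p) \<Longrightarrow> l' = l" by blast
  have "l \<noteq> 0"
  proof
    assume "l = 0"
    then have "int p dvd 1" using l(2) by (simp add: cong_iff_dvd_diff)
    then show False using p_gt_1 by simp
  qed
  show ?thesis
  proof (rule ex1I[of _ l])
    show "l \<in> {1..p-1} \<and> [int k * int l = -1] (mod int p)"
      using l \<open>l \<noteq> 0\<close> by (simp add: mult.commute[of "int k"])
    show "l' = l" if "l' \<in> {1..p-1} \<and> [int k * int l' = -1] (mod int p)" for l'
      using that p_gt_1 by (intro u) (auto simp: mult.commute[of "int l'"])
  qed
qed

lemma dual_index:
  assumes "1 \<le> k" "k \<le> p - 1"
  shows "1 \<le> dual_index p k" "dual_index p k \<le> p - 1" "int p dvd int k * int (dual_index p k) + 1"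
proof -
  have "dual_index p k \<in> {1..p-1} \<and> [int k * int (dual_index p k) = -1] (mod int p)"
    unfolding dual_index_def by (rule theI'[OF dual_ex1[OF assms]])
  then show "1 \<le> dual_index p k" "dual_index p k \<le> p - 1" "int p dvd int k * int (dual_index p k) + 1"
    by (simp_all add: cong_iff_dvd_diff)
qed

lemma dual_index_eqI:
  assumes "1 \<le> k" "k \<le> p - 1" "1 \<le> l" "l \<le> p - 1" "int p dvd int k * int l + 1"
  shows "dual_index p k = l"
proof -
  have "l \<in> {1..p-1} \<and> [int k * int l = -1] (mod int p)"
    using assms(3-5) by (simp add: cong_iff_dvd_diff)
  moreover have "dual_index p k \<in> {1..p-1} \<and> [int k * int (dual_index p k) = -1] (mod int p)"
    using dual_index[OF assms(1,2)] by (simp add: cong_iff_dvd_diff)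
  ultimately show ?thesis using dual_ex1[OF assms(1,2)] by blast
qed

lemma dual_dual: "1 \<le> k \<Longrightarrow> k \<le> p - 1 \<Longrightarrow> dual_index p (dual_index p k) = k"
  using dual_index[of k] by (intro dual_index_eqI) (simp_all add: mult.commute)

lemma dual_one: "dual_index p 1 = p - 1" and dual_last: "dual_index p (p - 1) = 1"
  using p_gt_1 by (intro dual_index_eqI; simp add: of_nat_diff)+

lemma dual_gt_1:
  assumes "1 \<le> k" "k < p - 1" shows "1 < dual_index p k"
proof -
  have "dual_index p k \<noteq> 1" using dual_dual[of k] dual_one assms by auto
  then show ?thesis using dual_index(1)[of k] assms by simp
qed

definition q_index :: "nat \<Rightarrow> int" where
  "q_index k = (int k * int (dual_index p k) + 1) div int p"

lemma q_index: "1 \<le> k \<Longrightarrow> k \<le> p - 1 \<Longrightarrow> int p * q_index k = int k * int (dual_index p k) + 1"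
  using dual_index(3) by (simp add: q_index_def)

definition H_mat :: "nat \<Rightarrow> int^2^2" where
  "H_mat k = mat2 (int (dual_index p k)) (- q_index k) (int p) (- int k)"

lemma h_elt_eq: "h_elt p k = psl (H_mat k)"
  by (simp add: h_elt_def H_mat_def q_index_def)

lemma det_H_mat [simp]: "1 \<le> k \<Longrightarrow> k \<le> p - 1 \<Longrightarrow> det (H_mat k) = 1"
  using q_index[of k] by (simp add: H_mat_def algebra_simps)

lemma H_mat_Gamma0: "1 \<le> k \<Longrightarrow> k \<le> p - 1 \<Longrightarrow> H_mat k \<in> Gamma0 p"
  by (simp add: Gamma0_def) (simp add: H_mat_def)

lemma adj_H_mat:
  assumes "1 \<le> k" "k \<le> p - 1" shows "adj (H_mat k) = - H_mat (dual_index p k)"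
proof -
  have "q_index (dual_index p k) = q_index k"
    using dual_dual[OF assms] by (simp add: q_index_def mult.commute)
  then show ?thesis using dual_dual[OF assms] by (simp add: H_mat_def)
qed

text \<open>Descent on the lower left entry: if \<open>(p c, - m)\<close> with \<open>0 < m < p c\<close> is the lower row of \<open>A\<close>
  and \<open>q = m div c\<close>, then \<open>A\<close> times the \<open>H_mat\<close> with upper left entry \<open>max 1 q\<close> has a smaller one.\<close>

lemma Gamma0_generated:
  assumes mult: "\<And>A B. A \<in> K \<Longrightarrow> B \<in> K \<Longrightarrow> A ** B \<in> K"
    and adj: "\<And>A. A \<in> K \<Longrightarrow> adj A \<in> K"
    and neg: "- mat 1 \<in> K" and T: "T_mat \<in> K"
    and H: "\<And>k. 1 \<le> k \<Longrightarrow> k \<le> p - 1 \<Longrightarrow> H_mat k \<in> K"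
    and A: "A \<in> Gamma0 p"
  shows "A \<in> K"
proof -
  have one: "mat2 1 0 0 1 \<in> K" using mult[OF neg neg] by (simp add: mat2_one)
  have Tn: "mat2 1 n 0 1 \<in> K" for n
  proof -
    have nat: "mat2 1 (int m) 0 1 \<in> K" for m
    proof (induction m)
      case (Suc m)
      then show ?case using mult[OF T Suc] by (simp add: T_mat_def algebra_simps)
    qed (use one in simp)
    show ?thesis
      using nat[of "nat n"] adj[OF nat[of "nat (- n)"]] by (cases "n \<ge> 0") auto
  qed
  have negK: "- B \<in> K" if "B \<in> K" for B
    using mult[OF neg that] by (simp add: uminus_one_mult)
  show ?thesis
    using A
  proof (induction "nat \<bar>A$2$1\<bar>" arbitrary: A rule: less_induct)
    case less
    have pos: "B \<in> K" if B: "B \<in> Gamma0 p" "\<bar>B$2$1\<bar> = \<bar>A$2$1\<bar>" "B$2$1 \<ge> 0" for B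
    proof (cases "B$2$1 = 0")
      case True
      then have "B$1$1 * B$2$2 = 1" using Gamma0_det[OF B(1)] by (simp add: det_2)
      then have "B = mat2 1 (B$1$2) 0 1 \<or> B = - mat2 1 (- B$1$2) 0 1"
        using True mat2_eta[of B] by (auto simp: zmult_eq_1_iff)
      then show ?thesis using Tn negK by metis
    next
      case False
      obtain c where c: "B$2$1 = int p * c" using B(1) by (auto simp: Gamma0_def)
      have c0: "c > 0" using c B(3) False p_gt_1 by (simp add: zero_le_mult_iff)
      define pc where "pc = int p * c"
      have pc: "pc > 0" using c0 p_gt_1 by (simp add: pc_def)
      define m where "m = pc - (B$2$2) mod pc"
      have nd: "\<not> int p dvd m"
      proof
        assume "int p dvd m"
        moreover have "B$2$2 = pc * ((B$2$2) div pc) + pc - m" by (simp add: m_def)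
        moreover have "int p dvd pc * ((B$2$2) div pc) + pc" by (simp add: pc_def)
        ultimately have "int p dvd B$2$2" by (metis dvd_diff)
        then have "int p dvd B$1$1 * B$2$2 - B$1$2 * B$2$1" using c by (intro dvd_diff) auto
        then show False using Gamma0_det[OF B(1)] p_gt_1 by (simp add: det_2)
      qed
      have "m \<le> pc" using pc by (simp add: m_def)
      moreover have "m \<noteq> pc" using nd by (auto simp: pc_def)
      ultimately have m: "0 < m" "m < pc" 
        using pc pos_mod_bound[of pc "B$2$2"] pos_mod_sign[of pc "B$2$2"] unfolding m_def by linarith+
      define n where "n = - ((B$2$2) div pc) - 1"
      have n: "B$2$2 + pc * n = - m" by (simp add: n_def m_def algebra_simps minus_mod_eq_mult_div[symmetric])
      define q where "q = m div c"
      have mq: "m = c * q + m mod c" by (simp add: q_def)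
      have q: "0 \<le> q" "q < int p"
      proof -
        show "0 \<le> q" using m c0 by (simp add: q_def pos_imp_zdiv_nonneg_iff)
        have "c * q \<le> m" using mq pos_mod_sign[OF c0, of m] by linarith
        then have "c * q < c * int p" using m(2) by (simp add: pc_def mult.commute)
        then show "q < int p" using c0 by simp
      qed
      \<comment> \<open>The value 0 of \<open>q\<close> is no admissible index, hence the maximum.
        In that case m < c, and c - m still lies strictly between 0 and \<open>c\<close>; otherwise
        the difference below is minus the remainder of \<open>m\<close> modulo
        \<open>c\<close>.\<close>
      define l where "l = nat (max 1 q)"
      have l: "1 \<le> l" "l \<le> p - 1" "int l = max 1 q" using q p_gt_1 by (auto simp: l_def)
      define k where "k = dual_index p l"
      have k: "1 \<le> k" "k \<le> p - 1" "dual_index p k = l"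
        using dual_index[OF l(1,2)] dual_dual[OF l(1,2)] by (auto simp: k_def)
      have small: "\<bar>c * int l - m\<bar> < c"
      proof (cases "q = 0")
        case True
        then have "m mod c = m" using mq by simp
        then have "m < c" using pos_mod_bound[OF c0, of m] by simp
        then show ?thesis using True m(1) l(3) by simp
      next
        case False
        then have "c * int l - m = - (m mod c)" using mq l(3) q by (simp add: max_def)
        then show ?thesis using pos_mod_bound[OF c0, of m] pos_mod_sign[OF c0, of m] by simp
      qed
      define C where "C = B ** mat2 1 n 0 1 ** H_mat k"
      have "C$2$1 = int p * (c * int l - m)"
      proof -
        have "C$2$1 = B$2$1 * int l + (B$2$1 * n + B$2$2) * int p"
          by (simp add: C_def H_mat_def k(3) matrix_matrix_mult_def sum_2)
        also have "B$2$1 * n + B$2$2 = - m" using n c by (simp add: pc_def add.commute)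
        finally show ?thesis using c by (simp add: algebra_simps)
      qed
      moreover have "int p * \<bar>c * int l - m\<bar> < int p * c"
        using small p_gt_1 by simp
      moreover have "\<bar>A$2$1\<bar> = int p * c" using B(2,3) c by simp
      ultimately have "\<bar>C$2$1\<bar> < \<bar>A$2$1\<bar>" by (simp add: abs_mult)
      moreover have "C \<in> Gamma0 p"
        unfolding C_def using B(1) H_mat_Gamma0 k
        by (intro Gamma0_mult) (auto simp: Gamma0_def)
      ultimately have "C \<in> K" by (intro less.hyps) auto
      then have "C ** adj (H_mat k) ** adj (mat2 1 n 0 1) \<in> K"
        using mult adj H k Tn by blast
      moreover have "C ** adj (H_mat k) ** adj (mat2 1 n 0 1) = B"
      proof -
        have "C ** adj (H_mat k) ** adj (mat2 1 n 0 1) =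
            B ** (mat2 1 n 0 1 ** (H_mat k ** adj (H_mat k)) ** adj (mat2 1 n 0 1))"
          unfolding C_def by (simp only: matrix_mul_assoc)
        then show ?thesis using k by (simp add: mult_adj flip: mat2_one)
      qed
      ultimately show ?thesis by simp
    qed
    show ?case
    proof (cases "A$2$1 \<ge> 0")
      case True
      then show ?thesis using pos less.prems by simp
    next
      case False
      then have "- A \<in> K" using less.prems by (intro pos Gamma0_uminus) auto
      then show ?thesis using negK[of "- A"] by simp
    qed
  qed
qed

end

declare One_nat_def [simp del]

context prime_level
begin

lemma p_pos [simp]: "0 < p" and p_nonzero [simp]: "p \<noteq> 0"
  using p_gt_1 by simp_all

lemma extends_smoothly_P1_iff: "extends_smoothly_P1 p s \<phi> \<longleftrightarrow> smooth_P1 s \<phi>"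
proof
  assume "extends_smoothly_P1 p s \<phi>"
  then obtain A where A: "A \<in> Gamma0 p" "\<not> stabilizes_infinity (psl A)" "smooth \<phi>"
    "smooth (tau s (psl A) \<phi>)"
    unfolding extends_smoothly_P1_def carrier_PGamma0 by blast
  have "A$2$1 \<noteq> 0" using A(2) by (auto simp: stabilizes_infinity_def psl_eq)
  then have "adj A $ 2 $ 1 \<noteq> 0" by (simp add: adj_def)
  then show "smooth_P1 s \<phi>"
    using A(3,4) Gamma0_det[OF A(1)] by (intro smooth_P1I[of \<phi> s "adj A"]) (auto simp: tau_psl)
next
  assume \<phi>: "smooth_P1 s \<phi>"
  have k: "1 \<le> (1::nat)" "1 \<le> p - 1" using p_gt_1 by auto
  have "smooth (tau s (psl (H_mat 1)) \<phi>)"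
    using smooth_P1_slash_smooth[OF \<phi>, of "adj (H_mat 1)"] det_H_mat[OF k]
    by (simp add: tau_psl)
  moreover have "\<not> stabilizes_infinity (psl (H_mat 1))"
    using p_gt_1 by (simp add: stabilizes_infinity_def psl_eq H_mat_def)
  moreover have "smooth \<phi>" using \<phi> by (simp add: smooth_P1_def)
  ultimately show "extends_smoothly_P1 p s \<phi>"
    unfolding extends_smoothly_P1_def carrier_PGamma0 using H_mat_Gamma0[OF k] by blast
qed

lemma V_space_eq: "V_space p s = V s"
  unfolding V_space_def V_def
  by (auto simp: extends_smoothly_P1_iff real_analytic_on_iff smooth_P1_def)

section \<open>The period equation as a three-term equation indexed by classes of rows\<close>

definition rep :: "nat \<Rightarrow> int \<times> int" where
  "rep j = (if j = p then (0, 1) else (1, int j))"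

lemma row_rep: "row (fst (rep j)) (snd (rep j))"
  using p_gt_1 by (auto simp: row_def rep_def)

lemma row_class_rep: "j \<le> p \<Longrightarrow> row_class (fst (rep j)) (snd (rep j)) = j"
  by (auto simp: rep_def)

lemma row_T: "row a b \<Longrightarrow> row a (b - a)" and row_L: "row a b \<Longrightarrow> row (a - b) b"
  and row_S: "row a b \<Longrightarrow> row b (- a)"
  unfolding row_def by (auto simp: dvd_diff_left_iff dvd_diff_right_iff)

lemma row_class_T_eq_iff:
  "row a b \<Longrightarrow> row a' b' \<Longrightarrow> row_class a (b - a) = row_class a' (b' - a') \<longleftrightarrow> row_class a b = row_class a' b'"
  by (simp add: row_class_eq_iff row_T algebra_simps)

lemma row_class_L_eq_iff:
  "row a b \<Longrightarrow> row a' b' \<Longrightarrow> row_class (a - b) b = row_class (a' - b') b' \<longleftrightarrow> row_class a b = row_class a' b'"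
  by (simp add: row_class_eq_iff row_L algebra_simps)

lemma row_class_S_eq_iff:
  "row a b \<Longrightarrow> row a' b' \<Longrightarrow> row_class b (- a) = row_class b' (- a') \<longleftrightarrow> row_class a b = row_class a' b'"
  by (subst (1 2) row_class_eq_iff)
    (auto simp: row_S algebra_simps dvd_diff_commute)

lemma row_class_scale:
  assumes "row a b" "row a' b'" "int p dvd a * b' - a' * b" shows "row_class a b = row_class a' b'"
  using assms row_class_eq_iff by blast

text \<open>\<open>T_index\<close>, \<open>L_index\<close> and \<open>S_index\<close> are the
  permutations of the projective line induced by right multiplication of rows with the inverses of
  \<open>T_mat\<close> and \<open>L_mat\<close> and with \<open>S_mat\<close>. The values of the
  first two, computed below, are the index pattern of the transfer operator.\<close>

definition T_index :: "nat \<Rightarrow> nat" where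
  "T_index j = row_class (fst (rep j)) (snd (rep j) - fst (rep j))"

definition L_index :: "nat \<Rightarrow> nat" where
  "L_index j = row_class (fst (rep j) - snd (rep j)) (snd (rep j))"

definition S_index :: "nat \<Rightarrow> nat" where
  "S_index j = row_class (snd (rep j)) (- fst (rep j))"

lemma row_class_T: "row a b \<Longrightarrow> row_class a (b - a) = T_index (row_class a b)"
  unfolding T_index_def
  by (subst row_class_T_eq_iff) (auto simp: row_rep row_class_rep row_class_le)

lemma row_class_L: "row a b \<Longrightarrow> row_class (a - b) b = L_index (row_class a b)"
  unfolding L_index_def
  by (subst row_class_L_eq_iff) (auto simp: row_rep row_class_rep row_class_le)

lemma row_class_S: "row a b \<Longrightarrow> row_class b (- a) = S_index (row_class a b)"
  unfolding S_index_def
  by (subst row_class_S_eq_iff) (auto simp: row_rep row_class_rep row_class_le)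

lemma T_index_le: "T_index j \<le> p" and L_index_le: "L_index j \<le> p"
  by (simp_all add: T_index_def L_index_def row_class_le)

lemma inj_T_index: "inj_on T_index {..p}" and inj_L_index: "inj_on L_index {..p}"
  by (auto simp: inj_on_def T_index_def L_index_def row_class_T_eq_iff row_class_L_eq_iff
      row_rep row_class_rep)

lemma T_index_zero: "T_index 0 = p - 1"
  using p_gt_1 by (auto simp: T_index_def rep_def of_nat_diff intro!: row_class_eqI)

lemma T_index_finite: "1 \<le> j \<Longrightarrow> j < p \<Longrightarrow> T_index j = j - 1"
  using p_gt_1 by (auto simp: T_index_def rep_def of_nat_diff intro!: row_class_eqI)

lemma T_index_infinity: "T_index p = p"
  by (auto simp: T_index_def rep_def)

lemma L_index_zero: "L_index 0 = 0"
  using p_gt_1 by (auto simp: L_index_def rep_def intro!: row_class_eqI)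

lemma L_index_one: "L_index 1 = p"
  using p_gt_1 by (auto simp: L_index_def rep_def)

lemma L_index_infinity: "L_index p = p - 1"
  using p_gt_1 by (auto simp: L_index_def rep_def of_nat_diff intro!: row_class_eqI)

text \<open>The row in question is (- k, k + 1), and (k' - 1)(- k) is congruent to 1 + k because k
  k' is congruent to -1.\<close>

lemma L_index_finite:
  assumes "1 \<le> k" "k < p - 1" shows "L_index (k + 1) = dual_index p k - 1"
proof -
  have k: "1 \<le> k" "k \<le> p - 1" using assms by auto
  note d = dual_index[OF k] dual_gt_1[OF assms]
  have "\<not> int p dvd - int k" using assms nat_dvd_not_less[of k p] by auto
  moreover have "int (dual_index p k - 1) * (- int k) - int (k + 1) = - (int k * int (dual_index p k) + 1)"
    using d by (simp add: of_nat_diff algebra_simps)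
  moreover have "int p dvd - (int k * int (dual_index p k) + 1)"
    using d(3) by (simp only: dvd_minus_iff)
  ultimately have "row_class (- int k) (int (k + 1)) = dual_index p k - 1"
    using d by (intro row_class_eqI) (linarith | simp only:)+
  then show ?thesis using assms by (simp add: L_index_def rep_def)
qed

lemma S_index_zero: "S_index 0 = p"
  using p_gt_1 by (auto simp: S_index_def rep_def)

lemma S_index_infinity: "S_index p = 0"
  using p_gt_1 by (auto simp: S_index_def rep_def intro!: row_class_eqI)

lemma S_index_finite:
  assumes "1 \<le> k" "k \<le> p - 1" shows "S_index k = dual_index p k"
proof -
  note d = dual_index[OF assms]
  have "\<not> int p dvd int k" using assms p_gt_1 nat_dvd_not_less[of k p] by auto
  then have "row_class (int k) (- 1) = dual_index p k"
    using d p_gt_1 by (intro row_class_eqI) (auto simp: mult.commute)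
  then show ?thesis using assms p_gt_1 by (auto simp: S_index_def rep_def)
qed

text \<open>Moebius maps of determinant \<open>p\<close> that carry the positive half-line onto
  \<open>I_dom p j\<close>. Multiplying by the adjugate leaves the scalar \<open>p\<close>, the
  origin of the factors \<open>weight s (real p)\<close> below.\<close>

definition B_mat :: "nat \<Rightarrow> int^2^2" where
  "B_mat j = (if j = p then mat2 0 (- 1) (int p) 0 else mat2 1 (int j) 0 (int p))"

lemma det_B_mat [simp]: "det (B_mat j) = int p" by (simp add: B_mat_def)

lemma B_mat_pos:
  assumes "j \<le> p" "t > 0"
  shows "den (B_mat j) t > 0" "mob (B_mat j) t \<in> I_dom p j"
  using assms p_gt_1 by (auto simp: B_mat_def den_def mob_def I_dom_def field_simps)

lemma adj_B_mat_pos: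
  assumes "j \<le> p" "x \<in> I_dom p j"
  shows "den (adj (B_mat j)) x \<noteq> 0" "mob (adj (B_mat j)) x > 0"
  using assms p_gt_1
  by (auto simp: B_mat_def den_def mob_def I_dom_def field_simps mult_less_0_iff split: if_splits)

lemma open_I_dom: "open (I_dom p j)"
  by (simp add: I_dom_def)

text \<open>In the coordinate of the positive half-line the matrix \<open>X\<close> becomes the
  nonnegative \<open>M\<close>. No pole is met there, so \<open>g\<close> may be a component of a
  period function, about whose behaviour off its interval nothing is assumed.\<close>

lemma slash_B_mat_transport:
  assumes t: "t > 0" and "j \<le> p" "i \<le> p" and M: "nonneg_mat M"
    and eq: "X ** B_mat j = B_mat i ** M \<or> X ** B_mat j = - (B_mat i ** M)"
  shows "slash s (B_mat j) (slash s X g) t = slash s M (slash s (B_mat i) g) t"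
proof -
  have dj: "den (B_mat j) t \<noteq> 0" using B_mat_pos(1)[OF assms(2) t] by simp
  have dM: "den M t \<noteq> 0" using nonneg_mat_pos(1)[OF M t] by simp
  have di: "den (B_mat i) (mob M t) \<noteq> 0"
    using B_mat_pos(1)[OF assms(3) nonneg_mat_pos(2)[OF M t]] by simp
  have den_uminus: "den (- A) u = - den A u" for A u by (simp add: den_def)
  have "den (B_mat i ** M) t \<noteq> 0" using dM di by (simp add: den_mult)
  then have "den (X ** B_mat j) t \<noteq> 0" using eq by (auto simp: den_uminus)
  then have dX: "den X (mob (B_mat j) t) \<noteq> 0" using dj by (simp add: den_mult)
  have "slash s (B_mat j) (slash s X g) t = slash s (X ** B_mat j) g t"
    using slash_mult_regular[OF dj dX] by simp
  also have "slash s (X ** B_mat j) g = slash s (B_mat i ** M) g" using eq by (auto simp: slash_uminus)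
  also have "slash s (B_mat i ** M) g t = slash s M (slash s (B_mat i) g) t"
    using slash_mult_regular[OF dM di] by simp
  finally show ?thesis .
qed

text \<open>The parabolic element h_{p-1} T, which fixes the cusp 0; its inverse is the class of
  T^{-1} h_1.\<close>

definition G_mat :: "int^2^2" where "G_mat = mat2 1 0 (int p) 1"

lemma det_G_mat [simp]: "det G_mat = 1" by (simp add: G_mat_def)

lemma G_mat_Gamma0: "G_mat \<in> Gamma0 p"
  by (simp add: Gamma0_def) (simp add: G_mat_def)

lemma q_index_one: "q_index 1 = 1" and q_index_last: "q_index (p - 1) = 1"
  using p_gt_1 by (simp_all add: q_index_def dual_one dual_last of_nat_diff)

lemma H_mat_one: "H_mat 1 = mat2 (int p - 1) (- 1) (int p) (- 1)"
  using p_gt_1 q_index_one by (simp add: H_mat_def dual_one of_nat_diff)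

lemma H_mat_last: "H_mat (p - 1) = mat2 1 (- 1) (int p) (1 - int p)"
  using p_gt_1 q_index_last dual_last by (simp add: H_mat_def of_nat_diff)

lemma h_last_T: "h_elt p (p - 1) \<otimes>\<^bsub>PSL2Z\<^esub> T_elt = psl G_mat"
  by (simp add: h_elt_eq T_elt_eq psl_mult H_mat_last T_mat_def G_mat_def)

lemma inv_T_h_one: "inv\<^bsub>PSL2Z\<^esub> T_elt \<otimes>\<^bsub>PSL2Z\<^esub> h_elt p 1 = psl (adj G_mat)"
proof -
  have "psl (mat2 (- 1) 0 (int p) (- 1)) = psl (- mat2 (- 1) 0 (int p) (- 1))" by (rule psl_uminus[symmetric])
  then show ?thesis
    using H_mat_one by (simp add: h_elt_eq T_elt_eq psl_inv psl_mult T_mat_def G_mat_def)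
qed

lemma tau_inv_T: "tau s (inv\<^bsub>PSL2Z\<^esub> T_elt) = slash s T_mat"
  by (simp add: T_elt_eq tau_inv_psl)

lemma tau_inv_T_h_one: "tau s (inv\<^bsub>PSL2Z\<^esub> T_elt \<otimes>\<^bsub>PSL2Z\<^esub> h_elt p 1) = slash s G_mat"
  by (simp add: inv_T_h_one tau_psl)

lemma tau_h_last_T: "tau s (h_elt p (p - 1) \<otimes>\<^bsub>PSL2Z\<^esub> T_elt) = slash s (adj G_mat)"
  by (simp add: h_last_T tau_psl)

lemma tau_h:
  assumes "1 \<le> k" "k \<le> p - 1"
  shows "tau s (h_elt p k) = slash s (adj (H_mat k))"
    "tau s (h_elt p (dual_index p k)) = slash s (H_mat k)"
proof -
  show "tau s (h_elt p k) = slash s (adj (H_mat k))"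
    using det_H_mat[OF assms] by (simp add: h_elt_eq tau_psl)
  note d = dual_index(1,2)[OF assms]
  show "tau s (h_elt p (dual_index p k)) = slash s (H_mat k)"
    using det_H_mat[OF d] adj_H_mat[OF d] dual_dual[OF assms]
    by (simp add: h_elt_eq tau_psl slash_uminus)
qed

text \<open>In terms of the functions \<open>slash s (B_mat j) (f j)\<close> on \<open>(0, \<infinity>)\<close> all rows of \<open>f = transfer_op p s f\<close>
  take the same form, Lewis' three-term equation.\<close>

lemma transfer_op_three_term:
  assumes f: "f = transfer_op p s f" and j: "j \<le> p" and t: "t > 0"
  shows "slash s (B_mat j) (f j) t = slash s T_mat (slash s (B_mat (T_index j)) (f (T_index j))) t
    + slash s L_mat (slash s (B_mat (L_index j)) (f (L_index j))) t"
proof -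
  define x where "x = mob (B_mat j) t"
  have xI: "x \<in> I_dom p j" using B_mat_pos(2)[OF j t] by (simp add: x_def)
  have fjx: "f j x = transfer_op p s f j x" using f by simp
  have reg: "slash s (B_mat j) g t = weight s (den (B_mat j) t) * g x" for g
    using B_mat_pos(1)[OF j t] by (simp add: slash_regular x_def)
  have *: ?thesis
    if "f j x = slash s X (f (T_index j)) x + slash s Y (f (L_index j)) x"
      "X ** B_mat j = B_mat (T_index j) ** T_mat \<or> X ** B_mat j = - (B_mat (T_index j) ** T_mat)"
      "Y ** B_mat j = B_mat (L_index j) ** L_mat \<or> Y ** B_mat j = - (B_mat (L_index j) ** L_mat)" for X Y
  proof -
    have "slash s (B_mat j) (f j) t =
      slash s (B_mat j) (slash s X (f (T_index j))) t + slash s (B_mat j) (slash s Y (f (L_index j))) t"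
      by (simp add: reg that(1) distrib_left)
    then show ?thesis
      using slash_B_mat_transport[OF t j T_index_le nonneg_T_mat that(2)]
        slash_B_mat_transport[OF t j L_index_le nonneg_L_mat that(3)] by simp
  qed
  have k1: "1 \<le> p - 1" "p - 1 \<le> p - 1" using p_gt_1 by auto
  consider "j = 0" | "j = p" | "j = 1" | k where "j = k + 1" "1 \<le> k" "k < p - 1"
    using j p_gt_1 by (metis Suc_eq_plus1 Suc_lessI diff_Suc_1 le_neq_implies_less less_diff_conv
        less_one not_less not_less_eq old.nat.exhaust)
  then show ?thesis
  proof cases
    case 1
    have "f j x = slash s T_mat (f (p - 1)) x + slash s G_mat (f 0) x"
      unfolding fjx using xI 1 by (simp add: transfer_op_def tau_inv_T tau_inv_T_h_one add.commute)
    then show ?thesis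
      using 1 p_gt_1 by (intro *[of T_mat G_mat])
        (auto simp: T_index_zero L_index_zero B_mat_def T_mat_def L_mat_def G_mat_def of_nat_diff)
  next
    case 2
    have "f j x = slash s (adj G_mat) (f p) x + slash s (adj (H_mat (p - 1))) (f (p - 1)) x"
      unfolding fjx using xI 2 p_gt_1 tau_h(1)[OF k1]
      by (simp add: transfer_op_def tau_h_last_T add.commute)
    then show ?thesis
      using 2 p_gt_1 H_mat_last
      by (intro *[of "adj G_mat" "adj (H_mat (p - 1))"])
        (auto simp: T_index_infinity L_index_infinity B_mat_def T_mat_def L_mat_def G_mat_def of_nat_diff)
  next
    case 3
    have "f j x = slash s (mat2 1 0 0 1) (f 0) x + slash s (adj G_mat) (f p) x"
      unfolding fjx using xI 3 p_gt_1 by (simp add: transfer_op_def tau_h_last_T)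
    then show ?thesis
      using 3 p_gt_1 T_index_finite[of 1] L_index_one
      by (intro *[of "mat2 1 0 0 1" "adj G_mat"])
        (auto simp: B_mat_def T_mat_def L_mat_def G_mat_def)
  next
    case 4
    have k: "1 \<le> k" "k \<le> p - 1" using 4 by auto
    have "f j x = slash s (mat2 1 0 0 1) (f k) x + slash s (H_mat k) (f (dual_index p k - 1)) x"
    proof -
      have "j \<noteq> 0" "j \<noteq> p" "j \<noteq> 1" "j - 1 = k" using 4 by auto
      then show ?thesis unfolding fjx using xI tau_h(2)[OF k] by (simp add: transfer_op_def)
    qed
    moreover have "H_mat k ** B_mat j = B_mat (dual_index p k - 1) ** L_mat"
      using 4 k q_index[OF k] dual_index[OF k]
      by (auto simp: H_mat_def B_mat_def L_mat_def of_nat_diff algebra_simps)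
    ultimately show ?thesis
      using 4 T_index_finite[of j] L_index_finite[of k]
      by (intro *[of "mat2 1 0 0 1" "H_mat k"]) (auto simp: B_mat_def T_mat_def)
  qed
qed

text \<open>On the positive half-line the whole vector solves Lewis' equation over the finite set of
  classes, and \<open>T_index\<close> and \<open>L_index\<close> permute the classes, so
  \<open>three_term_regularity\<close> applies. Pulling back by the adjugate of
  \<open>B_mat j\<close> returns to \<open>I_dom p j\<close>.\<close>

lemma transfer_op_regularity:
  assumes s: "0 < Re s" and f: "f = transfer_op p s f"
    and V: "\<And>j. j \<le> p \<Longrightarrow> \<exists>\<phi>\<in>V s. \<forall>t\<in>I_dom p j. f j t = \<phi> t"
    and j: "j \<le> p"
  shows "real_analytic_on (f j) (I_dom p j)"
proof -
  define F where "F j = slash s (B_mat j) (f j)" for j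
  obtain \<phi> where \<phi>: "\<And>j. j \<le> p \<Longrightarrow> \<phi> j \<in> V s" "\<And>j t. j \<le> p \<Longrightarrow> t \<in> I_dom p j \<Longrightarrow> f j t = \<phi> j t"
    using V by metis
  define \<Phi> where "\<Phi> j = slash s (B_mat j) (\<phi> j)" for j
  have \<Phi>V: "\<Phi> j \<in> V s" if "j \<le> p" for j unfolding \<Phi>_def using \<phi>(1)[OF that] by (intro V_slash) auto
  have F\<Phi>: "F j t = \<Phi> j t" if "j \<le> p" "t > 0" for j t
    using B_mat_pos[OF that] \<phi>(2)[OF that(1)] by (simp add: F_def \<Phi>_def slash_regular)
  have ev: "\<forall>\<^sub>F u in nhds t. \<Phi> j u = F j u" if "j \<le> p" "t > 0" for j t
    using eventually_nhds_in_open[of "{0<..}" t] that by (auto elim!: eventually_mono simp: F\<Phi>)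
  have an: "analytic_at (F j) t" if "t > 0" "j \<le> p" for t j
  proof (rule three_term_regularity[OF s _ inj_T_index _ inj_L_index])
    show "finite {..p}" "T_index ` {..p} \<subseteq> {..p}" "L_index ` {..p} \<subseteq> {..p}"
      using T_index_le L_index_le by auto
    show "F j t = slash s T_mat (F (T_index j)) t + slash s L_mat (F (L_index j)) t"
      if "j \<in> {..p}" "t > 0" for j t
      unfolding F_def using transfer_op_three_term[OF f _ that(2)] that(1) by simp
    show "isCont (F j) t" if "j \<in> {..p}" "t > 0" for j t
      using smooth_isCont[OF V_smooth[OF \<Phi>V], of j t] isCont_cong[OF ev, of j t] that by simp
    show "finite {t. t > 0 \<and> \<not> analytic_at (F j) t}" if "j \<in> {..p}" for j
    proof -
      have "j \<le> p" using that by simp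
      from \<Phi>V[OF this] obtain E where E: "finite E" "\<And>t. t \<notin> E \<Longrightarrow> analytic_at (\<Phi> j) t"
        unfolding V_def by blast
      have "analytic_at (F j) t" if "t > 0" "t \<notin> E" for t
        by (rule analytic_at_cong[OF E(2)[OF that(2)] ev[OF \<open>j \<le> p\<close> that(1)]])
      then have "{t. t > 0 \<and> \<not> analytic_at (F j) t} \<subseteq> E" by blast
      then show ?thesis using E(1) finite_subset by blast
    qed
  qed (use that in auto)
  show ?thesis
    unfolding real_analytic_on_iff
  proof
    fix x assume x: "x \<in> I_dom p j"
    define A where "A = adj (B_mat j)"
    have BA: "B_mat j ** A = mat2 (int p) 0 0 (int p)" by (simp add: A_def B_mat_def)
    have dA: "den A u \<noteq> 0" "mob A u > 0" if "u \<in> I_dom p j" for u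
      using adj_B_mat_pos[OF j that] by (auto simp: A_def)
    have "analytic_at (\<lambda>u. inverse (weight s (real p)) * slash s A (F j) u) x"
      using dA[OF x] an j by (intro analytic_at_cmult analytic_at_slash) auto
    moreover have "inverse (weight s (real p)) * slash s A (F j) u = f j u" if "u \<in> I_dom p j" for u
    proof -
      have d: "den A u \<noteq> 0" "den (B_mat j) (mob A u) \<noteq> 0"
        using dA[OF that] B_mat_pos(1)[OF j dA(2)[OF that]] by auto
      have "slash s A (F j) u = weight s (real p) * f j u"
        using slash_mult_regular[OF d, of s "f j"] slash_scalar[of "int p" s] p_gt_1
        unfolding F_def BA by simp
      then show ?thesis using weight_nonzero[of "real p" s] p_gt_1 by simp
    qed
    ultimately show "analytic_at (f j) x"
      using eventually_nhds_in_open[OF open_I_dom x]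
      by (intro analytic_at_cong[of "\<lambda>u. inverse (weight s (real p)) * slash s A (F j) u" x "f j"])
        (auto elim!: eventually_mono)
  qed
qed

end

section \<open>The cocycle of a period function\<close>

text \<open>Abstracts the glued components of a period function, now total functions in
  \<open>V s\<close>. \<open>phi_dual\<close> and \<open>phi_infinity\<close> encode the gluing at
  k/p and at 0, while the three-term equation is required only where the original components are
  defined.\<close>

locale period_system = prime_level +
  fixes s :: complex and \<phi> :: "nat \<Rightarrow> real \<Rightarrow> complex"
  assumes phi_V: "j \<le> p \<Longrightarrow> \<phi> j \<in> V s"
    and phi_dual: "1 \<le> k \<Longrightarrow> k \<le> p - 1 \<Longrightarrow>
      slash s (H_mat k) (\<phi> (dual_index p k)) = (\<lambda>t. - \<phi> k t)"
    and phi_infinity: "\<phi> p = (\<lambda>t. - \<phi> 0 t)"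
    and phi_three_term: "j \<le> p \<Longrightarrow> t > 0 \<Longrightarrow> slash s (B_mat j) (\<phi> j) t =
      slash s T_mat (slash s (B_mat (T_index j)) (\<phi> (T_index j))) t +
      slash s L_mat (slash s (B_mat (L_index j)) (\<phi> (L_index j))) t"
begin

definition Phi :: "nat \<Rightarrow> real \<Rightarrow> complex" where
  "Phi j = (\<lambda>t. inverse (weight s (real p)) * slash s (B_mat j) (\<phi> j) t)"

lemma Phi_V: "j \<le> p \<Longrightarrow> Phi j \<in> V s"
  unfolding Phi_def by (intro V_cmult V_slash phi_V) auto

lemma slash_Phi:
  assumes "j \<le> p" "det A \<noteq> 0"
  shows "slash s A (Phi j) = (\<lambda>t. inverse (weight s (real p)) * slash s (B_mat j ** A) (\<phi> j) t)"
  unfolding Phi_def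
  by (subst V_slash_cmult) (use assms in \<open>auto simp: V_slash phi_V V_slash_mult\<close>)

text \<open>Both gluing relations become the same statement in the coordinate of the half-line:
  reversing the edge between infinity and 0 changes the sign. For finite indices the link is the
  matrix identity \<open>H_mat l ** B_mat l = B_mat j ** S_mat\<close>.\<close>

lemma slash_S_Phi:
  assumes "j \<le> p"
  shows "slash s S_mat (Phi j) = (\<lambda>t. - Phi (S_index j) t)"
proof -
  consider "j = 0" | "j = p" | "1 \<le> j" "j \<le> p - 1" using assms by linarith
  then show ?thesis
  proof cases
    case 1
    have "B_mat 0 ** S_mat = B_mat p" by (simp add: B_mat_def S_mat_def)
    then show ?thesis
      using 1 by (simp add: slash_Phi S_index_zero)
        (simp add: Phi_def phi_infinity V_slash_uminus phi_V)
  next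
    case 2
    have "B_mat p ** S_mat = - B_mat 0" by (simp add: B_mat_def S_mat_def)
    then show ?thesis
      using 2 by (simp add: slash_Phi S_index_infinity slash_uminus)
        (simp add: Phi_def phi_infinity V_slash_uminus phi_V)
  next
    case 3
    define l where "l = dual_index p j"
    have l: "1 \<le> l" "l \<le> p - 1" "dual_index p l = j" "S_index j = l"
      using dual_index[OF 3] dual_dual[OF 3] S_index_finite[OF 3] by (auto simp: l_def)
    have m: "H_mat l ** B_mat l = B_mat j ** S_mat"
      using q_index[OF l(1,2)] l 3 by (auto simp: H_mat_def B_mat_def S_mat_def algebra_simps)
    have "\<phi> l = (\<lambda>t. - slash s (H_mat l) (\<phi> j) t)"
      using phi_dual[OF l(1,2)] l(3) by simp
    then have "slash s (B_mat l) (\<phi> l) = (\<lambda>t. - slash s (B_mat j ** S_mat) (\<phi> j) t)"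
      using l 3 by (simp add: V_slash_uminus V_slash phi_V V_slash_mult[symmetric] m)
    then show ?thesis
      using 3 by (simp add: slash_Phi l(4)) (simp add: Phi_def)
  qed
qed

definition Row :: "int \<Rightarrow> int \<Rightarrow> real \<Rightarrow> complex" where
  "Row a b = Phi (row_class a b)"

lemma Row_V: "Row a b \<in> V s"
  by (simp add: Row_def Phi_V row_class_le)

lemma slash_S_Row: "row a b \<Longrightarrow> slash s S_mat (Row a b) = (\<lambda>t. - Row b (- a) t)"
  by (simp add: Row_def slash_S_Phi row_class_S row_class_le)

lemma slash_slash_Row:
  "det A \<noteq> 0 \<Longrightarrow> det B \<noteq> 0 \<Longrightarrow> slash s B (slash s A (Row a b)) = slash s (A ** B) (Row a b)"
  by (simp add: V_slash_mult Row_V)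

lemma Row_uminus: "row a b \<Longrightarrow> Row (- a) (- b) = Row a b"
  unfolding Row_def by (subst row_class_scale[of "- a" "- b" a b]) (auto simp: row_def)

definition Defect :: "int \<Rightarrow> int \<Rightarrow> real \<Rightarrow> complex" where
  "Defect a b = (\<lambda>t. Row a b t - slash s T_mat (Row a (b - a)) t - slash s L_mat (Row (a - b) b) t)"

lemma Defect_V: "Defect a b \<in> V s"
  unfolding Defect_def by (intro V_diff V_slash Row_V) auto

text \<open>\<open>slash s (mat2 0 1 (- 1) (- 1))\<close> permutes the vertices of a Farey triangle cyclically.\<close>

lemma Defect_rotate:
  assumes ab: "row a b"
  shows "Defect a b = slash s (mat2 0 1 (- 1) (- 1)) (Defect (b - a) (- a))"
proof -
  let ?Z = "mat2 0 1 (- 1) (- 1)"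
  have Z: "S_mat ** ?Z = T_mat" "T_mat ** ?Z = - L_mat" "L_mat ** ?Z = - S_mat"
    by (simp_all add: S_mat_def T_mat_def L_mat_def)
  have "slash s ?Z (Defect (b - a) (- a)) =
    (\<lambda>t. slash s ?Z (Row (b - a) (- a)) t - slash s ?Z (slash s T_mat (Row (b - a) (- b))) t
      - slash s ?Z (slash s L_mat (Row b (- a))) t)"
    unfolding Defect_def by (simp add: V_slash_diff V_diff V_slash Row_V)
  also have "slash s ?Z (Row (b - a) (- a)) = (\<lambda>t. - slash s T_mat (Row a (b - a)) t)"
  proof -
    have "Row (b - a) (- a) = (\<lambda>t. - slash s S_mat (Row a (b - a)) t)"
      using slash_S_Row[OF row_T[OF ab]] by simp
    then show ?thesis by (simp add: V_slash_uminus V_slash Row_V slash_slash_Row Z)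
  qed
  also have "slash s ?Z (slash s T_mat (Row (b - a) (- b))) = slash s L_mat (Row (a - b) b)"
    using Row_uminus[OF row_L[OF ab]] by (simp add: slash_slash_Row Z slash_uminus)
  also have "slash s ?Z (slash s L_mat (Row b (- a))) = (\<lambda>t. - Row a b t)"
    using slash_S_Row[OF row_S[OF ab]] Row_uminus[OF ab] by (simp add: slash_slash_Row Z slash_uminus)
  finally show ?thesis unfolding Defect_def by (simp add: algebra_simps fun_eq_iff)
qed

text \<open>The rotation acts by t |-> -1/(t + 1). It takes (-\<infinity>, -1) into (0,
  \<infinity>), where the equation is given, and (-1, 0) into (-\<infinity>, -1); continuity
  supplies the points 0 and -1.\<close>

lemma Defect_eq_zero:
  assumes ab: "row a b" shows "Defect a b = (\<lambda>t. 0)"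
proof (rule V_eqI[OF Defect_V V_zero])
  have pos: "Defect a b t = 0" if "row a b" "t > 0" for a b t
  proof -
    define k where "k = inverse (weight s (real p))"
    have 1: "slash s M (Row a b) t = k * slash s M (slash s (B_mat (row_class a b)) (\<phi> (row_class a b))) t"
      if "det M \<noteq> 0" for M a b t
      unfolding Row_def Phi_def k_def
      by (subst V_slash_cmult) (use that in \<open>auto simp: V_slash phi_V row_class_le\<close>)
    show ?thesis
      unfolding Defect_def using phi_three_term[OF row_class_le that(2), of a b]
      by (simp add: 1 row_class_T[OF that(1)] row_class_L[OF that(1)])
        (simp add: Row_def Phi_def k_def algebra_simps)
  qed
  have rot: "Defect a b t = 0" if "row a b" "t \<noteq> - 1" "Defect (b - a) (- a) (- 1 / (t + 1)) = 0" for a b t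
  proof -
    have d: "den (mat2 0 1 (- 1) (- 1)) t \<noteq> 0" using that(2) by (simp add: den_def)
    have "mob (mat2 0 1 (- 1) (- 1)) t = - 1 / (t + 1)"
      using that(2) by (simp add: mob_def den_def divide_simps)
    then show ?thesis
      using that(3) by (subst Defect_rotate[OF that(1)]) (simp add: slash_regular[OF d])
  qed
  have row_rot: "row (b - a) (- a)" if "row a b" for a b using row_S[OF row_T[OF that]] by simp
  have neg: "Defect a b t = 0" if "row a b" "t < - 1" for a b t
    by (rule rot[OF that(1) _ pos[OF row_rot[OF that(1)]]]) (use that(2) in \<open>auto simp: divide_simps\<close>)
  show "finite {0, - 1 :: real}" by simp
  show "Defect a b t = 0" if "t \<notin> {0, - 1}" for t
  proof -
    have "t \<noteq> 0" "t \<noteq> - 1" using that by auto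
    then consider "t > 0" | "t < - 1" | "- 1 < t" "t < 0" by linarith
    then show ?thesis
    proof cases
      case 3
      then show ?thesis
        by (intro rot[OF ab _ neg[OF row_rot[OF ab]]]) (auto simp: divide_simps)
    qed (use pos neg ab in auto)
  qed
qed

lemma Row_three_term:
  "row a b \<Longrightarrow> Row a b = (\<lambda>t. slash s T_mat (Row a (b - a)) t + slash s L_mat (Row (a - b) b) t)"
  using Defect_eq_zero unfolding Defect_def fun_eq_iff by (simp add: algebra_simps)

section \<open>The closed equivariant cochain, its potential and the cocycle\<close>

definition edge :: "int \<Rightarrow> int \<Rightarrow> int \<Rightarrow> int \<Rightarrow> real \<Rightarrow> complex" where
  "edge a b c d = slash s (mat2 (int p * d) (- b) (- (int p * c)) a) (Row a b)"

lemma row_of_det': "a * d - b * c = 1 \<Longrightarrow> row a b"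
proof -
  assume "a * d - b * c = 1"
  then have "det (mat2 a b c d) = 1" by simp
  from row_of_det[OF this] show ?thesis by simp
qed

text \<open>The matrix in \<open>edge\<close> is the adjugate of M = \<open>mat2 a b c d\<close>
  times diag(p, 1). The inverse of M carries the edge to the one from infinity to 0, and diag(p, 1)
  passes from the coordinate of the group to that of the Farey graph, where k/p becomes the vertex
  k.\<close>

lemma det_edge: "a * d - b * c = 1 \<Longrightarrow> det (mat2 (int p * d) (- b) (- (int p * c)) a) = int p"
proof -
  assume "a * d - b * c = 1"
  then have "int p * (a * d - b * c) = int p" by simp
  then show ?thesis by (simp add: algebra_simps)
qed

lemma edge_V: "a * d - b * c = 1 \<Longrightarrow> edge a b c d \<in> V s"
  unfolding edge_def by (intro V_slash Row_V, subst det_edge) auto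

lemma edge_reverse:
  assumes "a * d - b * c = 1" shows "edge b (- a) d (- c) t = - edge a b c d t"
proof -
  have "Row b (- a) = (\<lambda>t. - slash s S_mat (Row a b) t)"
    using slash_S_Row[OF row_of_det'[OF assms]] by simp
  then have "edge b (- a) d (- c) =
      (\<lambda>t. - slash s (S_mat ** mat2 (- (int p * c)) a (- (int p * d)) b) (Row a b) t)"
    using assms det_edge[of b "- c" "- a" d]
    by (simp add: edge_def V_slash_uminus V_slash Row_V slash_slash_Row algebra_simps)
  then show ?thesis by (simp add: edge_def S_mat_def)
qed

lemma edge_triangle:
  assumes det: "a * d - b * c = 1"
  shows "edge a b c d t = edge a (b - a) c (d - c) t + edge (a - b) b (c - d) d t"
proof -
  let ?X = "mat2 (int p * d) (- b) (- (int p * c)) a"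
  have X: "det ?X \<noteq> 0" using det_edge[OF det] by simp
  have "edge a b c d = (\<lambda>t. slash s ?X (slash s T_mat (Row a (b - a))) t +
      slash s ?X (slash s L_mat (Row (a - b) b)) t)"
    unfolding edge_def
    by (subst Row_three_term[OF row_of_det'[OF det]])
      (intro V_slash_add V_slash Row_V; use X in simp)
  also have "slash s ?X (slash s T_mat (Row a (b - a))) = edge a (b - a) c (d - c)"
    using X by (subst slash_slash_Row) (auto simp: edge_def T_mat_def algebra_simps)
  also have "slash s ?X (slash s L_mat (Row (a - b) b)) = edge (a - b) b (c - d) d"
    using X by (subst slash_slash_Row) (auto simp: edge_def L_mat_def algebra_simps)
  finally show ?thesis by simp
qed

definition is_potential :: "(int \<Rightarrow> int \<Rightarrow> real \<Rightarrow> complex) \<Rightarrow> bool" where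
  "is_potential P \<longleftrightarrow> P 1 0 = (\<lambda>t. 0) \<and> (\<forall>a c. P (- a) (- c) = P a c) \<and>
    (\<forall>a b c d. a * d - b * c = 1 \<longrightarrow> P a c = (\<lambda>t. P b d t - edge a b c d t))"

lemma potential_exists: "\<exists>P. is_potential P"
proof -
  \<comment> \<open>The cochain is integrated separately for each \<open>t\<close>. Membership of
    the potential in \<open>V s\<close> is recovered in \<open>pot_V\<close>, along finite chains of
    edges.\<close>
  have "\<exists>P. P 1 0 = 0 \<and> (\<forall>a c. P (- a) (- c) = P a c) \<and>
    (\<forall>a b c d. a * d - b * c = 1 \<longrightarrow> P b d - P a c = edge a b c d t)" for t
    by (rule farey_potential_exists) (auto intro: edge_reverse edge_triangle)
  then obtain P where P: "\<And>t. P t 1 0 = 0" "\<And>t a c. P t (- a) (- c) = P t a c"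
    "\<And>t a b c d. a * d - b * c = 1 \<Longrightarrow> P t b d - P t a c = edge a b c d t"
    by metis
  have "is_potential (\<lambda>a c t. P t a c)"
    unfolding is_potential_def by (auto simp: P(1,2) P(3)[symmetric])
  then show ?thesis by blast
qed

definition pot :: "int \<Rightarrow> int \<Rightarrow> real \<Rightarrow> complex" where
  "pot = (SOME P. is_potential P)"

lemma pot_infinity [simp]: "pot 1 0 = (\<lambda>t. 0)"
  and pot_uminus: "pot (- a) (- c) = pot a c"
  and pot_step: "a * d - b * c = 1 \<Longrightarrow> pot a c = (\<lambda>t. pot b d t - edge a b c d t)"
proof -
  have "is_potential pot" unfolding pot_def by (rule someI_ex[OF potential_exists])
  then show "pot 1 0 = (\<lambda>t. 0)" "pot (- a) (- c) = pot a c"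
    "a * d - b * c = 1 \<Longrightarrow> pot a c = (\<lambda>t. pot b d t - edge a b c d t)"
    unfolding is_potential_def by blast+
qed

lemma pot_V: "coprime a c \<Longrightarrow> pot a c \<in> V s"
proof (induction a c rule: primitive_vector_induct)
  case (step a b c d)
  then show ?case unfolding pot_step[OF step.hyps] by (intro V_diff edge_V)
qed (simp_all add: V_zero pot_uminus)

text \<open>For \<open>A\<close> in \<open>Gamma0 p\<close> let \<open>A'\<close> be its conjugate with entries \<open>A11\<close>, \<open>p A12\<close>, \<open>A21 / p\<close>,
  \<open>A22\<close>. Edges and potentials live on the orbits of \<open>A'\<close>, and the cocycle is the difference of the
  potentials at the images of \<open>\<infinity>\<close> under the inverse of \<open>A'\<close> and at \<open>\<infinity>\<close>.\<close>

lemma Gamma0_cases: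
  assumes "A \<in> Gamma0 p"
  obtains a b c d where "A = mat2 a b (int p * c) d" "a * d - b * (int p * c) = 1"
proof -
  obtain c where "A$2$1 = int p * c" using assms by (auto simp: Gamma0_def)
  then show ?thesis
    using that[of "A$1$1" "A$1$2" c "A$2$2"] assms mat2_eta[of A] by (simp add: Gamma0_def det_2)
qed

text \<open>The adjugate of the conjugated matrix acts on the edge. Modulo \<open>p\<close> it
  multiplies the upper row by \<delta>, so the class of the row stays the same. The matrices agree
  since diag(p, 1) A = A' diag(p, 1).\<close>

lemma edge_equivariant:
  assumes A: "\<alpha> * \<delta> - \<beta> * (int p * \<gamma>) = 1" and det: "a * d - b * c = 1"
  shows "edge (\<delta> * a - int p * \<beta> * c) (\<delta> * b - int p * \<beta> * d) (\<alpha> * c - \<gamma> * a) (\<alpha> * d - \<gamma> * b) =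
    slash s (mat2 \<alpha> \<beta> (int p * \<gamma>) \<delta>) (edge a b c d)"
proof -
  let ?a = "\<delta> * a - int p * \<beta> * c" and ?b = "\<delta> * b - int p * \<beta> * d"
  let ?c = "\<alpha> * c - \<gamma> * a" and ?d = "\<alpha> * d - \<gamma> * b"
  have "?a * ?d - ?b * ?c = (\<alpha> * \<delta> - \<beta> * (int p * \<gamma>)) * (a * d - b * c)"
    by (simp add: algebra_simps)
  then have det': "?a * ?d - ?b * ?c = 1" using A det by simp
  have "Row ?a ?b = Row a b"
    unfolding Row_def
  proof (subst row_class_scale[OF row_of_det'[OF det'] row_of_det'[OF det]])
    have "?a * b - a * ?b = int p * (\<beta> * (a * d - b * c))" by (simp add: algebra_simps)
    then show "int p dvd ?a * b - a * ?b" by simp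
  qed simp
  moreover have "mat2 (int p * d) (- b) (- (int p * c)) a ** mat2 \<alpha> \<beta> (int p * \<gamma>) \<delta> =
      mat2 (int p * ?d) (- ?b) (- (int p * ?c)) ?a"
    by (simp add: algebra_simps)
  moreover have "slash s (mat2 \<alpha> \<beta> (int p * \<gamma>) \<delta>) (edge a b c d) =
      slash s (mat2 (int p * d) (- b) (- (int p * c)) a ** mat2 \<alpha> \<beta> (int p * \<gamma>) \<delta>) (Row a b)"
    unfolding edge_def by (rule slash_slash_Row; use det_edge[OF det] A in simp)
  ultimately show ?thesis by (simp only: edge_def)
qed

text \<open>As functions of the vertex both sides change in the same way along edges, by
  \<open>edge_equivariant\<close>, and they agree at infinity; the second summand is the constant of
  integration.\<close>

lemma pot_equivariant:
  assumes A: "\<alpha> * \<delta> - \<beta> * (int p * \<gamma>) = 1" and "coprime a c"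
  shows "pot (\<delta> * a - int p * \<beta> * c) (\<alpha> * c - \<gamma> * a) =
    (\<lambda>t. slash s (mat2 \<alpha> \<beta> (int p * \<gamma>) \<delta>) (pot a c) t + pot \<delta> (- \<gamma>) t)"
proof -
  let ?A = "mat2 \<alpha> \<beta> (int p * \<gamma>) \<delta>"
  have A': "det ?A \<noteq> 0" using A by simp
  have "coprime a c \<and> ?thesis"
    using assms(2)
  proof (induction a c rule: primitive_vector_induct)
    case (neg a c)
    then show ?case
      using pot_uminus[of "\<delta> * a - int p * \<beta> * c" "\<alpha> * c - \<gamma> * a"] pot_uminus[of a c]
      by (simp add: algebra_simps)
  next
    case (step a b c d)
    have "coprime a c"
    proof (rule coprimeI)
      fix l assume "l dvd a" "l dvd c"
      then have "l dvd a * d - b * c" by (intro dvd_diff) auto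
      then show "is_unit l" using step.hyps by simp
    qed
    moreover have "(\<delta> * a - int p * \<beta> * c) * (\<alpha> * d - \<gamma> * b) - (\<delta> * b - int p * \<beta> * d) * (\<alpha> * c - \<gamma> * a) =
      (\<alpha> * \<delta> - \<beta> * (int p * \<gamma>)) * (a * d - b * c)" by (simp add: algebra_simps)
    then have "(\<delta> * a - int p * \<beta> * c) * (\<alpha> * d - \<gamma> * b) -
        (\<delta> * b - int p * \<beta> * d) * (\<alpha> * c - \<gamma> * a) = 1" using A step.hyps by simp
    from pot_step[OF this] have "pot (\<delta> * a - int p * \<beta> * c) (\<alpha> * c - \<gamma> * a) =
      (\<lambda>t. slash s ?A (pot b d) t + pot \<delta> (- \<gamma>) t - slash s ?A (edge a b c d) t)"
      using step.IH by (simp add: edge_equivariant[OF A step.hyps])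
    moreover have "slash s ?A (pot a c) = (\<lambda>t. slash s ?A (pot b d) t - slash s ?A (edge a b c d) t)"
      unfolding pot_step[OF step.hyps]
      using step A' by (intro V_slash_diff pot_V edge_V) auto
    ultimately show ?case by (simp add: algebra_simps)
  qed simp
  then show ?thesis ..
qed

definition coc_mat :: "int^2^2 \<Rightarrow> real \<Rightarrow> complex" where
  "coc_mat A = pot (A$2$2) (- (A$2$1 div int p))"

lemma coc_mat_mat2: "coc_mat (mat2 a b (int p * c) d) = pot d (- c)"
  by (simp add: coc_mat_def)

lemma coprime_of_det: "a * d - b * (int p * c) = 1 \<Longrightarrow> coprime d c" for a b c d :: int
proof (rule coprimeI)
  fix l assume *: "a * d - b * (int p * c) = 1" "l dvd d" "l dvd c"
  then have "l dvd a * d - b * (int p * c)" by (intro dvd_diff dvd_mult) auto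
  then show "is_unit l" using * by simp
qed

lemma coc_mat_V: "A \<in> Gamma0 p \<Longrightarrow> coc_mat A \<in> V s"
  by (erule Gamma0_cases) (auto simp: coc_mat_mat2 intro!: pot_V dest: coprime_of_det)

lemma coc_mat_uminus: "A \<in> Gamma0 p \<Longrightarrow> coc_mat (- A) = coc_mat A"
proof (erule Gamma0_cases)
  fix a b c d assume "A = mat2 a b (int p * c) d"
  then show ?thesis
    using coc_mat_mat2[of "- a" "- b" "- c" "- d"] pot_uminus[of d "- c"] by (simp add: coc_mat_mat2)
qed

lemma coc_mat_mult:
  assumes "A \<in> Gamma0 p" "B \<in> Gamma0 p"
  shows "coc_mat (A ** B) = (\<lambda>t. slash s B (coc_mat A) t + coc_mat B t)"
proof -
  obtain a b c d where A: "A = mat2 a b (int p * c) d" "a * d - b * (int p * c) = 1"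
    using assms(1) by (rule Gamma0_cases)
  obtain \<alpha> \<beta> \<gamma> \<delta> where B: "B = mat2 \<alpha> \<beta> (int p * \<gamma>) \<delta>" "\<alpha> * \<delta> - \<beta> * (int p * \<gamma>) = 1"
    using assms(2) by (rule Gamma0_cases)
  have "coprime d (- c)" using coprime_of_det[OF A(2)] by simp
  moreover have "\<delta> * d - int p * \<beta> * (- c) = \<delta> * d + int p * \<beta> * c"
    "\<alpha> * (- c) - \<gamma> * d = - (\<alpha> * c + \<gamma> * d)" by simp_all
  moreover have "coc_mat A = pot d (- c)" "coc_mat B = pot \<delta> (- \<gamma>)"
    by (simp_all only: A(1) B(1) coc_mat_mat2)
  ultimately have "pot (\<delta> * d + int p * \<beta> * c) (- (\<alpha> * c + \<gamma> * d)) =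
      (\<lambda>t. slash s B (coc_mat A) t + coc_mat B t)"
    using pot_equivariant[OF B(2), of d "- c"] by (simp only: B(1))
  moreover have "A ** B = mat2 (a * \<alpha> + b * (int p * \<gamma>)) (a * \<beta> + b * \<delta>)
      (int p * (\<alpha> * c + \<gamma> * d)) (\<delta> * d + int p * \<beta> * c)"
    by (simp add: A B algebra_simps)
  ultimately show ?thesis by (simp only: coc_mat_mat2)
qed

definition coc :: "(int^2^2) set \<Rightarrow> real \<Rightarrow> complex" where
  "coc g = (if g \<in> carrier (PGamma0 p) then coc_mat (SOME A. A \<in> g) else (\<lambda>t. 0))"

lemma coc_psl: "A \<in> Gamma0 p \<Longrightarrow> coc (psl A) = coc_mat A"
proof -
  assume A: "A \<in> Gamma0 p"
  have "(SOME B. B \<in> psl A) \<in> psl A" by (rule someI[of _ A]) (simp add: psl_eq)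
  then show ?thesis using A coc_mat_uminus[OF A] by (auto simp: coc_def carrier_PGamma0 psl_eq)
qed

lemma coc_Z1: "coc \<in> Z1 p s"
  unfolding Z1_def V_space_eq
proof (intro CollectI conjI ballI allI impI)
  fix g assume "g \<in> carrier (PGamma0 p)"
  then obtain A where "g = psl A" "A \<in> Gamma0 p" by (auto simp: carrier_PGamma0)
  then show "coc g \<in> V s" by (simp add: coc_psl coc_mat_V)
next
  fix g h assume "g \<in> carrier (PGamma0 p)" "h \<in> carrier (PGamma0 p)"
  then obtain A B where "g = psl A" "A \<in> Gamma0 p" "h = psl B" "B \<in> Gamma0 p"
    by (auto simp: carrier_PGamma0)
  then show "coc (g \<otimes>\<^bsub>PSL2Z\<^esub> h) = (\<lambda>t. tau s (inv\<^bsub>PSL2Z\<^esub> h) (coc g) t + coc h t)"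
    by (simp add: psl_mult coc_psl Gamma0_mult coc_mat_mult tau_inv_psl Gamma0_det)
qed (simp add: coc_def)

lemma coc_T: "coc T_elt = (\<lambda>t. 0)"
  by (simp add: T_elt_eq coc_psl T_mat_Gamma0) (simp add: coc_mat_def T_mat_def)

text \<open>The edge from infinity to k returns \<open>\<phi> k\<close> itself: the two rescalings
  multiply to the scalar matrix \<open>p\<close>, whose weight the constant in \<open>Phi\<close>
  cancels.\<close>

lemma pot_finite:
  assumes "k < p" shows "pot (int k) 1 = \<phi> k"
proof -
  have "pot 1 0 = (\<lambda>t. pot (int k) 1 t - edge 1 (int k) 0 1 t)" by (rule pot_step) simp
  then have "pot (int k) 1 = edge 1 (int k) 0 1" by (simp add: fun_eq_iff)
  also have "\<dots> = slash s (mat2 (int p) (- int k) 0 1) (Phi k)"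
    using assms by (simp add: edge_def Row_def)
  also have "\<dots> = (\<lambda>t. inverse (weight s (real p)) * slash s (mat2 (int p) 0 0 (int p)) (\<phi> k) t)"
    using assms by (simp add: slash_Phi B_mat_def)
  also have "\<dots> = \<phi> k"
    using weight_nonzero[of "real p" s] by (simp add: slash_scalar mult.assoc[symmetric])
  finally show ?thesis .
qed

lemma coc_h:
  assumes "1 \<le> k" "k \<le> p - 1" shows "coc (h_elt p k) = \<phi> k"
proof -
  have "coc (h_elt p k) = pot (- int k) (- 1)"
    using coc_mat_mat2[of "int (dual_index p k)" "- q_index k" 1 "- int k"]
    by (simp add: h_elt_eq coc_psl H_mat_Gamma0 assms) (simp add: H_mat_def)
  then show ?thesis using pot_uminus[of "int k" 1] pot_finite[of k] assms by simp
qed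

text \<open>The conjugate of \<open>G_mat\<close> fixes the vertex 0/1, so equivariance of the
  potential at this vertex computes the cocycle.\<close>

lemma coc_G: "coc (psl G_mat) = (\<lambda>t. \<phi> 0 t - slash s G_mat (\<phi> 0) t)"
proof -
  have "pot 0 1 = (\<lambda>t. slash s G_mat (pot 0 1) t + pot 1 (- 1) t)"
    using pot_equivariant[of 1 1 0 1 0 1] by (simp add: G_mat_def)
  moreover have "coc (psl G_mat) = pot 1 (- 1)"
    using coc_mat_mat2[of 1 0 1 1] by (simp add: coc_psl G_mat_Gamma0) (simp add: G_mat_def)
  moreover have "pot 0 1 = \<phi> 0" using pot_finite[of 0] by simp
  ultimately have "\<phi> 0 = (\<lambda>t. slash s G_mat (\<phi> 0) t + coc (psl G_mat) t)" by (simp only:)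
  then show ?thesis by (metis add_diff_cancel_left')
qed

text \<open>A parabolic element fixes a primitive vector \<open>u\<close> up to sign; the potential at \<open>u\<close>
  trivializes the cocycle on it.\<close>

lemma coc_parabolic:
  assumes A: "A \<in> Gamma0 p" and tr: "\<bar>trace A\<bar> = 2"
  shows "\<exists>\<psi>\<in>V s. coc_mat A = (\<lambda>t. slash s A \<psi> t - \<psi> t)"
proof -
  obtain \<alpha> \<beta> \<gamma> \<delta> where A': "A = mat2 \<alpha> \<beta> (int p * \<gamma>) \<delta>" "\<alpha> * \<delta> - \<beta> * (int p * \<gamma>) = 1"
    using A by (rule Gamma0_cases)
  have "trace A = \<alpha> + \<delta>" by (simp add: A' trace_def sum_2)
  then have "\<alpha> + \<delta> = 2 * 1 \<or> \<alpha> + \<delta> = 2 * (- 1)" using tr by arith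
  then obtain \<epsilon> where \<epsilon>: "\<alpha> + \<delta> = 2 * \<epsilon>" "\<epsilon> = 1 \<or> \<epsilon> = - 1" by blast
  have "\<exists>a c. coprime a c \<and> \<delta> * a - int p * \<beta> * c = \<epsilon> * a \<and> \<alpha> * c - \<gamma> * a = \<epsilon> * c"
  proof (cases "\<gamma> = 0")
    case True
    then have "\<alpha> * \<delta> = 1" using A' by simp
    then have "\<delta> = \<epsilon>" using \<epsilon> by (auto simp: zmult_eq_1_iff)
    then show ?thesis using True by (intro exI[of _ 1] exI[of _ 0]) simp
  next
    case False
    \<comment> \<open>First column of the adjugate of A' minus \<epsilon>. Since \<epsilon> is its
      double eigenvalue, the Cayley-Hamilton theorem makes this column an eigenvector, and division
      by the gcd makes it primitive.\<close>
    define x y where "x = \<delta> - \<epsilon>" and "y = - \<gamma>"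
    define g where "g = gcd x y"
    have g: "g \<noteq> 0" using False by (simp add: g_def y_def)
    define a c where "a = x div g" and "c = y div g"
    have ga: "x = g * a" "y = g * c" by (simp_all add: a_def c_def g_def)
    have cop: "coprime a c" unfolding a_def c_def g_def
      using False by (intro div_gcd_coprime) (simp add: y_def)
    have e2: "\<epsilon> * \<epsilon> = 1" using \<epsilon>(2) by auto
    have al: "\<alpha> = 2 * \<epsilon> - \<delta>" using \<epsilon>(1) by simp
    have "\<delta> * x - int p * \<beta> * y = \<epsilon> * x"
      using A'(2) e2 unfolding x_def y_def al by (simp add: algebra_simps)
    then have "g * (\<delta> * a - int p * \<beta> * c) = g * (\<epsilon> * a)" by (simp add: ga algebra_simps)
    then have 1: "\<delta> * a - int p * \<beta> * c = \<epsilon> * a" using g by simp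
    have "\<alpha> * y - \<gamma> * x = \<epsilon> * y" unfolding x_def y_def al by (simp add: algebra_simps)
    then have "g * (\<alpha> * c - \<gamma> * a) = g * (\<epsilon> * c)" by (simp add: ga algebra_simps)
    then have "\<alpha> * c - \<gamma> * a = \<epsilon> * c" using g by simp
    then show ?thesis using cop 1 by blast
  qed
  then obtain a c where ac: "coprime a c" "\<delta> * a - int p * \<beta> * c = \<epsilon> * a" "\<alpha> * c - \<gamma> * a = \<epsilon> * c"
    by blast
  have "pot (\<epsilon> * a) (\<epsilon> * c) = pot a c" using \<epsilon>(2) pot_uminus by auto
  then have "pot a c = (\<lambda>t. slash s A (pot a c) t + coc_mat A t)"
    using pot_equivariant[OF A'(2) ac(1)] unfolding ac(2,3) A'(1) coc_mat_mat2 by simp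
  then have "coc_mat A = (\<lambda>t. pot a c t - slash s A (pot a c) t)"
    by (simp add: fun_eq_iff algebra_simps)
  also have "\<dots> = (\<lambda>t. slash s A (\<lambda>t. - pot a c t) t - (- pot a c t))"
    using pot_V[OF ac(1)] Gamma0_det[OF A] by (simp add: V_slash_uminus)
  finally show ?thesis using V_uminus[OF pot_V[OF ac(1)]] by blast
qed

lemma coc_Z1_par: "coc \<in> Z1_par p s"
  unfolding Z1_par_def V_space_eq
proof (intro CollectI conjI coc_Z1 ballI impI)
  fix g assume g: "g \<in> carrier (PGamma0 p)" "parabolic g"
  then obtain A where A: "g = psl A" "A \<in> Gamma0 p" by (auto simp: carrier_PGamma0)
  then have "\<bar>trace A\<bar> = 2" using g(2) by (simp add: parabolic_def psl_eq)
  then show "\<exists>\<psi>\<in>V s. coc g = (\<lambda>t. tau s (inv\<^bsub>PSL2Z\<^esub> g) \<psi> t - \<psi> t)"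
    using coc_parabolic[OF A(2)]
    by (simp add: A(1) coc_psl[OF A(2)] tau_inv_psl[OF Gamma0_det[OF A(2)]])
qed

end

context prime_level
begin

lemma Z1_V: "c \<in> Z1 p s \<Longrightarrow> A \<in> Gamma0 p \<Longrightarrow> c (psl A) \<in> V s"
  by (auto simp: Z1_def carrier_PGamma0 V_space_eq)

lemma Z1_mult:
  assumes "c \<in> Z1 p s" "A \<in> Gamma0 p" "B \<in> Gamma0 p"
  shows "c (psl (A ** B)) = (\<lambda>t. slash s B (c (psl A)) t + c (psl B) t)"
proof -
  have "c (psl A \<otimes>\<^bsub>PSL2Z\<^esub> psl B) = (\<lambda>t. tau s (inv\<^bsub>PSL2Z\<^esub> psl B) (c (psl A)) t + c (psl B) t)"
    using assms unfolding Z1_def carrier_PGamma0 by blast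
  then show ?thesis using Gamma0_det[OF assms(3)] by (simp add: psl_mult tau_inv_psl)
qed

lemma Z1_one: "c \<in> Z1 p s \<Longrightarrow> c (psl (mat 1)) = (\<lambda>t. 0)"
  using Z1_mult[OF _ one_Gamma0 one_Gamma0, of c s] by (simp add: mat2_one fun_eq_iff)

lemma Z1_adj:
  assumes "c \<in> Z1 p s" "A \<in> Gamma0 p"
  shows "c (psl (adj A)) = (\<lambda>t. - slash s (adj A) (c (psl A)) t)"
  using Z1_mult[OF assms Gamma0_adj[OF assms(2)]] mult_adj(1)[OF Gamma0_det[OF assms(2)]]
    Z1_one[OF assms(1)]
  by (simp add: fun_eq_iff eq_neg_iff_add_eq_0 add.commute)

text \<open>The matrices on which two cocycles agree are closed under products and inverses, so
  agreement on the generators suffices.\<close>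

lemma Z1_eqI:
  assumes c: "c \<in> Z1 p s" and c': "c' \<in> Z1 p s" and T: "c T_elt = c' T_elt"
    and h: "\<And>k. 1 \<le> k \<Longrightarrow> k \<le> p - 1 \<Longrightarrow> c (h_elt p k) = c' (h_elt p k)"
  shows "c = c'"
proof
  fix g
  show "c g = c' g"
  proof (cases "g \<in> carrier (PGamma0 p)")
    case True
    then obtain A where A: "g = psl A" "A \<in> Gamma0 p" by (auto simp: carrier_PGamma0)
    have "A \<in> {A \<in> Gamma0 p. c (psl A) = c' (psl A)}"
    proof (rule Gamma0_generated[OF _ _ _ _ _ A(2)])
      show "- mat 1 \<in> {A \<in> Gamma0 p. c (psl A) = c' (psl A)}"
        using Z1_one[OF c] Z1_one[OF c'] by (simp add: Gamma0_uminus one_Gamma0)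
    qed (use T h in \<open>auto simp: Gamma0_mult Gamma0_adj T_mat_Gamma0 H_mat_Gamma0 T_elt_eq h_elt_eq
        Z1_mult[OF c] Z1_mult[OF c'] Z1_adj[OF c] Z1_adj[OF c']\<close>)
    then show ?thesis by (simp add: A)
  next
    case False
    then show ?thesis using c c' by (simp add: Z1_def)
  qed
qed

lemma Z1_h_dual:
  assumes c: "c \<in> Z1 p s" and k: "1 \<le> k" "k \<le> p - 1"
  shows "slash s (H_mat k) (c (h_elt p (dual_index p k))) = (\<lambda>t. - c (h_elt p k) t)"
proof -
  note d = dual_index(1,2)[OF k]
  have "psl (H_mat k) = psl (adj (H_mat (dual_index p k)))"
    using adj_H_mat[OF d] dual_dual[OF k] by simp
  then have "c (h_elt p k) = (\<lambda>t. - slash s (H_mat k) (c (h_elt p (dual_index p k))) t)"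
    using Z1_adj[OF c H_mat_Gamma0[OF d]] adj_H_mat[OF d] dual_dual[OF k]
    by (simp add: h_elt_eq slash_uminus)
  then show ?thesis by simp
qed

section \<open>Period functions\<close>

text \<open>This partial fraction shows that \<open>H_mat k\<close> exchanges the sides: points left
  of k/p land right of k'/p, and conversely. The left half of a gluing condition therefore evaluates
  the dual component inside its own interval.\<close>

lemma mob_H_mat: "1 \<le> k \<Longrightarrow> k \<le> p - 1 \<Longrightarrow> den (H_mat k) t \<noteq> 0 \<Longrightarrow>
    mob (H_mat k) t = real (dual_index p k) / real p - 1 / (real p * den (H_mat k) t)"
proof -
  assume k: "1 \<le> k" "k \<le> p - 1" and d: "den (H_mat k) t \<noteq> 0"
  have "real p * of_int (q_index k) = real k * real (dual_index p k) + 1"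
    using arg_cong[OF q_index[OF k], of real_of_int] by simp
  then have "real p * (real (dual_index p k) * t - of_int (q_index k)) =
      real (dual_index p k) * den (H_mat k) t - 1"
    by (simp add: H_mat_def den_def algebra_simps)
  then have "real (dual_index p k) * t - of_int (q_index k) =
      (real (dual_index p k) * den (H_mat k) t - 1) / real p"
    by (simp add: field_simps)
  moreover have "mob (H_mat k) t =
      (real (dual_index p k) * t - of_int (q_index k)) / den (H_mat k) t"
    by (simp add: mob_def) (simp add: H_mat_def)
  ultimately have "mob (H_mat k) t =
      (real (dual_index p k) * den (H_mat k) t - 1) / real p / den (H_mat k) t" by simp
  then show ?thesis using d by (simp add: diff_divide_distrib)
qed

lemma den_H_mat: "den (H_mat k) t = real p * t - real k"
  by (simp add: den_def H_mat_def)

lemma mob_H_mat_left: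
  assumes "1 \<le> k" "k \<le> p - 1" "t < real k / real p"
  shows "den (H_mat k) t \<noteq> 0" "mob (H_mat k) t > real (dual_index p k) / real p"
proof -
  have d: "den (H_mat k) t < 0" using assms(3) by (simp add: den_H_mat field_simps)
  then show "den (H_mat k) t \<noteq> 0" by simp
  then show "mob (H_mat k) t > real (dual_index p k) / real p"
    using mob_H_mat[OF assms(1,2)] d by (simp add: mult_pos_neg)
qed

lemma mob_H_mat_right:
  assumes "1 \<le> k" "k \<le> p - 1" "t > real k / real p"
  shows "den (H_mat k) t \<noteq> 0" "mob (H_mat k) t < real (dual_index p k) / real p"
proof -
  have d: "den (H_mat k) t > 0" using assms(3) by (simp add: den_H_mat field_simps)
  then show "den (H_mat k) t \<noteq> 0" by simp
  then show "mob (H_mat k) t < real (dual_index p k) / real p"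
    using mob_H_mat[OF assms(1,2)] d by simp
qed

lemma glues_component_iff:
  assumes "1 \<le> k" "k \<le> p - 1"
  shows "glues_component p s f k \<phi> \<longleftrightarrow> (\<forall>t>real k / real p. \<phi> t = f k t) \<and>
    (\<forall>t<real k / real p. \<phi> t = - slash s (H_mat k) (f (dual_index p k)) t)"
  by (simp add: glues_component_def glues_def tau_h(2)[OF assms])

text \<open>Gluing supplies smooth total functions; the work is to derive the duality relation and
  membership in \<open>V s\<close> from the conditions on the two half-lines.\<close>

lemma FE_period_system:
  assumes f: "f \<in> FE p s"
  obtains \<phi> where "period_system p s \<phi>" "\<And>j t. j \<le> p \<Longrightarrow> t \<in> I_dom p j \<Longrightarrow> f j t = \<phi> j t"
    "\<And>k. 1 \<le> k \<Longrightarrow> k \<le> p - 1 \<Longrightarrow> glues_component p s f k (\<phi> k)"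
proof -
  have tr: "f = transfer_op p s f" and an: "\<And>j x. j \<le> p \<Longrightarrow> x \<in> I_dom p j \<Longrightarrow> analytic_at (f j) x"
    using f by (auto simp: FE_def real_analytic_on_iff)
  have "\<forall>k\<in>{1..p-1}. \<exists>\<eta>. smooth \<eta> \<and> glues_component p s f k \<eta>" using f by (simp add: FE_def)
  then obtain \<eta> where \<eta>: "\<And>k. 1 \<le> k \<Longrightarrow> k \<le> p - 1 \<Longrightarrow> smooth (\<eta> k)"
    "\<And>k. 1 \<le> k \<Longrightarrow> k \<le> p - 1 \<Longrightarrow> glues_component p s f k (\<eta> k)"
    by (metis atLeastAtMost_iff)
  obtain \<psi> where \<psi>: "smooth_P1 s \<psi>" "\<And>t. t > 0 \<Longrightarrow> \<psi> t = - f 0 t" "\<And>t. t < 0 \<Longrightarrow> \<psi> t = f p t"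
    using f by (auto simp: FE_def glues_def extends_smoothly_P1_iff)
  define \<phi> where "\<phi> j = (if j = 0 then \<lambda>t. - \<psi> t else if j = p then \<psi> else \<eta> j)" for j
  have \<phi>k: "\<phi> k = \<eta> k" if "1 \<le> k" "k \<le> p - 1" for k using that p_gt_1 by (auto simp: \<phi>_def)
  have agree: "f j t = \<phi> j t" if "j \<le> p" "t \<in> I_dom p j" for j t
  proof -
    consider "j = 0" | "j = p" | "1 \<le> j" "j \<le> p - 1" using \<open>j \<le> p\<close> by linarith
    then show ?thesis
    proof cases
      case 3
      then show ?thesis
        using that \<eta>(2)[OF 3] by (auto simp: \<phi>k glues_component_iff I_dom_def split: if_splits)
    qed (use that \<psi> in \<open>auto simp: \<phi>_def I_dom_def\<close>)
  qed
  have ev: "\<forall>\<^sub>F u in nhds t. f j u = \<phi> j u" if "j \<le> p" "t \<in> I_dom p j" for j t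
    using eventually_nhds_in_open[OF open_I_dom that(2)] that(1) by (auto elim!: eventually_mono simp: agree)
  \<comment> \<open>Left of k/p this is the gluing of \<open>\<eta> k\<close>. Right of it the
    gluing of \<open>\<eta> l\<close> is used at the image point, together with
    \<open>H_mat l ** H_mat k = - mat 1\<close>. The point k/p is the pole, where the limit is
    taken.\<close>
  have dual: "slash s (H_mat k) (\<eta> (dual_index p k)) = (\<lambda>t. - \<eta> k t)" if k: "1 \<le> k" "k \<le> p - 1" for k
  proof
    fix t
    define l where "l = dual_index p k"
    have l: "1 \<le> l" "l \<le> p - 1" "dual_index p l = k"
      using dual_index(1,2)[OF k] dual_dual[OF k] by (auto simp: l_def)
    note gk = \<eta>(2)[OF k, unfolded glues_component_iff[OF k]]
    note gl = \<eta>(2)[OF l(1,2), unfolded glues_component_iff[OF l(1,2)]]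
    have off: "slash s (H_mat k) (\<eta> l) u = - \<eta> k u" if "u \<noteq> real k / real p" for u
    proof (cases "u < real k / real p")
      case True
      note m = mob_H_mat_left[OF k True]
      show ?thesis using gk gl m True by (simp add: slash_regular l_def)
    next
      case False
      then have u: "u > real k / real p" using that by simp
      note m = mob_H_mat_right[OF k u]
      have "mob (H_mat k) u < real l / real p" using m(2) by (simp add: l_def)
      then have "\<eta> l (mob (H_mat k) u) = - slash s (H_mat l) (f k) (mob (H_mat k) u)"
        and d: "den (H_mat l) (mob (H_mat k) u) \<noteq> 0"
        using gl mob_H_mat_left(1)[OF l(1,2)] l(3) by auto
      then have "slash s (H_mat k) (\<eta> l) u = - slash s (H_mat k) (slash s (H_mat l) (f k)) u"
        using m(1) by (simp add: slash_regular)
      also have "\<dots> = - slash s (H_mat l ** H_mat k) (f k) u"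
        using slash_mult_regular[OF m(1) d] by simp
      also have "H_mat l ** H_mat k = - mat 1"
        using mult_adj(2)[of "H_mat k"] adj_H_mat[OF k] det_H_mat[OF k]
        by (metis l_def minus_equation_iff uminus_matrix_mult(1))
      also have "slash s (- mat 1) (f k) = f k" by (simp only: slash_uminus mat2_one slash_one)
      finally show ?thesis using gk u by simp
    qed
    show "slash s (H_mat k) (\<eta> (dual_index p k)) t = - \<eta> k t"
    proof (cases "t = real k / real p")
      case True
      have "\<forall>\<^sub>F u in at t. slash s (H_mat k) (\<eta> l) u = - \<eta> k u"
        using eventually_neq_at_within[of "real k / real p" t] by eventually_elim (rule off)
      moreover have "isCont (\<lambda>t. - \<eta> k t) t" using smooth_isCont[OF \<eta>(1)[OF k]] by simp
      ultimately show ?thesis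
        unfolding l_def[symmetric] using True det_H_mat[OF k]
        by (intro slash_eq_limit[where g = "\<lambda>t. - \<eta> k t"]) (auto simp: den_H_mat)
    qed (use off l_def in simp)
  qed
  \<comment> \<open>The gluing condition provides smoothness on the line only. At infinity it
    follows from duality, since \<open>H_mat l\<close> moves infinity and turns
    \<open>\<eta> k\<close> into minus the smooth function \<open>\<eta> l\<close>.\<close>
  have \<eta>V: "\<eta> k \<in> V s" if k: "1 \<le> k" "k \<le> p - 1" for k
  proof -
    define l where "l = dual_index p k"
    have l: "1 \<le> l" "l \<le> p - 1" "dual_index p l = k"
      using dual_index(1,2)[OF k] dual_dual[OF k] by (auto simp: l_def)
    have "slash s (H_mat l) (\<eta> k) = (\<lambda>t. (- 1) * \<eta> l t)" using dual[OF l(1,2)] l(3) by simp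
    then have "smooth (slash s (H_mat l) (\<eta> k))"
      using smooth_cmult[OF \<eta>(1)[OF l(1,2)], of "- 1"] by simp
    then have 1: "smooth_P1 s (\<eta> k)"
      using \<eta>(1)[OF k] det_H_mat[OF l(1,2)]
      by (intro smooth_P1I[where A = "H_mat l"]) (auto simp: H_mat_def)
    have "analytic_at (\<eta> k) t" if "t \<notin> {real k / real p}" for t
    proof (cases "t > real k / real p")
      case True
      then have "t \<in> I_dom p k" using k p_gt_1 by (auto simp: I_dom_def)
      then show ?thesis using analytic_at_cong[OF an ev, of k t] k by (simp add: \<phi>k)
    next
      case False
      then have t: "t < real k / real p" using that by simp
      note m = mob_H_mat_left[OF k t]
      have "mob (H_mat k) t \<in> I_dom p l" using m(2) l by (auto simp: I_dom_def l_def)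
      then have "analytic_at (\<lambda>u. (- 1) * slash s (H_mat k) (f l) u) t"
        using l by (intro analytic_at_cmult analytic_at_slash m an) auto
      moreover have "\<forall>\<^sub>F u in nhds t. (- 1) * slash s (H_mat k) (f l) u = \<eta> k u"
        using eventually_nhds_in_open[of "{..<real k / real p}" t] t \<eta>(2)[OF k]
        unfolding glues_component_iff[OF k] by (auto elim!: eventually_mono simp: l_def)
      ultimately show ?thesis by (rule analytic_at_cong)
    qed
    then show ?thesis using 1 unfolding V_def by (auto intro: exI[of _ "{real k / real p}"])
  qed
  have \<psi>V: "\<psi> \<in> V s"
  proof -
    have "analytic_at \<psi> t" if "t \<notin> {0}" for t
    proof (cases "t > 0")
      case True
      then have "analytic_at (\<lambda>u. (- 1) * f 0 u) t"
        by (intro analytic_at_cmult an) (auto simp: I_dom_def)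
      moreover have "\<forall>\<^sub>F u in nhds t. (- 1) * f 0 u = \<psi> u"
        using eventually_nhds_in_open[of "{0<..}" t] True by (auto elim!: eventually_mono simp: \<psi>)
      ultimately show ?thesis by (rule analytic_at_cong)
    next
      case False
      then have t: "t < 0" using that by simp
      have "analytic_at (f p) t" using t by (intro an) (auto simp: I_dom_def)
      moreover have "\<forall>\<^sub>F u in nhds t. f p u = \<psi> u"
        using eventually_nhds_in_open[of "{..<0}" t] t by (auto elim!: eventually_mono simp: \<psi>)
      ultimately show ?thesis by (rule analytic_at_cong)
    qed
    then show ?thesis using \<psi>(1) unfolding V_def by (auto intro: exI[of _ "{0}"])
  qed
  have "period_system p s \<phi>"
  proof
    show "\<phi> j \<in> V s" if "j \<le> p" for j
    proof -
      consider "j = 0" | "j = p" | "1 \<le> j" "j \<le> p - 1" using \<open>j \<le> p\<close> by linarith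
      then show ?thesis by cases (use \<psi>V V_uminus[OF \<psi>V] \<eta>V in \<open>auto simp: \<phi>_def\<close>)
    qed
    show "slash s (H_mat k) (\<phi> (dual_index p k)) = (\<lambda>t. - \<phi> k t)" if "1 \<le> k" "k \<le> p - 1" for k
      using dual[OF that] dual_index(1,2)[OF that] that by (simp add: \<phi>k)
    show "\<phi> p = (\<lambda>t. - \<phi> 0 t)" by (simp add: \<phi>_def)
    show "slash s (B_mat j) (\<phi> j) t =
      slash s T_mat (slash s (B_mat (T_index j)) (\<phi> (T_index j))) t +
      slash s L_mat (slash s (B_mat (L_index j)) (\<phi> (L_index j))) t" if "j \<le> p" "t > 0" for j t
    proof -
      \<comment> \<open>Lewis' equation at positive arguments involves the components only inside
        their intervals, where they agree with the glued functions.\<close>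
      have B: "slash s (B_mat i) (\<phi> i) u = slash s (B_mat i) (f i) u" if "i \<le> p" "u > 0" for i u
        using B_mat_pos[OF that] agree[OF that(1)] by (simp add: slash_regular)
      have M: "slash s M (slash s (B_mat i) (\<phi> i)) t = slash s M (slash s (B_mat i) (f i)) t"
        if "i \<le> p" "nonneg_mat M" for i M
        using nonneg_mat_pos[OF that(2) \<open>t > 0\<close>] B[OF that(1)] by (simp add: slash_regular)
      show ?thesis
        using transfer_op_three_term[OF tr that] B[OF that] M T_index_le L_index_le by simp
    qed
  qed
  then show ?thesis using that[of \<phi>] agree \<eta>(2) by (simp add: \<phi>k)
qed

lemma is_cocycle_of_period_unique:
  assumes c: "is_cocycle_of_period p s f c" and c': "is_cocycle_of_period p s f c'"
  shows "c = c'"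
proof (rule Z1_eqI)
  show "c \<in> Z1 p s" "c' \<in> Z1 p s" "c T_elt = c' T_elt"
    using c c' by (auto simp: is_cocycle_of_period_def)
  fix k assume k: "1 \<le> k" "k \<le> p - 1"
  then have *: "smooth (c (h_elt p k))" "smooth (c' (h_elt p k))"
    "glues_component p s f k (c (h_elt p k))" "glues_component p s f k (c' (h_elt p k))"
    using c c' by (auto simp: is_cocycle_of_period_def)
  show "c (h_elt p k) = c' (h_elt p k)"
    by (rule smooth_eqI[OF *(1,2), of "{real k / real p}"])
      (use *(3,4) in \<open>auto simp: glues_component_def glues_def neq_iff\<close>)
qed

lemma FE_cocycle:
  assumes "f \<in> FE p s"
  obtains c \<psi> where "is_cocycle_of_period p s f c" "c \<in> Z1_par p s" "is_cusp_potential p s c \<psi>"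
    "\<And>t. t > 0 \<Longrightarrow> f 0 t = - \<psi> t" "\<And>t. t < 0 \<Longrightarrow> f p t = \<psi> t"
proof -
  obtain \<phi> where \<phi>: "period_system p s \<phi>" "\<And>j t. j \<le> p \<Longrightarrow> t \<in> I_dom p j \<Longrightarrow> f j t = \<phi> j t"
    "\<And>k. 1 \<le> k \<Longrightarrow> k \<le> p - 1 \<Longrightarrow> glues_component p s f k (\<phi> k)"
    using FE_period_system[OF assms] by blast
  interpret period_system p s \<phi> by (rule \<phi>(1))
  show ?thesis
  proof (rule that[of coc "\<phi> p"])
    show "is_cocycle_of_period p s f coc"
      unfolding is_cocycle_of_period_def
      using coc_Z1 coc_T \<phi>(3) V_smooth[OF phi_V] by (auto simp: coc_h)
    show "coc \<in> Z1_par p s" by (rule coc_Z1_par)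
    have "\<phi> 0 \<in> V s" by (simp add: phi_V)
    then show "is_cusp_potential p s coc (\<phi> p)"
      unfolding is_cusp_potential_def h_last_T tau_inv_T_h_one V_space_eq coc_G phi_infinity
      by (simp add: V_uminus V_slash_uminus)
    show "f 0 t = - \<phi> p t" if "t > 0" for t
      using \<phi>(2)[of 0 t] that by (simp add: I_dom_def phi_infinity)
    show "f p t = \<phi> p t" if "t < 0" for t
      using \<phi>(2)[of p t] that p_gt_1 by (simp add: I_dom_def)
  qed
qed

section \<open>From normalized cocycles back to period functions\<close>

lemma dual_index_step:
  assumes "1 \<le> k" "k < p - 1"
  shows "dual_index p (dual_index p k - 1) = dual_index p (k + 1) + 1"
proof -
  define l m where "l = dual_index p k" and "m = dual_index p (k + 1)"
  have k: "1 \<le> k" "k \<le> p - 1" "1 \<le> k + 1" "k + 1 \<le> p - 1" using assms by auto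
  have l: "1 < l" "l \<le> p - 1" "int p dvd int k * int l + 1"
    using dual_index[OF k(1,2)] dual_gt_1[OF assms] by (auto simp: l_def)
  have m: "1 \<le> m" "m \<le> p - 1" "int p dvd int (k + 1) * int m + 1"
    using dual_index[OF k(3,4)] by (auto simp: m_def)
  \<comment> \<open>Hence m + 1 is still an admissible index. Modulo \<open>p\<close> the claim is:
    k' - 1 = -(k + 1)/k has dual k/(k + 1) = 1 - 1/(k + 1).\<close>
  have "m \<noteq> p - 1" using dual_dual[OF k(3,4)] dual_last assms by (auto simp: m_def)
  have "int k * (int (l - 1) * int (m + 1) + 1) =
      int (m + 1) * (int k * int l + 1) - (int (k + 1) * int m + 1)"
    using l(1) by (simp add: of_nat_diff algebra_simps)
  moreover have "int p dvd int (m + 1) * (int k * int l + 1) - (int (k + 1) * int m + 1)"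
    using l(3) m(3) by (intro dvd_diff dvd_mult)
  ultimately have "int p dvd int k * (int (l - 1) * int (m + 1) + 1)" by simp
  moreover have "\<not> int p dvd int k" using k p_gt_1 nat_dvd_not_less[of k p] by auto
  ultimately have "int p dvd int (l - 1) * int (m + 1) + 1"
    using prime_int prime_dvd_mult_iff by blast
  then have "dual_index p (l - 1) = m + 1"
    using l m \<open>m \<noteq> p - 1\<close> by (intro dual_index_eqI) auto
  then show ?thesis by (simp add: l_def m_def)
qed

text \<open>The group relation behind the generic row of the transfer operator: applied to a cocycle
  it expresses the value at h_{k+1} by those at h_k and h_{k'-1}.\<close>

lemma H_mat_step:
  assumes "1 \<le> k" "k < p - 1"
  shows "H_mat (dual_index p k - 1) ** H_mat k = H_mat (k + 1)"
proof -
  define l m where "l = dual_index p k" and "m = dual_index p (k + 1)"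
  have k: "1 \<le> k" "k \<le> p - 1" "1 \<le> k + 1" "k + 1 \<le> p - 1" using assms by auto
  have l: "1 < l" "l \<le> p - 1" using dual_index[OF k(1,2)] dual_gt_1[OF assms] by (auto simp: l_def)
  have l1: "1 \<le> l - 1" "l - 1 \<le> p - 1" using l by auto
  have dl: "dual_index p (l - 1) = m + 1" using dual_index_step[OF assms] by (simp add: l_def m_def)
  have q: "int p * q_index k = int k * int l + 1" "int p * q_index (k + 1) = int (k + 1) * int m + 1"
    "int p * q_index (l - 1) = (int l - 1) * (int m + 1) + 1"
    using q_index[OF k(1,2)] q_index[OF k(3,4)] q_index[OF l1] l by (simp_all add: l_def m_def dl[unfolded l_def m_def] of_nat_diff)
  have 1: "int (m + 1) * int l - q_index (l - 1) * int p = int m"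
    using q(3) by (simp add: algebra_simps)
  \<comment> \<open>Multiplied by \<open>p\<close>, the quotients \<open>q_index\<close> become
    polynomials in the indices.\<close>
  have "int p * (- (int (m + 1) * q_index k) + q_index (l - 1) * int k) = int p * (- q_index (k + 1))"
  proof -
    have "int p * (- (int (m + 1) * q_index k) + q_index (l - 1) * int k) =
        - int (m + 1) * (int p * q_index k) + (int p * q_index (l - 1)) * int k"
      by (simp add: algebra_simps)
    also have "\<dots> = - (int p * q_index (k + 1))" unfolding q by (simp add: algebra_simps)
    finally show ?thesis by simp
  qed
  then have 2: "- (int (m + 1) * q_index k) + q_index (l - 1) * int k = - q_index (k + 1)"
    unfolding mult_cancel_left using p_gt_1 by simp
  have 3: "int p * int l - int (l - 1) * int p = int p" using l by (simp add: of_nat_diff algebra_simps)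
  have 4: "- (int p * q_index k) + int (l - 1) * int k = - int (k + 1)"
    unfolding q using l by (simp add: of_nat_diff algebra_simps)
  show ?thesis
    unfolding l_def[symmetric] using 1 2 3 4
    by (simp add: H_mat_def dl) (simp add: l_def[symmetric] m_def[symmetric])
qed

text \<open>The inverse map for an explicitly given cocycle and potential, before the choices in
  \<open>period_of_class\<close> are known to be unique.\<close>

definition restriction :: "((int^2^2) set \<Rightarrow> real \<Rightarrow> complex) \<Rightarrow> (real \<Rightarrow> complex) \<Rightarrow> nat \<Rightarrow> real \<Rightarrow> complex"
  where "restriction c \<psi> j t = (if t \<notin> I_dom p j then 0 else if j = 0 then - \<psi> t
    else if j = p then \<psi> t else c (h_elt p j) t)"

text \<open>Every row of the equation is an instance of the cocycle relation. Elements of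
  \<open>V s\<close> may have finitely many singularities, so analyticity on the whole intervals is
  obtained at the end, from the equation itself.\<close>

lemma restriction_FE:
  assumes s: "0 < Re s" and c: "c \<in> Z1 p s" and T: "c T_elt = (\<lambda>t. 0)"
    and \<psi>: "is_cusp_potential p s c \<psi>"
  shows "restriction c \<psi> \<in> FE p s" "is_cocycle_of_period p s (restriction c \<psi>) c"
proof -
  define f where "f = restriction c \<psi>"
  have \<psi>V: "\<psi> \<in> V s" and \<psi>G: "c (psl G_mat) = (\<lambda>t. slash s G_mat \<psi> t - \<psi> t)"
    using \<psi> by (simp_all add: is_cusp_potential_def V_space_eq h_last_T tau_inv_T_h_one)
  have hV: "c (h_elt p k) \<in> V s" if "1 \<le> k" "k \<le> p - 1" for k
    using Z1_V[OF c H_mat_Gamma0[OF that]] by (simp add: h_elt_eq)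
  have k1: "1 \<le> p - 1" "p - 1 \<le> p - 1" "1 \<le> (1::nat)" using p_gt_1 by auto
  have f0: "f 0 t = - \<psi> t" if "t > 0" for t
    using that by (simp add: f_def restriction_def I_dom_def)
  have fp: "f p t = \<psi> t" if "t < 0" for t
    using that by (simp add: f_def restriction_def I_dom_def)
  have fk: "f k t = c (h_elt p k) t" if "1 \<le> k" "k \<le> p - 1" "t > real k / real p" for k t
    using that p_gt_1 by (auto simp: f_def restriction_def I_dom_def)
  have "psl G_mat = psl (H_mat (p - 1) ** T_mat)" by (simp add: H_mat_last T_mat_def G_mat_def)
  then have cG: "c (psl G_mat) = slash s T_mat (c (h_elt p (p - 1)))"
    using Z1_mult[OF c H_mat_Gamma0[OF k1(1,2)] T_mat_Gamma0] T by (simp add: T_elt_eq h_elt_eq)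
  \<comment> \<open>Rows 0 and \<open>p\<close> are two readings of \<open>cG\<close>, before and
    after applying the inverse of \<open>G_mat\<close>; row 1 then follows from h_1 being the
    inverse of h_{p-1}.\<close>
  have r0: "- \<psi> t = slash s T_mat (c (h_elt p (p - 1))) t - slash s G_mat \<psi> t" for t
    using fun_cong[OF cG[unfolded \<psi>G], of t] by (simp add: algebra_simps)
  have rp: "\<psi> t = slash s (adj (H_mat (p - 1))) (c (h_elt p (p - 1))) t + slash s (adj G_mat) \<psi> t" for t
  proof -
    have "slash s (adj G_mat) (slash s T_mat (c (h_elt p (p - 1)))) =
        slash s (adj G_mat) (\<lambda>t. slash s G_mat \<psi> t - \<psi> t)"
      using cG \<psi>G by simp
    also have "\<dots> = (\<lambda>t. \<psi> t - slash s (adj G_mat) \<psi> t)"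
      using \<psi>V V_slash_adj(2)[OF \<psi>V, of G_mat] by (simp add: V_slash_diff V_slash)
    also have "slash s (adj G_mat) (slash s T_mat (c (h_elt p (p - 1)))) =
        slash s (T_mat ** adj G_mat) (c (h_elt p (p - 1)))"
      using hV[OF k1(1,2)] by (simp add: V_slash_mult)
    also have "T_mat ** adj G_mat = adj (H_mat (p - 1))"
      by (simp add: H_mat_last T_mat_def G_mat_def)
    finally show ?thesis by (simp add: fun_eq_iff)
  qed
  have r1: "c (h_elt p 1) t = - \<psi> t + slash s (adj G_mat) \<psi> t" for t
  proof -
    have "slash s (adj (H_mat (p - 1))) (c (h_elt p (p - 1))) = (\<lambda>t. - c (h_elt p 1) t)"
      using Z1_h_dual[OF c k1(3,1)] adj_H_mat[OF k1(1,2)] dual_last dual_one by (simp add: slash_uminus)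
    then show ?thesis using rp[of t] by (simp add: algebra_simps)
  qed
  have rk: "c (h_elt p (k + 1)) t =
      c (h_elt p k) t + slash s (H_mat k) (c (h_elt p (dual_index p k - 1))) t"
    if "1 \<le> k" "k < p - 1" for k t
  proof -
    have k: "1 \<le> k" "k \<le> p - 1" "1 \<le> dual_index p k - 1" "dual_index p k - 1 \<le> p - 1"
      using that dual_gt_1[OF that] dual_index(2)[of k] by auto
    show ?thesis
      using Z1_mult[OF c H_mat_Gamma0[OF k(3,4)] H_mat_Gamma0[OF k(1,2)]]
      by (simp add: H_mat_step[OF that] h_elt_eq)
  qed
  \<comment> \<open>The relations above concern total functions. Since \<open>restriction\<close> is
    cut off outside the intervals, each Moebius image has to be shown to lie in the interval of the
    component evaluated there.\<close>
  have tr: "f j x = transfer_op p s f j x" for j x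
  proof (cases "x \<in> I_dom p j")
    case False
    then show ?thesis by (simp add: f_def restriction_def transfer_op_def)
  next
    case x: True
    then have "j \<le> p" by (auto simp: I_dom_def split: if_splits)
    then consider "j = 0" | "j = p" | "j = 1" "p > 1" | k where "j = k + 1" "1 \<le> k" "k < p - 1"
      using p_gt_1 by (metis Suc_eq_plus1 Suc_lessI diff_Suc_1 le_neq_implies_less less_diff_conv
          less_one not_less not_less_eq old.nat.exhaust)
    then show ?thesis
    proof cases
      case 1
      then have x0: "x > 0" using x by (simp add: I_dom_def)
      have d: "den G_mat x \<noteq> 0" "mob G_mat x > 0"
        using x0 p_gt_1 by (auto simp: den_def mob_def G_mat_def add_pos_pos intro!: divide_pos_pos add_pos_pos less_imp_neq[symmetric])
      have "real (p - 1) / real p < x + 1"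
        using x0 p_gt_1 less_trans[of "real (p - 1) / real p" 1 "x + 1"] by simp
      then have "slash s T_mat (f (p - 1)) x = slash s T_mat (c (h_elt p (p - 1))) x"
        using fk[OF k1(1,2), of "x + 1"] by (simp add: T_mat_def slash_shift)
      moreover have "slash s G_mat (f 0) x = - slash s G_mat \<psi> x"
        using d by (simp add: slash_regular f0)
      ultimately show ?thesis
        using 1 x r0[of x] f0[OF x0] by (simp add: transfer_op_def tau_inv_T tau_inv_T_h_one)
    next
      case 2
      then have x0: "x < 0" using x by (simp add: I_dom_def)
      have G: "den (adj G_mat) x > 0" 
        using mult_pos_neg[of "real p" x] x0 by (simp add: den_def G_mat_def)
      have G': "mob (adj G_mat) x < 0" using x0 G by (simp add: mob_def G_mat_def divide_neg_pos)
      have "real 1 / real p > x" using x0 by (meson divide_nonneg_nonneg less_le_trans of_nat_0_le_iff)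
      from mob_H_mat_left[OF k1(3,1) this]
      have H: "den (adj (H_mat (p - 1))) x \<noteq> 0"
        "mob (adj (H_mat (p - 1))) x > real (p - 1) / real p"
        using adj_H_mat[OF k1(1,2)] dual_one dual_last
        by (auto simp: den_def mob_def minus_divide_divide) (smt (verit) minus_divide_divide)
      show ?thesis
        using 2 x x0 p_gt_1 rp[of x] fp[OF x0] tau_h(1)[OF k1(1,2)] G G' H fk[OF k1(1,2) H(2)]
        by (simp add: transfer_op_def tau_h_last_T slash_regular fp)
    next
      case 3
      then have x1: "x > 1 / real p" using x by (simp add: I_dom_def)
      have x0: "x > 0" using x1 p_gt_1 by (meson divide_pos_pos less_trans of_nat_0_less_iff p_pos zero_less_one)
      have G: "den (adj G_mat) x < 0" using x1 by (simp add: den_def G_mat_def field_simps)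
      have "mob (adj G_mat) x < 0" using x0 G by (simp add: mob_def G_mat_def divide_pos_neg)
      then show ?thesis
        using 3 x r1[of x] fk[OF k1(3,1), of x] x1 f0[OF x0] G
        by (simp add: transfer_op_def tau_h_last_T slash_regular fp)
    next
      case 4
      have k: "1 \<le> k" "k \<le> p - 1" "1 \<le> k + 1" "k + 1 \<le> p - 1"
        "1 \<le> dual_index p k - 1" "dual_index p k - 1 \<le> p - 1"
        using 4 dual_gt_1[OF 4(2,3)] dual_index(2)[of k] by auto
      have j: "j \<noteq> 0" "j \<noteq> p" "j \<noteq> 1" "j - 1 = k" using 4 by auto
      have x1: "x > real (k + 1) / real p" using x 4 by (simp add: I_dom_def split: if_splits)
      then have xk: "x > real k / real p"
        by (rule le_less_trans[rotated]) (simp add: divide_right_mono)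
      note m = mob_H_mat_right(1)[OF k(1,2) xk]
      \<comment> \<open>Membership in the interval of index k + 1 makes the denominator exceed 1,
        which keeps k'/p - 1/(p den) above (k' - 1)/p.\<close>
      have den: "den (H_mat k) x > 1" using x1 by (simp add: den_H_mat field_simps)
      have "1 / (real p * den (H_mat k) x) < 1 / real p"
        using den p_gt_1 by (simp add: field_simps)
      then have "mob (H_mat k) x > real (dual_index p k - 1) / real p"
        unfolding mob_H_mat[OF k(1,2) m] using k(5) by (simp add: of_nat_diff diff_divide_distrib)
      from fk[OF k(5,6) this] m
      have "slash s (H_mat k) (f (dual_index p k - 1)) x =
          slash s (H_mat k) (c (h_elt p (dual_index p k - 1))) x" by (simp add: slash_regular)
      then show ?thesis
        using x j rk[OF 4(2,3), of x] fk[OF k(1,2) xk] fk[OF k(3,4) x1] 4(1) tau_h(2)[OF k(1,2)]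
        by (simp add: transfer_op_def)
    qed
  qed
  then have tr': "f = transfer_op p s f" by blast
  have glue: "glues_component p s f k (c (h_elt p k))" if k: "1 \<le> k" "k \<le> p - 1" for k
    unfolding glues_component_iff[OF k]
  proof (intro conjI allI impI)
    fix t assume t: "t < real k / real p"
    note m = mob_H_mat_left[OF k t]
    note d = dual_index(1,2)[OF k]
    show "c (h_elt p k) t = - slash s (H_mat k) (f (dual_index p k)) t"
      using fun_cong[OF Z1_h_dual[OF c k], of t] fk[OF d m(2)] m(1)
      by (simp add: slash_regular minus_equation_iff)
  qed (use fk[OF k] in simp)
  have "\<exists>\<phi>\<in>V s. \<forall>t\<in>I_dom p j. f j t = \<phi> t" if "j \<le> p" for j
  proof -
    consider "j = 0" | "j = p" | "1 \<le> j" "j \<le> p - 1" using \<open>j \<le> p\<close> by linarith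
    then show ?thesis
    proof cases
      case 1
      then show ?thesis
        using V_uminus[OF \<psi>V] f0 by (intro bexI[of _ "\<lambda>t. - \<psi> t"]) (auto simp: I_dom_def)
    next
      case 2
      then show ?thesis using \<psi>V fp by (intro bexI[of _ \<psi>]) (auto simp: I_dom_def)
    next
      case 3
      then show ?thesis using hV[OF 3] fk[OF 3] p_gt_1
        by (intro bexI[of _ "c (h_elt p j)"]) (auto simp: I_dom_def)
    qed
  qed
  then have an: "real_analytic_on (f j) (I_dom p j)" if "j \<le> p" for j
    using transfer_op_regularity[OF s tr' _ that] by blast
  have "f \<in> function_vectors p" by (simp add: function_vectors_def f_def restriction_def)
  moreover have "glues 0 (\<lambda>t. - f 0 t) (f p) \<psi>" by (simp add: glues_def f0 fp)
  moreover have "smooth_P1 s \<psi>" using V_smooth_P1[OF \<psi>V] .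
  moreover have "\<forall>k\<in>{1..p-1}. \<exists>\<phi>. smooth \<phi> \<and> glues_component p s f k \<phi>"
    using glue V_smooth[OF hV] by (meson atLeastAtMost_iff)
  ultimately show "restriction c \<psi> \<in> FE p s"
    unfolding f_def[symmetric] FE_def extends_smoothly_P1_iff using tr' an by auto
  show "is_cocycle_of_period p s (restriction c \<psi>) c"
    unfolding f_def[symmetric] is_cocycle_of_period_def
    using c T glue V_smooth[OF hV] by auto
qed

end

section \<open>Spaces of functions and their quotients\<close>

definition fun_subspace :: "('i \<Rightarrow> real \<Rightarrow> complex) set \<Rightarrow> bool" where
  "fun_subspace X \<longleftrightarrow> (\<lambda>i t. 0) \<in> X \<and> (\<forall>f\<in>X. \<forall>g\<in>X. (\<lambda>i t. f i t + g i t) \<in> X) \<and>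
    (\<forall>a. \<forall>f\<in>X. (\<lambda>i t. a * f i t) \<in> X)"

lemma fun_subspace_add:
  "fun_subspace X \<Longrightarrow> f \<in> X \<Longrightarrow> g \<in> X \<Longrightarrow> (\<lambda>i t. f i t + g i t) \<in> X"
  by (simp add: fun_subspace_def)

lemma fun_subspace_cmult: "fun_subspace X \<Longrightarrow> f \<in> X \<Longrightarrow> (\<lambda>i t. a * f i t) \<in> X"
  by (simp add: fun_subspace_def)

lemma fun_subspace_uminus: "fun_subspace X \<Longrightarrow> f \<in> X \<Longrightarrow> (\<lambda>i t. - f i t) \<in> X"
  using fun_subspace_cmult[of X f "- 1"] by simp

lemma fun_subspace_diff:
  "fun_subspace X \<Longrightarrow> f \<in> X \<Longrightarrow> g \<in> X \<Longrightarrow> (\<lambda>i t. f i t - g i t) \<in> X"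
  using fun_subspace_add[OF _ _ fun_subspace_uminus, of X f g] by simp

lemma cring_complex_field: "cring complex_field"
  using field_complex_field by (simp add: field_def domain_def)

lemma module_fun_space:
  assumes X: "fun_subspace X" shows "module complex_field (fun_space X)"
proof (rule moduleI[OF cring_complex_field])
  show "abelian_group (fun_space X)"
  proof (rule abelian_groupI)
    fix f assume "f \<in> carrier (fun_space X)"
    then have "(\<lambda>i t. - f i t) \<in> X" using fun_subspace_uminus[OF X] by (simp add: fun_space_def)
    then show "\<exists>g\<in>carrier (fun_space X). g \<oplus>\<^bsub>fun_space X\<^esub> f = \<zero>\<^bsub>fun_space X\<^esub>"
      by (intro bexI[of _ "\<lambda>i t. - f i t"]) (auto simp: fun_space_def)
  qed (use X in \<open>auto simp: fun_subspace_def fun_space_def algebra_simps\<close>)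
qed (use X in \<open>auto simp: fun_subspace_def fun_space_def complex_field_def algebra_simps\<close>)

locale fun_quotient =
  fixes X B :: "('i \<Rightarrow> real \<Rightarrow> complex) set"
  assumes X: "fun_subspace X" and B: "fun_subspace B" and sub: "B \<subseteq> X"
begin

abbreviation Q where "Q \<equiv> quotient_space (fun_space X) B"

definition cl :: "('i \<Rightarrow> real \<Rightarrow> complex) \<Rightarrow> ('i \<Rightarrow> real \<Rightarrow> complex) set" where
  "cl x = B +>\<^bsub>fun_space X\<^esub> x"

lemma mem_cl: "y \<in> cl x \<longleftrightarrow> (\<lambda>i t. y i t - x i t) \<in> B"
proof
  assume "y \<in> cl x"
  then obtain b where "b \<in> B" "y = (\<lambda>i t. b i t + x i t)"
    by (auto simp: cl_def a_r_coset_def' fun_space_def)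
  then show "(\<lambda>i t. y i t - x i t) \<in> B" by simp
next
  assume "(\<lambda>i t. y i t - x i t) \<in> B"
  then show "y \<in> cl x"
    by (auto simp: cl_def a_r_coset_def' fun_space_def intro!: bexI[of _ "\<lambda>i t. y i t - x i t"])
qed

lemma cl_self: "x \<in> cl x"
  using B by (simp add: mem_cl fun_subspace_def)

lemma cl_eqI: "(\<lambda>i t. y i t - x i t) \<in> B \<Longrightarrow> cl y = cl x"
proof -
  assume b: "(\<lambda>i t. y i t - x i t) \<in> B"
  have "(\<lambda>i t. z i t - y i t) \<in> B \<longleftrightarrow> (\<lambda>i t. z i t - x i t) \<in> B" for z
  proof
    assume "(\<lambda>i t. z i t - y i t) \<in> B"
    then have "(\<lambda>i t. (z i t - y i t) + (y i t - x i t)) \<in> B"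
      using fun_subspace_add[OF B _ b] by blast
    then show "(\<lambda>i t. z i t - x i t) \<in> B" by simp
  next
    assume "(\<lambda>i t. z i t - x i t) \<in> B"
    from fun_subspace_diff[OF B this b] show "(\<lambda>i t. z i t - y i t) \<in> B" by simp
  qed
  then show ?thesis by (auto simp: mem_cl)
qed

lemma cl_eq_of_mem: "y \<in> cl x \<Longrightarrow> cl y = cl x"
  by (simp add: mem_cl cl_eqI)

lemma carrier_quotient: "carrier (Q) = cl ` X"
  by (auto simp: quotient_space_def A_RCOSETS_def' cl_def fun_space_def)

lemma zero_quotient: "\<zero>\<^bsub>Q\<^esub> = cl (\<lambda>i t. 0)"
  by (auto simp: quotient_space_def mem_cl)

lemma add_quotient:
  "cl x \<oplus>\<^bsub>Q\<^esub> cl y = cl (\<lambda>i t. x i t + y i t)"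
proof -
  have "cl x \<oplus>\<^bsub>Q\<^esub> cl y = {\<lambda>i t. x' i t + y' i t |x' y'. x' \<in> cl x \<and> y' \<in> cl y}"
    by (auto simp: quotient_space_def set_add_def' fun_space_def)
  also have "\<dots> = cl (\<lambda>i t. x i t + y i t)"
  proof (intro equalityI subsetI)
    fix z assume "z \<in> {\<lambda>i t. x' i t + y' i t |x' y'. x' \<in> cl x \<and> y' \<in> cl y}"
    then obtain x' y' where *: "z = (\<lambda>i t. x' i t + y' i t)" "(\<lambda>i t. x' i t - x i t) \<in> B"
      "(\<lambda>i t. y' i t - y i t) \<in> B" by (auto simp: mem_cl)
    have "(\<lambda>i t. (x' i t - x i t) + (y' i t - y i t)) \<in> B"
      by (rule fun_subspace_add[OF B *(2,3)])
    then show "z \<in> cl (\<lambda>i t. x i t + y i t)" by (simp add: mem_cl * algebra_simps)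
  next
    fix z assume "z \<in> cl (\<lambda>i t. x i t + y i t)"
    then have "(\<lambda>i t. z i t - y i t) \<in> cl x" by (simp add: mem_cl algebra_simps)
    then show "z \<in> {\<lambda>i t. x' i t + y' i t |x' y'. x' \<in> cl x \<and> y' \<in> cl y}"
      using cl_self[of y] by (intro CollectI exI[of _ "\<lambda>i t. z i t - y i t"] exI[of _ y]) simp
  qed
  finally show ?thesis .
qed

text \<open>The scalar multiple of a coset is a union over its representatives; all members of this
  union are the same coset.\<close>

lemma smult_quotient:
  "a \<odot>\<^bsub>Q\<^esub> cl x = cl (\<lambda>i t. a * x i t)"
proof -
  have *: "cl (\<lambda>i t. a * z i t) = cl (\<lambda>i t. a * x i t)" if "z \<in> cl x" for z
  proof (rule cl_eqI)
    have "(\<lambda>i t. a * (z i t - x i t)) \<in> B" using that B by (simp add: mem_cl fun_subspace_def)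
    then show "(\<lambda>i t. a * z i t - a * x i t) \<in> B" by (simp add: right_diff_distrib)
  qed
  have "a \<odot>\<^bsub>Q\<^esub> cl x = (\<Union>z\<in>cl x. cl (\<lambda>i t. a * z i t))"
    by (simp add: quotient_space_def cl_def) (simp add: fun_space_def)
  also have "\<dots> = (\<Union>z\<in>cl x. cl (\<lambda>i t. a * x i t))" by (rule SUP_cong[OF refl *])
  also have "\<dots> = cl (\<lambda>i t. a * x i t)" using cl_self[of x] by auto
  finally show ?thesis .
qed

lemma module_quotient: "module complex_field (Q)"
proof (rule moduleI[OF cring_complex_field])
  note add = fun_subspace_add[OF X] and smult = fun_subspace_cmult[OF X]
  have zero: "(\<lambda>i t. 0) \<in> X" using X by (simp add: fun_subspace_def)
  show "abelian_group (Q)"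
  proof (rule abelian_groupI)
    fix C assume "C \<in> carrier (Q)"
    then obtain x where x: "x \<in> X" "C = cl x" by (auto simp: carrier_quotient)
    show "\<exists>D\<in>carrier (Q).
        D \<oplus>\<^bsub>Q\<^esub> C = \<zero>\<^bsub>Q\<^esub>"
      using fun_subspace_uminus[OF X x(1)]
      by (intro bexI[of _ "cl (\<lambda>i t. - x i t)"])
        (auto simp: carrier_quotient x zero_quotient add_quotient)
  qed (use add zero in \<open>auto simp: carrier_quotient zero_quotient add_quotient algebra_simps\<close>)
  show "a \<odot>\<^bsub>Q\<^esub> C \<in> carrier (Q)"
    if "a \<in> carrier complex_field" "C \<in> carrier (Q)" for a C
    using that smult by (auto simp: carrier_quotient smult_quotient)
qed (auto simp: carrier_quotient smult_quotient add_quotient complex_field_def algebra_simps)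

end

section \<open>Parabolic cohomology\<close>

context prime_level
begin

lemma Z1_iff: "c \<in> Z1 p s \<longleftrightarrow> (\<forall>A\<in>Gamma0 p. c (psl A) \<in> V s) \<and>
    (\<forall>g. g \<notin> carrier (PGamma0 p) \<longrightarrow> c g = (\<lambda>t. 0)) \<and>
    (\<forall>A\<in>Gamma0 p. \<forall>B\<in>Gamma0 p. c (psl (A ** B)) = (\<lambda>t. slash s B (c (psl A)) t + c (psl B) t))"
  unfolding Z1_def V_space_eq carrier_PGamma0
  by (simp add: psl_mult tau_inv_psl Gamma0_det cong: ball_cong)

lemma Z1_par_iff: "c \<in> Z1_par p s \<longleftrightarrow> c \<in> Z1 p s \<and> (\<forall>A\<in>Gamma0 p. parabolic (psl A) \<longrightarrow>
    (\<exists>\<psi>\<in>V s. c (psl A) = (\<lambda>t. slash s A \<psi> t - \<psi> t)))"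
  unfolding Z1_par_def V_space_eq carrier_PGamma0
  by (simp add: tau_inv_psl Gamma0_det cong: ball_cong)

definition cobound :: "complex \<Rightarrow> (real \<Rightarrow> complex) \<Rightarrow> (int^2^2) set \<Rightarrow> real \<Rightarrow> complex" where
  "cobound s \<psi> = (\<lambda>g t. if g \<in> carrier (PGamma0 p) then tau s (inv\<^bsub>PSL2Z\<^esub> g) \<psi> t - \<psi> t else 0)"

lemma B1_par_eq: "B1_par p s = cobound s ` V s"
  by (auto simp: B1_par_def cobound_def V_space_eq)

lemma cobound_psl: "A \<in> Gamma0 p \<Longrightarrow> cobound s \<psi> (psl A) = (\<lambda>t. slash s A \<psi> t - \<psi> t)"
  by (simp add: cobound_def carrier_PGamma0 tau_inv_psl Gamma0_det)

lemma cobound_off: "g \<notin> carrier (PGamma0 p) \<Longrightarrow> cobound s \<psi> g = (\<lambda>t. 0)"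
  by (simp add: cobound_def)

lemma Gamma0_ext:
  assumes "\<And>A. A \<in> Gamma0 p \<Longrightarrow> c (psl A) = c' (psl A)"
    "\<And>g. g \<notin> carrier (PGamma0 p) \<Longrightarrow> c g = c' g"
  shows "c = c'"
proof
  fix g show "c g = c' g"
    by (cases "g \<in> carrier (PGamma0 p)") (auto simp: carrier_PGamma0 assms)
qed

lemma Gamma0_det_nonzero: "A \<in> Gamma0 p \<Longrightarrow> det A \<noteq> 0"
  by (simp add: Gamma0_det)

lemma cobound_Z1_par:
  assumes \<psi>: "\<psi> \<in> V s" shows "cobound s \<psi> \<in> Z1_par p s"
  unfolding Z1_par_iff Z1_iff
proof (intro conjI ballI allI impI)
  fix A B assume A: "A \<in> Gamma0 p" and B: "B \<in> Gamma0 p"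
  show "cobound s \<psi> (psl (A ** B)) = (\<lambda>t. slash s B (cobound s \<psi> (psl A)) t + cobound s \<psi> (psl B) t)"
    using \<psi> A B
    by (simp add: cobound_psl Gamma0_mult V_slash_diff V_slash V_slash_mult Gamma0_det_nonzero)
qed (use \<psi> in \<open>auto simp: cobound_psl cobound_off V_diff V_slash Gamma0_det_nonzero\<close>)

lemma fun_subspace_Z1_par: "fun_subspace (Z1_par p s)"
  unfolding fun_subspace_def
proof (intro conjI ballI allI)
  show "(\<lambda>g t. 0) \<in> Z1_par p s"
    unfolding Z1_par_iff Z1_iff by (auto simp: V_zero intro!: bexI[of _ "\<lambda>t. 0"])
  fix c c' assume c: "c \<in> Z1_par p s" and c': "c' \<in> Z1_par p s"
  then have Z: "c \<in> Z1 p s" "c' \<in> Z1 p s" by (simp_all add: Z1_par_iff)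
  show "(\<lambda>g t. c g t + c' g t) \<in> Z1_par p s"
    unfolding Z1_par_iff
  proof (intro conjI ballI impI)
    show "(\<lambda>g t. c g t + c' g t) \<in> Z1 p s"
      using Z unfolding Z1_iff by (auto simp: V_add V_slash_add Gamma0_det_nonzero)
    fix A assume A: "A \<in> Gamma0 p" "parabolic (psl A)"
    then obtain \<psi> \<psi>' where "\<psi> \<in> V s" "c (psl A) = (\<lambda>t. slash s A \<psi> t - \<psi> t)"
      "\<psi>' \<in> V s" "c' (psl A) = (\<lambda>t. slash s A \<psi>' t - \<psi>' t)"
      using c c' unfolding Z1_par_iff by blast
    then show "\<exists>\<psi>\<in>V s. (\<lambda>t. c (psl A) t + c' (psl A) t) = (\<lambda>t. slash s A \<psi> t - \<psi> t)"
      using A by (intro bexI[of _ "\<lambda>t. \<psi> t + \<psi>' t"]) (auto simp: V_add V_slash_add Gamma0_det_nonzero)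
  qed
next
  fix a c assume c: "c \<in> Z1_par p s"
  then have Z: "c \<in> Z1 p s" by (simp add: Z1_par_iff)
  show "(\<lambda>g t. a * c g t) \<in> Z1_par p s"
    unfolding Z1_par_iff
  proof (intro conjI ballI impI)
    show "(\<lambda>g t. a * c g t) \<in> Z1 p s"
      using Z unfolding Z1_iff by (auto simp: V_cmult V_slash_cmult Gamma0_det_nonzero distrib_left)
    fix A assume A: "A \<in> Gamma0 p" "parabolic (psl A)"
    then obtain \<psi> where "\<psi> \<in> V s" "c (psl A) = (\<lambda>t. slash s A \<psi> t - \<psi> t)"
      using c unfolding Z1_par_iff by blast
    then show "\<exists>\<psi>\<in>V s. (\<lambda>t. a * c (psl A) t) = (\<lambda>t. slash s A \<psi> t - \<psi> t)"
      using A by (intro bexI[of _ "\<lambda>t. a * \<psi> t"])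
        (auto simp: V_cmult V_slash_cmult Gamma0_det_nonzero right_diff_distrib)
  qed
qed

lemma cobound_add:
  "\<psi> \<in> V s \<Longrightarrow> \<psi>' \<in> V s \<Longrightarrow>
    (\<lambda>g t. cobound s \<psi> g t + cobound s \<psi>' g t) = cobound s (\<lambda>t. \<psi> t + \<psi>' t)"
  by (rule Gamma0_ext) (auto simp: cobound_psl cobound_off V_slash_add Gamma0_det_nonzero)

lemma cobound_cmult: "\<psi> \<in> V s \<Longrightarrow> (\<lambda>g t. a * cobound s \<psi> g t) = cobound s (\<lambda>t. a * \<psi> t)"
  by (rule Gamma0_ext) (auto simp: cobound_psl cobound_off V_slash_cmult Gamma0_det_nonzero right_diff_distrib)

lemma fun_subspace_B1_par: "fun_subspace (B1_par p s)"
proof -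
  have "(\<lambda>g t. 0) = cobound s (\<lambda>t. 0)"
    by (rule Gamma0_ext) (auto simp: cobound_psl cobound_off)
  then show ?thesis
    unfolding fun_subspace_def B1_par_eq
    by (auto simp: cobound_add cobound_cmult V_add V_cmult V_zero)
qed

sublocale cohomology: fun_quotient "Z1_par p s" "B1_par p s" for s
proof
  show "fun_subspace (Z1_par p s)" by (rule fun_subspace_Z1_par)
  show "fun_subspace (B1_par p s)" by (rule fun_subspace_B1_par)
  show "B1_par p s \<subseteq> Z1_par p s" using cobound_Z1_par by (auto simp: B1_par_eq)
qed

lemma cohomology_class_eq: "cohomology_class p s c = cohomology.cl s c"
  by (simp add: cohomology_class_def cohomology.cl_def)

lemma parabolic_psl:
  "A \<noteq> mat 1 \<Longrightarrow> A \<noteq> - mat 1 \<Longrightarrow> \<bar>trace A\<bar> = 2 \<Longrightarrow> parabolic (psl A)"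
  unfolding parabolic_def one_PSL2Z psl_eq_iff by (auto simp: psl_eq trace_def sum_2)

lemma parabolic_T: "parabolic (psl T_mat)" and parabolic_G: "parabolic (psl G_mat)"
  by (auto intro!: parabolic_psl simp: T_mat_def G_mat_def mat2_one trace_def sum_2)

text \<open>\<open>T_mat\<close> is parabolic, so the value of the cocycle there is a coboundary of
  some \<open>\<psi>\<close>, and the coboundary of \<open>\<psi>\<close> can be subtracted.\<close>

lemma normalized_exists:
  assumes c: "c \<in> Z1_par p s"
  obtains c' where "c' \<in> Z1_par p s" "c' T_elt = (\<lambda>t. 0)" "c' \<in> cohomology.cl s c"
proof -
  obtain \<psi> where \<psi>: "\<psi> \<in> V s" "c (psl T_mat) = (\<lambda>t. slash s T_mat \<psi> t - \<psi> t)"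
    using c T_mat_Gamma0 parabolic_T unfolding Z1_par_iff by blast
  define c' where "c' = (\<lambda>g t. c g t - cobound s \<psi> g t)"
  show ?thesis
  proof (rule that[of c'])
    show "c' \<in> Z1_par p s"
      unfolding c'_def by (rule fun_subspace_diff[OF fun_subspace_Z1_par c cobound_Z1_par[OF \<psi>(1)]])
    show "c' T_elt = (\<lambda>t. 0)"
      by (simp add: c'_def T_elt_eq cobound_psl T_mat_Gamma0 \<psi>(2))
    have "(\<lambda>g t. - cobound s \<psi> g t) \<in> B1_par p s"
      using \<psi>(1) by (intro fun_subspace_uminus fun_subspace_B1_par) (simp add: B1_par_eq)
    then show "c' \<in> cohomology.cl s c" by (simp add: cohomology.mem_cl c'_def)
  qed
qed

text \<open>Two normalized representatives differ by the coboundary of a translation invariant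
  element of \<open>V s\<close>, which vanishes by decay.\<close>

lemma normalized_unique:
  assumes s: "0 < Re s" and "c \<in> cohomology.cl s d" "c' \<in> cohomology.cl s d"
    "c T_elt = (\<lambda>t. 0)" "c' T_elt = (\<lambda>t. 0)"
  shows "c = c'"
proof -
  have "(\<lambda>g t. c g t - c' g t) \<in> B1_par p s"
    using assms(2,3) cohomology.cl_eq_of_mem[of c' s d] cohomology.mem_cl[of c s c'] by simp
  then obtain \<psi> where \<psi>: "\<psi> \<in> V s" "(\<lambda>g t. c g t - c' g t) = cobound s \<psi>"
    by (auto simp: B1_par_eq)
  have "slash s T_mat \<psi> = \<psi>"
    using fun_cong[OF \<psi>(2), of "psl T_mat"] assms(4,5)
    by (simp add: T_elt_eq cobound_psl T_mat_Gamma0 fun_eq_iff)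
  then have "\<psi> = (\<lambda>t. 0)"
    using V_shift_invariant_eq_zero[OF \<psi>(1) s, of 1] by (simp add: T_mat_def)
  then have "cobound s \<psi> = (\<lambda>g t. 0)" by (intro Gamma0_ext) (auto simp: cobound_psl cobound_off)
  then show ?thesis using \<psi>(2) by (simp add: fun_eq_iff)
qed

lemma normalized_representative_eq:
  assumes "0 < Re s" "c T_elt = (\<lambda>t. 0)"
  shows "normalized_representative (cohomology.cl s c) = c"
  unfolding normalized_representative_def is_normalized_representative_def
  using assms cohomology.cl_self normalized_unique[OF assms(1)] by (intro the_equality) blast+

lemma is_cusp_potential_iff:
  "is_cusp_potential p s c \<psi> \<longleftrightarrow> \<psi> \<in> V s \<and> c (psl G_mat) = (\<lambda>t. slash s G_mat \<psi> t - \<psi> t)"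
  by (simp add: is_cusp_potential_def V_space_eq h_last_T tau_inv_T_h_one)

lemma cusp_potential_exists: "c \<in> Z1_par p s \<Longrightarrow> \<exists>\<psi>. is_cusp_potential p s c \<psi>"
  using G_mat_Gamma0 parabolic_G unfolding Z1_par_iff is_cusp_potential_iff by blast

text \<open>The difference of two potentials is invariant under the parabolic \<open>G_mat\<close>
  at the cusp 0.\<close>

lemma cusp_potential_unique:
  assumes s: "0 < Re s" and "is_cusp_potential p s c \<psi>" "is_cusp_potential p s c \<psi>'"
  shows "\<psi> = \<psi>'"
proof -
  have V: "\<psi> \<in> V s" "\<psi>' \<in> V s"
    and eq: "(\<lambda>t. slash s G_mat \<psi> t - \<psi> t) = (\<lambda>t. slash s G_mat \<psi>' t - \<psi>' t)"
    using assms(2,3) unfolding is_cusp_potential_iff by auto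
  have inv: "slash s (mat2 1 0 (int p) 1) (\<lambda>t. \<psi> t - \<psi>' t) = (\<lambda>t. \<psi> t - \<psi>' t)"
    using V eq by (simp add: V_slash_diff fun_eq_iff G_mat_def algebra_simps)
  have "(\<lambda>t. \<psi> t - \<psi>' t) = (\<lambda>t. 0)"
    by (rule V_lower_shift_invariant_eq_zero[OF V_diff[OF V] s _ inv]) simp
  then show ?thesis by (simp add: fun_eq_iff)
qed

lemma cusp_potential_eq:
  "0 < Re s \<Longrightarrow> is_cusp_potential p s c \<psi> \<Longrightarrow> cusp_potential p s c = \<psi>"
  unfolding cusp_potential_def using cusp_potential_unique by (intro the_equality)

lemma period_of_class_eq:
  assumes "0 < Re s" "c T_elt = (\<lambda>t. 0)" "is_cusp_potential p s c \<psi>"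
  shows "period_of_class p s (cohomology.cl s c) = restriction c \<psi>"
  using assms
  by (intro ext) (simp add: period_of_class_def restriction_def normalized_representative_eq
      cusp_potential_eq Let_def)

text \<open>On such pairs both maps are explicit. The pairs form a vector space that parametrizes
  the period functions by \<open>restriction\<close> and the cohomology by classes, so linearity and
  bijectivity can be read off.\<close>

definition normalized_pair ::
    "complex \<Rightarrow> ((int^2^2) set \<Rightarrow> real \<Rightarrow> complex) \<Rightarrow> (real \<Rightarrow> complex) \<Rightarrow> bool" where
  "normalized_pair s c \<psi> \<longleftrightarrow> c \<in> Z1_par p s \<and> c T_elt = (\<lambda>t. 0) \<and> is_cusp_potential p s c \<psi>"

lemma normalized_pair_period:
  "0 < Re s \<Longrightarrow> normalized_pair s c \<psi> \<Longrightarrow>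
    period_of_class p s (cohomology.cl s c) = restriction c \<psi>"
  unfolding normalized_pair_def by (intro period_of_class_eq) auto

lemma cocycle_of_period_eq:
  "is_cocycle_of_period p s f c \<Longrightarrow> cocycle_of_period p s f = c"
  unfolding cocycle_of_period_def using is_cocycle_of_period_unique by (intro the_equality)

lemma normalized_pair_FE:
  assumes "0 < Re s" "normalized_pair s c \<psi>"
  shows "restriction c \<psi> \<in> FE p s" "is_cocycle_of_period p s (restriction c \<psi>) c"
    "cocycle_of_period p s (restriction c \<psi>) = c"
proof -
  have "c \<in> Z1 p s" "c T_elt = (\<lambda>t. 0)" "is_cusp_potential p s c \<psi>"
    using assms(2) by (auto simp: normalized_pair_def Z1_par_iff)
  note * = restriction_FE[OF assms(1) this]
  show "restriction c \<psi> \<in> FE p s" "is_cocycle_of_period p s (restriction c \<psi>) c" by (fact *)+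
  show "cocycle_of_period p s (restriction c \<psi>) = c" by (rule cocycle_of_period_eq[OF *(2)])
qed

lemma FE_normalized_pair:
  assumes f: "f \<in> FE p s"
  obtains c \<psi> where "normalized_pair s c \<psi>" "f = restriction c \<psi>"
proof -
  obtain c \<psi> where c: "is_cocycle_of_period p s f c" "c \<in> Z1_par p s" "is_cusp_potential p s c \<psi>"
    "\<And>t. t > 0 \<Longrightarrow> f 0 t = - \<psi> t" "\<And>t. t < 0 \<Longrightarrow> f p t = \<psi> t"
    using FE_cocycle[OF f] by blast
  have "f j t = restriction c \<psi> j t" for j t
  proof (cases "t \<in> I_dom p j")
    case False
    then show ?thesis using f by (simp add: FE_def function_vectors_def restriction_def)
  next
    case True
    then have "j \<le> p" by (auto simp: I_dom_def split: if_splits)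
    then consider "j = 0" | "j = p" | "1 \<le> j" "j \<le> p - 1" by linarith
    then show ?thesis
    proof cases
      case 3
      then have "glues_component p s f j (c (h_elt p j))" "j \<noteq> p" "j \<noteq> 0" "j < p"
        using c(1) p_gt_1 by (auto simp: is_cocycle_of_period_def)
      then show ?thesis
        using True by (simp add: glues_component_iff[OF 3] restriction_def I_dom_def)
    qed (use True c(4,5) in \<open>auto simp: restriction_def I_dom_def\<close>)
  qed
  then have "f = restriction c \<psi>" by blast
  moreover have "normalized_pair s c \<psi>"
    using c by (simp add: normalized_pair_def is_cocycle_of_period_def)
  ultimately show ?thesis using that by blast
qed

lemma normalized_pair_add:
  assumes "normalized_pair s c \<psi>" "normalized_pair s c' \<psi>'"
  shows "normalized_pair s (\<lambda>g t. c g t + c' g t) (\<lambda>t. \<psi> t + \<psi>' t)"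
  using assms fun_subspace_Z1_par[of s]
  unfolding normalized_pair_def is_cusp_potential_iff fun_subspace_def
  by (simp add: V_add V_slash_add algebra_simps)

lemma normalized_pair_cmult:
  assumes "normalized_pair s c \<psi>"
  shows "normalized_pair s (\<lambda>g t. a * c g t) (\<lambda>t. a * \<psi> t)"
  using assms fun_subspace_Z1_par[of s]
  unfolding normalized_pair_def is_cusp_potential_iff fun_subspace_def
  by (simp add: V_cmult V_slash_cmult right_diff_distrib)

lemma normalized_pair_zero: "normalized_pair s (\<lambda>g t. 0) (\<lambda>t. 0)"
  using fun_subspace_Z1_par[of s]
  unfolding normalized_pair_def is_cusp_potential_iff fun_subspace_def by (simp add: V_zero)

lemma restriction_add: "(\<lambda>j t. restriction c \<psi> j t + restriction c' \<psi>' j t) =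
    restriction (\<lambda>g t. c g t + c' g t) (\<lambda>t. \<psi> t + \<psi>' t)"
  by (auto simp: restriction_def fun_eq_iff)

lemma restriction_cmult: "(\<lambda>j t. a * restriction c \<psi> j t) =
    restriction (\<lambda>g t. a * c g t) (\<lambda>t. a * \<psi> t)"
  by (auto simp: restriction_def fun_eq_iff)

text \<open>Closure is transferred from pairs, whose entries lie in \<open>V s\<close>; this avoids
  adding slashes of functions that are cut off to intervals.\<close>

lemma fun_subspace_FE:
  assumes s: "0 < Re s" shows "fun_subspace (FE p s)"
  unfolding fun_subspace_def
proof (intro conjI ballI allI)
  have "(\<lambda>j t. 0) = restriction (\<lambda>g t. 0) (\<lambda>t. 0)" by (auto simp: restriction_def fun_eq_iff)
  then show "(\<lambda>j t. 0) \<in> FE p s" using normalized_pair_FE(1)[OF s normalized_pair_zero] by simp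
  fix f f' assume "f \<in> FE p s" "f' \<in> FE p s"
  then show "(\<lambda>j t. f j t + f' j t) \<in> FE p s"
    by (elim FE_normalized_pair)
      (simp add: restriction_add normalized_pair_FE(1)[OF s] normalized_pair_add)
next
  fix a f assume "f \<in> FE p s"
  then show "(\<lambda>j t. a * f j t) \<in> FE p s"
    by (elim FE_normalized_pair)
      (simp add: restriction_cmult normalized_pair_FE(1)[OF s] normalized_pair_cmult)
qed

lemma class_normalized_pair:
  assumes "C \<in> carrier (H1_par p s)"
  obtains c \<psi> where "normalized_pair s c \<psi>" "C = cohomology.cl s c"
proof -
  obtain d where d: "d \<in> Z1_par p s" "C = cohomology.cl s d"
    using assms by (auto simp: H1_par_def cohomology.carrier_quotient)
  obtain c where c: "c \<in> Z1_par p s" "c T_elt = (\<lambda>t. 0)" "c \<in> cohomology.cl s d"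
    using normalized_exists[OF d(1)] by blast
  obtain \<psi> where "is_cusp_potential p s c \<psi>" using cusp_potential_exists[OF c(1)] by blast
  then show ?thesis
    using that[of c \<psi>] c cohomology.cl_eq_of_mem[OF c(3)] d(2) by (simp add: normalized_pair_def)
qed

lemma linear_iso_cocycle:
  assumes s: "0 < Re s"
  shows "linear_iso complex_field (fun_space (FE p s)) (H1_par p s)
    (\<lambda>f. cohomology_class p s (cocycle_of_period p s f))"
proof -
  let ?\<Phi> = "\<lambda>f. cohomology.cl s (cocycle_of_period p s f)"
  have car: "carrier (fun_space (FE p s)) = FE p s" by (simp add: fun_space_def)
  have "?\<Phi> (\<lambda>j t. f j t + f' j t) = ?\<Phi> f \<oplus>\<^bsub>H1_par p s\<^esub> ?\<Phi> f'"
    if "f \<in> FE p s" "f' \<in> FE p s" for f f'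
  proof -
    obtain c \<psi> where c: "normalized_pair s c \<psi>" "f = restriction c \<psi>"
      by (rule FE_normalized_pair[OF \<open>f \<in> FE p s\<close>])
    obtain c' \<psi>' where c': "normalized_pair s c' \<psi>'" "f' = restriction c' \<psi>'"
      by (rule FE_normalized_pair[OF \<open>f' \<in> FE p s\<close>])
    show ?thesis
      unfolding c(2) c'(2) restriction_add normalized_pair_FE(3)[OF s c(1)]
        normalized_pair_FE(3)[OF s c'(1)] normalized_pair_FE(3)[OF s normalized_pair_add[OF c(1) c'(1)]]
      by (simp add: H1_par_def cohomology.add_quotient)
  qed
  moreover have "?\<Phi> (\<lambda>j t. a * f j t) = a \<odot>\<^bsub>H1_par p s\<^esub> ?\<Phi> f" if "f \<in> FE p s" for a f
  proof -
    obtain c \<psi> where c: "normalized_pair s c \<psi>" "f = restriction c \<psi>"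
      by (rule FE_normalized_pair[OF \<open>f \<in> FE p s\<close>])
    show ?thesis
      unfolding c(2) restriction_cmult normalized_pair_FE(3)[OF s c(1)]
        normalized_pair_FE(3)[OF s normalized_pair_cmult[OF c(1)]]
      by (simp add: H1_par_def cohomology.smult_quotient)
  qed
  moreover have "bij_betw ?\<Phi> (FE p s) (carrier (H1_par p s))"
  proof (rule bij_betw_byWitness[where f' = "period_of_class p s"])
    show "\<forall>f\<in>FE p s. period_of_class p s (?\<Phi> f) = f"
    proof
      fix f assume "f \<in> FE p s"
      then obtain c \<psi> where c: "normalized_pair s c \<psi>" "f = restriction c \<psi>"
        by (rule FE_normalized_pair)
      show "period_of_class p s (?\<Phi> f) = f"
        unfolding c(2) normalized_pair_FE(3)[OF s c(1)] by (rule normalized_pair_period[OF s c(1)])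
    qed
    show "\<forall>C\<in>carrier (H1_par p s). ?\<Phi> (period_of_class p s C) = C"
    proof
      fix C assume "C \<in> carrier (H1_par p s)"
      then obtain c \<psi> where c: "normalized_pair s c \<psi>" "C = cohomology.cl s c"
        by (rule class_normalized_pair)
      show "?\<Phi> (period_of_class p s C) = C"
        unfolding c(2) normalized_pair_period[OF s c(1)] normalized_pair_FE(3)[OF s c(1)] ..
    qed
    show "?\<Phi> ` FE p s \<subseteq> carrier (H1_par p s)"
    proof
      fix C assume "C \<in> ?\<Phi> ` FE p s"
      then obtain f where "f \<in> FE p s" "C = ?\<Phi> f" by blast
      then obtain c \<psi> where c: "normalized_pair s c \<psi>" "C = ?\<Phi> (restriction c \<psi>)"
        by (metis FE_normalized_pair)
      then show "C \<in> carrier (H1_par p s)"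
        using normalized_pair_FE(3)[OF s c(1)]
        by (simp add: H1_par_def cohomology.carrier_quotient normalized_pair_def)
    qed
    show "period_of_class p s ` carrier (H1_par p s) \<subseteq> FE p s"
    proof
      fix f assume "f \<in> period_of_class p s ` carrier (H1_par p s)"
      then obtain C where "C \<in> carrier (H1_par p s)" "f = period_of_class p s C" by blast
      then obtain c \<psi> where c: "normalized_pair s c \<psi>" "f = period_of_class p s (cohomology.cl s c)"
        by (metis class_normalized_pair)
      then show "f \<in> FE p s"
        using normalized_pair_FE(1)[OF s c(1)] normalized_pair_period[OF s c(1)] by simp
    qed
  qed
  moreover have "module complex_field (H1_par p s)"
    unfolding H1_par_def by (rule cohomology.module_quotient)
  ultimately show ?thesis
    unfolding linear_iso_def cohomology_class_eq car
    using field_complex_field module_fun_space[OF fun_subspace_FE[OF s]]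
    by (simp add: fun_space_def)
qed

end

theorem theorem3p4:
  fixes p :: nat and s :: complex
  assumes "Factorial_Ring.prime p" and "0 < Re s" and "Re s < 1"
  shows
    "(\<forall>f\<in>FE p s. (\<exists>!c. is_cocycle_of_period p s f c) \<and> cocycle_of_period p s f \<in> Z1_par p s) \<and>
     (\<forall>C\<in>carrier (H1_par p s).
        (\<exists>!c. is_normalized_representative C c) \<and>
        (\<exists>!\<psi>. is_cusp_potential p s (normalized_representative C) \<psi>) \<and>
        period_of_class p s C \<in> FE p s) \<and>
     linear_iso complex_field (fun_space (FE p s)) (H1_par p s)
       (\<lambda>f. cohomology_class p s (cocycle_of_period p s f)) \<and>
     (\<forall>f\<in>FE p s. period_of_class p s (cohomology_class p s (cocycle_of_period p s f)) = f) \<and>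
     (\<forall>C\<in>carrier (H1_par p s).
        cohomology_class p s (cocycle_of_period p s (period_of_class p s C)) = C)"
proof -
  interpret prime_level p by standard (rule assms(1))
  note s = assms(2)
  show ?thesis
    unfolding cohomology_class_eq
  proof (intro conjI ballI)
    fix f assume "f \<in> FE p s"
    then obtain c \<psi> where c: "normalized_pair s c \<psi>" "f = restriction c \<psi>"
      by (rule FE_normalized_pair)
    note np = normalized_pair_FE[OF s c(1), folded c(2)]
    show "\<exists>!c. is_cocycle_of_period p s f c"
      using np(2) is_cocycle_of_period_unique by blast
    show "cocycle_of_period p s f \<in> Z1_par p s" using c(1) np(3) by (simp add: normalized_pair_def)
    show "period_of_class p s (cohomology.cl s (cocycle_of_period p s f)) = f"
      unfolding np(3) normalized_pair_period[OF s c(1)] by (simp add: c(2))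
  next
    fix C assume "C \<in> carrier (H1_par p s)"
    then obtain c \<psi> where c: "normalized_pair s c \<psi>" "C = cohomology.cl s c"
      by (rule class_normalized_pair)
    then have T: "c T_elt = (\<lambda>t. 0)" and \<psi>: "is_cusp_potential p s c \<psi>"
      by (auto simp: normalized_pair_def)
    have pc: "period_of_class p s C = restriction c \<psi>"
      unfolding c(2) by (rule normalized_pair_period[OF s c(1)])
    show "\<exists>!c. is_normalized_representative C c"
      unfolding is_normalized_representative_def c(2)
      using cohomology.cl_self T normalized_unique[OF s] by blast
    have "normalized_representative C = c"
      unfolding c(2) by (rule normalized_representative_eq[where c = c, OF s T])
    then show "\<exists>!\<psi>. is_cusp_potential p s (normalized_representative C) \<psi>"
      using \<psi> cusp_potential_unique[OF s] by blast
    show "period_of_class p s C \<in> FE p s"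
      unfolding pc by (rule normalized_pair_FE(1)[OF s c(1)])
    show "cohomology.cl s (cocycle_of_period p s (period_of_class p s C)) = C"
      unfolding pc normalized_pair_FE(3)[OF s c(1)] by (simp add: c(2))
  next
    show "linear_iso complex_field (fun_space (FE p s)) (H1_par p s)
       (\<lambda>f. cohomology.cl s (cocycle_of_period p s f))"
      using linear_iso_cocycle[OF s] by (simp add: cohomology_class_eq)
  qed
qed

end
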